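(* Let $C$ be a finitely based downward closed set of permutations under the consecutive subpermutation ordering, and let $b$ be the maximum length of a basis element of $C$. Then $C$ is well quasi-ordered if and only if the following are satisfied: (i) the factor graph $\Gamma(C)$ has a path-complete decomposition into bicycles $\mathcal{B}_1,\dots,\mathcal{B}_n$; (ii) $\Gamma(C)$ has no ambiguous cycles; and (iii) no bicycle $\mathcal{B}_i$ has a splittable pair.
   Context: PERMUTATIONS. A permutation of length $n$ is a sequence of elements of $\{1,\dots,n\}$ in which every element appears exactly once; $|\sigma|$ is the length, $\sigma|_i$ the $i$th entry and $\sigma|_{[i,j]}$ the subsequence of entries in positions $i,\dots,j$ of a sequence $\sigma$. $S$ is the set of all finite permutations. For a finite sequence $\tau$ of distinct real numbers, $\operatorname{perm}(\tau)$ is the unique permutation of the same length whose entries are in the same relative order as those of $\tau$. $\sigma$ is a consecutive subpermutation of $\tau$, $\sigma\le_f\tau$, if $\sigma=\operatorname{perm}(\tau|_{[i,i+|\sigma|-1]})$ for some $i$. $C\subseteq S$ is downward closed if $\tau\in C$, $\sigma\le_f\tau$ imply $\sigma\in C$. The basis of $C$ is the set of $\le_f$-minimal elements of $S\setminus C$; $C$ is finitely based if its basis is finite (understood to be nonempty, so that $b$ is defined). A poset is well quasi-ordered if it has no infinite strictly decreasing sequences and no infinite antichains; $C$ is ordered by $\le_f$. GRAPHS. In a digraph $G$ (loops allowed), a path is a sequence $v_1\to\dots\to v_k$ ($k\ge1$) with an edge from $v_i$ to $v_{i+1}$ for each $i$ (vertices may repeat), of length $k-1$; it is simple if its vertices are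 distinct, a cycle if $k\ge2$ and $v_1=v_k$, and a simple cycle if moreover $v_1,\dots,v_{k-1}$ are distinct. (So a cycle may wind round repeatedly.) $\operatorname{Path}(G)$ is the set of all paths. A finite collection of subgraphs $H_1,\dots,H_n$ of $G$ is a path-complete decomposition of $G$ if $\operatorname{Path}(G)=\bigcup_i\operatorname{Path}(H_i)$ (the empty collection is allowed if $G$ has no vertices). A bicycle is a digraph consisting precisely of two vertex-disjoint simple cycles (initial and terminal), connected by a simple path (connecting path) from a vertex of the initial cycle to a vertex of the terminal cycle, no internal vertex of which lies on either cycle. Either or both cycles may be absent (so a simple path, or a simple cycle with a simple path leading into it or out of it and otherwise disjoint from it, are bicycles), and a single simple cycle is also a bicycle; if both cycles are present they share no vertex. FACTOR GRAPH. $\Gamma(C)$ is the digraph whose vertices are the permutations of length $b$ in $C$, with $\sigma\to\tau$ precisely when $\operatorname{perm}(\sigma|_{[2,b]})=\operatorname{perm}(\tau|_{[1,b-1]})$. For a permutation $\sigma$ of length $n\ge b$, $\Pi(\sigma)$ is the path $\operatorname{perm}(\sigma|_{[1,b]})\to\operatorname{perm}(\sigma|_{[2,b+1]})\to\dots\to\operatorname{perm}(\sigma|_{[n-b+1,n]})$. For a path $\pi$, $\Sigma(\pi)=\{\sigma\in S:\Pi(\sigma)=\pi\}$; $\pi$ is ambiguous if $|\Sigma(\pi)|>1$. An ambiguous cycle is a cycle which is ambiguous as a path. If $\pi$ is unambiguous, $\Sigma(\pi)$ also denotes its unique element. For a bicycle $\mathcal{B}$ in $\Gamma(C)$, $C_{\mathcal{B}}=\bigcup_{\pi\in\operatorname{Path}(\mathcal{B})}\Sigma(\pi)$.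 SPLITTABLE PAIRS (defined for a bicycle $\mathcal{B}$ with no ambiguous cycles). Suppose first that both cycles are present. Let the initial cycle be $v_1\to\dots\to v_r\to v_1$, with $v_1$ the start of the connecting path; let $s$ be least with $rs\ge b$. Its $s$-fold concatenation $v_1'\to\dots\to v_{rs}'\to v_1'$ is the augmented initial cycle, and the initial iterator is $\alpha=\Sigma(v_1'\to\dots\to v'_{rs-b+1})$, a permutation of length $rs$. Dually, let the terminal cycle be $w_1\to\dots\to w_{r'}\to w_1$ with $w_1$ the end of the connecting path, $s'$ least with $r's'\ge b$, and $w_1'\to\dots\to w'_{r's'}\to w'_{r's'+1}=w_1'$ the augmented terminal cycle ($s'$-fold concatenation); the terminal iterator is $\gamma=\Sigma(w'_{b+1}\to\dots\to w'_{r's'+1})$, of length $r's'$. Let $c=\max(|\alpha|,|\gamma|)$. A balanced permutation of cycle length $m\ge c$ is a permutation $\sigma$ whose path $\Pi(\sigma)$ starts at $v_1$, follows the augmented initial cycle $m$ times, traverses the connecting path, and then follows the augmented terminal cycle $m$ times. It is uniquely written as $\sigma=\alpha_m\dots\alpha_1\beta\gamma_1\dots\gamma_m$ (a juxtaposition of contiguous subsequences) with $\operatorname{perm}(\alpha_t)=\alpha$, $\operatorname{perm}(\gamma_t)=\gamma$ for all $t$, and $|\beta|$ equal to $b$ plus the length of the connecting path. A core is a balanced permutation of cycle length $c$. Let $\gamma_1\gamma_2$ be the unique permutation in $C_{\mathcal{B}}$ which is a juxtaposition of two sequences with $\operatorname{perm}(\gamma_1)=\operatorname{perm}(\gamma_2)=\gamma$.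 A pair $(\gamma|_i,\gamma|_j)$ with $\gamma|_j=\gamma|_i+1$ is shrinking if $\gamma_1|_i<\gamma_2|_i<\gamma_2|_j<\gamma_1|_j$. The boundary pair $(-\infty,1)$ is shrinking if $\gamma_2|_q<\gamma_1|_q$, where $\gamma|_q=1$; the boundary pair $(|\gamma|,\infty)$ is shrinking if $\gamma_1|_q<\gamma_2|_q$, where $\gamma|_q=|\gamma|$. A shrinking pair $(\gamma|_i,\gamma|_j)$ is splittable if there is a core $\alpha_c\dots\alpha_1\beta\gamma_1\dots\gamma_c$ and an entry $p$ in $\alpha_c\dots\alpha_1\beta$ with $\gamma_1|_i<p<\gamma_1|_j$ (for a boundary pair, the inequality involving $\pm\infty$ is omitted). Shrinking and splittable pairs of $\alpha$ are defined analogously, using the unique permutation $\alpha_2\alpha_1\in C_{\mathcal{B}}$ that is a juxtaposition of two copies of $\alpha$, with $\alpha_1,\alpha_2$ in the roles of $\gamma_1,\gamma_2$, and entries $p$ from $\beta\gamma_1\dots\gamma_c$. $\mathcal{B}$ has a splittable pair if $\alpha$ or $\gamma$ has one. If one of the cycles is absent, the same definitions are used with the corresponding iterator and its copies omitted (e.g. with no initial cycle, $c=|\gamma|$, cores are $\beta\gamma_1\dots\gamma_c$, and $p$ comes from $\beta$); a single cycle is treated as a bicycle with only one of the two cycles and a connecting path of length $0$ at any chosen vertex; with no cycles there are no splittable pairs. *)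

theory Defs
  imports "Graph_Theory.Graph_Theory"
begin

section \<open>Permutations and the consecutive subpermutation order\<close>

definition perms :: "nat list set" where
  "perms = {\<sigma>. distinct \<sigma> \<and> set \<sigma> = {1..length \<sigma>}}"

text \<open>The operation perm; it is only meaningful for sequences of distinct entries.\<close>

definition standardize :: "'a::linorder list \<Rightarrow> nat list" where
  "standardize \<tau> = (THE \<sigma>. \<sigma> \<in> perms \<and> length \<sigma> = length \<tau> \<and>
     (\<forall>i<length \<tau>. \<forall>j<length \<tau>. \<sigma> ! i < \<sigma> ! j \<longleftrightarrow> \<tau> ! i < \<tau> ! j))"

definition consec_subperm :: "nat list \<Rightarrow> nat list \<Rightarrow> bool" (infix \<open>\<le>\<^sub>f\<close> 50) where
  "\<sigma> \<le>\<^sub>f \<tau> \<longleftrightarrow>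
     (\<exists>i. i + length \<sigma> \<le> length \<tau> \<and> \<sigma> = standardize (take (length \<sigma>) (drop i \<tau>)))"

definition downward_closed :: "nat list set \<Rightarrow> bool" where
  "downward_closed C \<longleftrightarrow> (\<forall>\<tau>\<in>C. \<forall>\<sigma>\<in>perms. \<sigma> \<le>\<^sub>f \<tau> \<longrightarrow> \<sigma> \<in> C)"

definition basis :: "nat list set \<Rightarrow> nat list set" where
  "basis C = {\<tau> \<in> perms - C. \<forall>\<sigma> \<in> perms - C. \<sigma> \<le>\<^sub>f \<tau> \<longrightarrow> \<sigma> = \<tau>}"

text \<open>Well quasi-order of a set \<open>A\<close> under a relation that is a partial order on \<open>A\<close>.\<close>

definition well_quasi_ordered_on :: "('a \<Rightarrow> 'a \<Rightarrow> bool) \<Rightarrow> 'a set \<Rightarrow> bool" where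
  "well_quasi_ordered_on le A \<longleftrightarrow>
     (\<nexists>f :: nat \<Rightarrow> 'a. \<forall>i. f i \<in> A \<and> le (f (Suc i)) (f i) \<and> f (Suc i) \<noteq> f i) \<and>
     (\<nexists>X. X \<subseteq> A \<and> infinite X \<and> pairwise (\<lambda>x y. \<not> le x y) X)"


section \<open>Paths, cycles and bicycles in digraphs\<close>

text \<open>
  Paths are vertex walks \<^const>\<open>vwalk\<close>, simple paths are \<^const>\<open>vpath\<close>. The library's own
  cycles are arc walks and always simple, hence the definitions below.
\<close>

definition paths :: "'a pair_pre_digraph \<Rightarrow> 'a list set" where
  "paths G = {p. vwalk p (with_proj G)}"

definition path_cycle :: "'a pair_pre_digraph \<Rightarrow> 'a list \<Rightarrow> bool" where
  "path_cycle G p \<longleftrightarrow> p \<in> paths G \<and> length p \<ge> 2 \<and> hd p = last p"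

definition simple_cycle :: "'a pair_pre_digraph \<Rightarrow> 'a list \<Rightarrow> bool" where
  "simple_cycle G p \<longleftrightarrow> path_cycle G p \<and> distinct (butlast p)"

definition path_complete_decomposition ::
  "'a pair_pre_digraph \<Rightarrow> 'a pair_pre_digraph list \<Rightarrow> bool" where
  "path_complete_decomposition G Hs \<longleftrightarrow>
     (\<forall>H\<in>set Hs. subgraph (with_proj H) (with_proj G)) \<and>
     paths G = (\<Union>H\<in>set Hs. paths H)"

definition closed_up :: "'a list \<Rightarrow> 'a list" where
  "closed_up xs = (if xs = [] then [] else xs @ [hd xs])"

text \<open>
  \<open>B\<close> consists of the initial cycle \<open>I = [v\<^sub>1, \<dots>, v\<^sub>r]\<close>, the connecting path \<open>P\<close> from
  \<open>v\<^sub>1\<close> to \<open>w\<^sub>1\<close> and the terminal cycle \<open>T = [w\<^sub>1, \<dots>, w\<^sub>r\<^sub>']\<close>; the closing edges of the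
  cycles are left implicit, and \<open>[]\<close> encodes an absent cycle. A digraph that is a single cycle
  is obtained from each of its vertices \<open>v\<close>, both as an initial and as a terminal cycle, with
  \<open>P = [v]\<close>.
\<close>

definition bicycle_parts ::
  "'a pair_pre_digraph \<Rightarrow> 'a list \<Rightarrow> 'a list \<Rightarrow> 'a list \<Rightarrow> bool" where
  "bicycle_parts B I P T \<longleftrightarrow>
     (I \<noteq> [] \<longrightarrow> simple_cycle B (closed_up I)) \<and>
     (T \<noteq> [] \<longrightarrow> simple_cycle B (closed_up T)) \<and>
     vpath P (with_proj B) \<and>
     set I \<inter> set T = {} \<and>
     (I \<noteq> [] \<longrightarrow> hd P = hd I \<and> set (tl P) \<inter> set I = {}) \<and>
     (T \<noteq> [] \<longrightarrow> last P = hd T \<and> set (butlast P) \<inter> set T = {}) \<and>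
     pverts B = set I \<union> set P \<union> set T \<and>
     parcs B = set (vwalk_arcs (closed_up I)) \<union> set (vwalk_arcs P) \<union> set (vwalk_arcs (closed_up T))"

definition bicycle :: "'a pair_pre_digraph \<Rightarrow> bool" where
  "bicycle B \<longleftrightarrow> (\<exists>I P T. bicycle_parts B I P T)"


section \<open>The factor graph\<close>

text \<open>On the vertices, which have length \<open>b\<close>, \<open>tl\<close> and \<open>butlast\<close> select the entries in
  positions \<open>2, \<dots>, b\<close> and \<open>1, \<dots>, b - 1\<close>.\<close>

definition factor_graph :: "nat \<Rightarrow> nat list set \<Rightarrow> nat list pair_pre_digraph" where
  "factor_graph b C =
     \<lparr> pverts = {\<sigma> \<in> C. length \<sigma> = b},
       parcs = {(\<sigma>, \<tau>). \<sigma> \<in> C \<and> length \<sigma> = b \<and> \<tau> \<in> C \<and> length \<tau> = b \<and>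
                        standardize (tl \<sigma>) = standardize (butlast \<tau>)} \<rparr>"

definition path_of :: "nat \<Rightarrow> nat list \<Rightarrow> nat list list" where
  "path_of b \<sigma> = map (\<lambda>i. standardize (take b (drop i \<sigma>))) [0..<length \<sigma> - b + 1]"

definition perms_of :: "nat \<Rightarrow> nat list list \<Rightarrow> nat list set" where
  "perms_of b \<pi> = {\<sigma> \<in> perms. b \<le> length \<sigma> \<and> path_of b \<sigma> = \<pi>}"

definition ambiguous :: "nat \<Rightarrow> nat list list \<Rightarrow> bool" where
  "ambiguous b \<pi> \<longleftrightarrow> card (perms_of b \<pi>) > 1"

definition perm_of :: "nat \<Rightarrow> nat list list \<Rightarrow> nat list" where
  "perm_of b \<pi> = the_elem (perms_of b \<pi>)"

definition class_of :: "nat \<Rightarrow> nat list pair_pre_digraph \<Rightarrow> nat list set" where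
  "class_of b B = (\<Union>\<pi>\<in>paths B. perms_of b \<pi>)"


section \<open>Splittable pairs\<close>

text \<open>The notions of this section are meant for bicycles without ambiguous cycles.\<close>

definition augmented :: "nat \<Rightarrow> 'a list \<Rightarrow> 'a list" where
  "augmented b X = concat (replicate (LEAST s. b \<le> length X * s) X)"

definition initial_iterator :: "nat \<Rightarrow> nat list list \<Rightarrow> nat list" where
  "initial_iterator b I =
     (if I = [] then []
      else perm_of b (take (length (augmented b I) - b + 1) (augmented b I)))"

definition terminal_iterator :: "nat \<Rightarrow> nat list list \<Rightarrow> nat list" where
  "terminal_iterator b T =
     (if T = [] then []
      else perm_of b (drop b (closed_up (augmented b T))))"

text \<open>The path from the start of \<open>P\<close> round the augmented initial cycle \<open>m\<close> times, along \<open>P\<close>, and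
  \<open>m\<close> times round the augmented terminal cycle. The latter is rotated because its first vertex is
  already the last vertex of \<open>P\<close>.\<close>

definition balanced_path ::
  "nat \<Rightarrow> nat list list \<Rightarrow> nat list list \<Rightarrow> nat list list \<Rightarrow> nat \<Rightarrow> nat list list" where
  "balanced_path b I P T m =
     concat (replicate m (augmented b I)) @ P @ concat (replicate m (rotate1 (augmented b T)))"

text \<open>\<open>\<alpha>\<^sub>m \<dots> \<alpha>\<^sub>1 \<beta> \<gamma>\<^sub>1 \<dots> \<gamma>\<^sub>m\<close> is a balanced permutation of cycle length \<open>m\<close>, where
  \<open>as = [\<alpha>\<^sub>1, \<dots>, \<alpha>\<^sub>m]\<close> and \<open>gs = [\<gamma>\<^sub>1, \<dots>, \<gamma>\<^sub>m]\<close>; if the corresponding cycle is absent,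
  then \<open>as\<close> or \<open>gs\<close> is empty.\<close>

definition balanced ::
  "nat \<Rightarrow> nat list list \<Rightarrow> nat list list \<Rightarrow> nat list list \<Rightarrow> nat \<Rightarrow>
     nat list list \<Rightarrow> nat list \<Rightarrow> nat list list \<Rightarrow> bool" where
  "balanced b I P T m as \<beta> gs \<longleftrightarrow>
     concat (rev as) @ \<beta> @ concat gs \<in> perms_of b (balanced_path b I P T m) \<and>
     length as = (if I = [] then 0 else m) \<and>
     (\<forall>\<alpha>\<in>set as. standardize \<alpha> = initial_iterator b I) \<and>
     length gs = (if T = [] then 0 else m) \<and>
     (\<forall>\<gamma>\<in>set gs. standardize \<gamma> = terminal_iterator b T) \<and>
     length \<beta> = b + vwalk_length P"

definition core ::
  "nat \<Rightarrow> nat list list \<Rightarrow> nat list list \<Rightarrow> nat list list \<Rightarrow>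
     nat list list \<Rightarrow> nat list \<Rightarrow> nat list list \<Rightarrow> bool" where
  "core b I P T as \<beta> gs \<longleftrightarrow>
     balanced b I P T (max (length (initial_iterator b I)) (length (terminal_iterator b T))) as \<beta> gs"

text \<open>The two halves of the unique juxtaposition of two copies of \<open>\<delta>\<close> in the class of \<open>B\<close>.\<close>

definition juxtaposition ::
  "nat \<Rightarrow> nat list pair_pre_digraph \<Rightarrow> nat list \<Rightarrow> nat list \<times> nat list" where
  "juxtaposition b B \<delta> =
     (THE (x, y). x @ y \<in> class_of b B \<and> standardize x = \<delta> \<and> standardize y = \<delta>)"

text \<open>Pairs of an iterator are given by positions, counted from \<open>0\<close>: \<open>Inner i j\<close> is the pair of
  the entries in positions \<open>i\<close> and \<open>j\<close>, \<open>Below q\<close> and \<open>Above q\<close> are the boundary pairs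
  \<open>(-\<infinity>, 1)\<close> and \<open>(n, \<infinity>)\<close>, where \<open>q\<close> is the position of \<open>1\<close> and of the maximum \<open>n\<close>.\<close>

datatype iterator_pair = Inner nat nat | Below nat | Above nat

text \<open>\<open>x\<^sub>1\<close> is the copy of the iterator \<open>\<delta>\<close> nearer to the connecting path, \<open>x\<^sub>2\<close> the other one.\<close>

fun shrinking :: "nat list \<Rightarrow> nat list \<Rightarrow> nat list \<Rightarrow> iterator_pair \<Rightarrow> bool" where
  "shrinking \<delta> x\<^sub>1 x\<^sub>2 (Inner i j) \<longleftrightarrow>
     i < length \<delta> \<and> j < length \<delta> \<and> \<delta> ! j = \<delta> ! i + 1 \<and>
     x\<^sub>1 ! i < x\<^sub>2 ! i \<and> x\<^sub>2 ! i < x\<^sub>2 ! j \<and> x\<^sub>2 ! j < x\<^sub>1 ! j"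
| "shrinking \<delta> x\<^sub>1 x\<^sub>2 (Below q) \<longleftrightarrow> q < length \<delta> \<and> \<delta> ! q = 1 \<and> x\<^sub>2 ! q < x\<^sub>1 ! q"
| "shrinking \<delta> x\<^sub>1 x\<^sub>2 (Above q) \<longleftrightarrow> q < length \<delta> \<and> \<delta> ! q = length \<delta> \<and> x\<^sub>1 ! q < x\<^sub>2 ! q"

fun lies_in :: "nat \<Rightarrow> nat list \<Rightarrow> iterator_pair \<Rightarrow> bool" where
  "lies_in p x (Inner i j) \<longleftrightarrow> x ! i < p \<and> p < x ! j"
| "lies_in p x (Below q) \<longleftrightarrow> p < x ! q"
| "lies_in p x (Above q) \<longleftrightarrow> x ! q < p"

definition initial_splittable ::
  "nat \<Rightarrow> nat list pair_pre_digraph \<Rightarrow> nat list list \<Rightarrow> nat list list \<Rightarrow> nat list list \<Rightarrow>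
     iterator_pair \<Rightarrow> bool" where
  "initial_splittable b B I P T g \<longleftrightarrow>
     (let \<alpha> = initial_iterator b I; (\<alpha>\<^sub>2, \<alpha>\<^sub>1) = juxtaposition b B \<alpha>
      in shrinking \<alpha> \<alpha>\<^sub>1 \<alpha>\<^sub>2 g) \<and>
     (\<exists>as \<beta> gs. core b I P T as \<beta> gs \<and> (\<exists>p \<in> set (\<beta> @ concat gs). lies_in p (hd as) g))"

definition terminal_splittable ::
  "nat \<Rightarrow> nat list pair_pre_digraph \<Rightarrow> nat list list \<Rightarrow> nat list list \<Rightarrow> nat list list \<Rightarrow>
     iterator_pair \<Rightarrow> bool" where
  "terminal_splittable b B I P T g \<longleftrightarrow>
     (let \<gamma> = terminal_iterator b T; (\<gamma>\<^sub>1, \<gamma>\<^sub>2) = juxtaposition b B \<gamma>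
      in shrinking \<gamma> \<gamma>\<^sub>1 \<gamma>\<^sub>2 g) \<and>
     (\<exists>as \<beta> gs. core b I P T as \<beta> gs \<and>
        (\<exists>p \<in> set (concat (rev as) @ \<beta>). lies_in p (hd gs) g))"

text \<open>The parts of a bicycle are determined by the digraph, except when it is a single cycle.\<close>

definition has_splittable_pair :: "nat \<Rightarrow> nat list pair_pre_digraph \<Rightarrow> bool" where
  "has_splittable_pair b B \<longleftrightarrow>
     (\<exists>I P T. bicycle_parts B I P T \<and>
        ((I \<noteq> [] \<and> (\<exists>g. initial_splittable b B I P T g)) \<or>
         (T \<noteq> [] \<and> (\<exists>g. terminal_splittable b B I P T g))))"

end

theory Submission
  imports Defs
begin

text \<open>
  Why the theorem holds.  A permutation of length at least \<open>b\<close> lies in \<open>C\<close> precisely if its windows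
  of length \<open>b\<close> do, so it is a walk in the factor graph together with a choice of all the
  comparisons between entries that share no window.  Linear orders that agree on their common part
  can be amalgamated (\<open>amalgamation\<close>).  Hence every walk is realised, realisations extend along
  longer walks, and whatever the windows leave open can be chosen freely.  As lengths decrease
  strictly, well quasi-order means that there is no infinite antichain, and each of the three
  conditions forbids one source of antichains.

  \<^item> A cycle that can be entered and left by further edges gives walks that enter it, wind round it
    and leave it; winding round different numbers of times gives incomparable walks
    (\<open>well_quasi_order_free\<close>).  Conversely, if no such cycle exists, then a walk can meet cycles only
    at its beginning and at its end, and so it lies in a bicycle (\<open>path_in_bicycle\<close>).
  \<^item> If some stretch of a cycle has two realisations \<open>f\<close> and \<open>g\<close>, a shortest such stretch allows them
    to be combined like letters, and the words \<open>f g \<dots> g f\<close> are incomparable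
    (\<open>well_quasi_order_rigid_cycles\<close>).
  \<^item> In a cycle without ambiguity, consecutive copies of an iterator move monotonically, entry by
    entry.  A shrinking pair encloses a nested sequence of intervals, one for each copy.  If some entry
    \<open>p\<close> off the cycle can lie in the first interval, then it can be put into exactly the first \<open>m\<close> of
    them, for every \<open>m\<close>, and these permutations are incomparable (\<open>splitting_antichain\<close>).

  For the converse, the crucial fact is that an entry outside all shrinking pairs of the first copy
  has the same position relative to all copies from the \<open>n\<close>-th one on, \<open>n\<close> being the length of the
  iterator (\<open>blocks.stable\<close>).  It rests on a separation property: two entries on different sides of a
  full copy are separated in value by an entry of that copy (\<open>rigid_separates\<close>), since otherwise two
  entries that share no window would be adjacent in value and could be exchanged.  Therefore a
  balanced permutation without splittable pairs is determined by its core (\<open>core_determines\<close>).  Every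
  permutation of the class of a bicycle is a stretch of a balanced one; there are finitely many
  cores, and for a given core one stretch contains another if its end points are further out.
  Dickson's lemma finishes the proof.
\<close>

section \<open>Order types\<close>

lemma nth_perms_conv_card:
  assumes "\<sigma> \<in> perms" and "i < length \<sigma>"
  shows "\<sigma> ! i = card {j. j < length \<sigma> \<and> \<sigma> ! j \<le> \<sigma> ! i}"
proof -
  have d: "distinct \<sigma>" and s: "set \<sigma> = {1..length \<sigma>}"
    using assms by (auto simp: perms_def)
  have le: "\<sigma> ! i \<le> length \<sigma>"
    using s assms(2) nth_mem by fastforce
  have "(!) \<sigma> ` {j. j < length \<sigma> \<and> \<sigma> ! j \<le> \<sigma> ! i} = {v \<in> set \<sigma>. v \<le> \<sigma> ! i}"
    by (auto simp: set_conv_nth)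
  also have "\<dots> = {1..\<sigma> ! i}"
    using s le by auto
  finally have "card ((!) \<sigma> ` {j. j < length \<sigma> \<and> \<sigma> ! j \<le> \<sigma> ! i}) = \<sigma> ! i" by simp
  moreover have "inj_on ((!) \<sigma>) {j. j < length \<sigma> \<and> \<sigma> ! j \<le> \<sigma> ! i}"
    using d by (auto simp: inj_on_def nth_eq_iff_index_eq)
  ultimately show ?thesis by (simp add: card_image)
qed

lemma perms_eqI:
  assumes "\<sigma> \<in> perms" "\<tau> \<in> perms" "length \<sigma> = length \<tau>"
    and "\<And>i j. i < length \<sigma> \<Longrightarrow> j < length \<sigma> \<Longrightarrow> \<sigma> ! i < \<sigma> ! j \<longleftrightarrow> \<tau> ! i < \<tau> ! j"
  shows "\<sigma> = \<tau>"
proof (rule nth_equalityI)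
  fix i assume i: "i < length \<sigma>"
  have "{j. j < length \<sigma> \<and> \<sigma> ! j \<le> \<sigma> ! i} = {j. j < length \<tau> \<and> \<tau> ! j \<le> \<tau> ! i}"
    using assms(3,4) i by (auto simp flip: not_less)
  then show "\<sigma> ! i = \<tau> ! i"
    using nth_perms_conv_card[OF assms(1) i] nth_perms_conv_card[OF assms(2), of i] i assms(3)
    by simp
qed (use assms in auto)

lemma standardize_exists:
  fixes \<tau> :: "'a::linorder list"
  assumes "distinct \<tau>"
  shows "\<exists>\<sigma>. \<sigma> \<in> perms \<and> length \<sigma> = length \<tau> \<and>
     (\<forall>i<length \<tau>. \<forall>j<length \<tau>. \<sigma> ! i < \<sigma> ! j \<longleftrightarrow> \<tau> ! i < \<tau> ! j)"
proof -
  define r where "r x = card {y \<in> set \<tau>. y \<le> x}" for x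
  have mono: "r x < r y \<longleftrightarrow> x < y" if "x \<in> set \<tau>" "y \<in> set \<tau>" for x y
  proof
    show "r x < r y" if "x < y"
      unfolding r_def
    proof (rule psubset_card_mono)
      have "y \<in> {z \<in> set \<tau>. z \<le> y} - {z \<in> set \<tau>. z \<le> x}" using \<open>y \<in> set \<tau>\<close> that by auto
      then show "{z \<in> set \<tau>. z \<le> x} \<subset> {z \<in> set \<tau>. z \<le> y}" using that by auto
    qed simp
    show "x < y" if "r x < r y"
    proof (rule ccontr)
      assume "\<not> x < y"
      then have "r y \<le> r x" unfolding r_def by (intro card_mono) auto
      with that show False by simp
    qed
  qed
  have inj: "inj_on r (set \<tau>)"
    by (rule inj_onI) (metis mono less_irrefl not_less_iff_gr_or_eq)
  have "r ` set \<tau> = {1..length \<tau>}"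
  proof (rule card_subset_eq)
    show "r ` set \<tau> \<subseteq> {1..length \<tau>}"
    proof safe
      fix x assume x: "x \<in> set \<tau>"
      have "r x \<le> card (set \<tau>)" unfolding r_def by (intro card_mono) auto
      moreover have "r x > 0" unfolding r_def using x by (auto simp: card_gt_0_iff)
      ultimately show "r x \<in> {1..length \<tau>}"
        using assms by (auto simp: distinct_card)
    qed
    show "card (r ` set \<tau>) = card {1..length \<tau>}"
      using assms by (simp add: card_image[OF inj] distinct_card)
  qed simp
  then have "map r \<tau> \<in> perms"
    using inj assms by (simp add: perms_def distinct_map)
  then show ?thesis
    by (intro exI[of _ "map r \<tau>"]) (auto simp: mono)
qed

lemma standardize_props:
  fixes \<tau> :: "'a::linorder list"
  assumes "distinct \<tau>"
  shows standardize_perms: "standardize \<tau> \<in> perms"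
    and length_standardize: "length (standardize \<tau>) = length \<tau>"
    and standardize_less_iff: "i < length \<tau> \<Longrightarrow> j < length \<tau> \<Longrightarrow>
           standardize \<tau> ! i < standardize \<tau> ! j \<longleftrightarrow> \<tau> ! i < \<tau> ! j"
proof -
  have "\<exists>!\<sigma>. \<sigma> \<in> perms \<and> length \<sigma> = length \<tau> \<and>
     (\<forall>i<length \<tau>. \<forall>j<length \<tau>. \<sigma> ! i < \<sigma> ! j \<longleftrightarrow> \<tau> ! i < \<tau> ! j)"
    using standardize_exists[OF assms] by (auto intro!: perms_eqI)
  from theI'[OF this] show "standardize \<tau> \<in> perms" "length (standardize \<tau>) = length \<tau>"
    "i < length \<tau> \<Longrightarrow> j < length \<tau> \<Longrightarrow>
           standardize \<tau> ! i < standardize \<tau> ! j \<longleftrightarrow> \<tau> ! i < \<tau> ! j"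
    unfolding standardize_def by blast+
qed

lemma standardize_eqI:
  assumes "distinct \<tau>" "\<sigma> \<in> perms" "length \<sigma> = length \<tau>"
    and "\<And>i j. i < length \<tau> \<Longrightarrow> j < length \<tau> \<Longrightarrow> \<sigma> ! i < \<sigma> ! j \<longleftrightarrow> \<tau> ! i < \<tau> ! j"
  shows "standardize \<tau> = \<sigma>"
  by (rule perms_eqI)
     (use assms standardize_perms[OF assms(1)] length_standardize[OF assms(1)]
        standardize_less_iff[OF assms(1)] in auto)

lemma standardize_eq_iff:
  assumes "distinct \<sigma>" "distinct \<tau>"
  shows "standardize \<sigma> = standardize \<tau> \<longleftrightarrow> length \<sigma> = length \<tau> \<and>
    (\<forall>i<length \<tau>. \<forall>j<length \<tau>. \<sigma> ! i < \<sigma> ! j \<longleftrightarrow> \<tau> ! i < \<tau> ! j)"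
proof
  assume eq: "standardize \<sigma> = standardize \<tau>"
  then show "length \<sigma> = length \<tau> \<and>
    (\<forall>i<length \<tau>. \<forall>j<length \<tau>. \<sigma> ! i < \<sigma> ! j \<longleftrightarrow> \<tau> ! i < \<tau> ! j)"
    using length_standardize[OF assms(1)] length_standardize[OF assms(2)]
      standardize_less_iff[OF assms(1)] standardize_less_iff[OF assms(2)] by metis
next
  assume "length \<sigma> = length \<tau> \<and>
    (\<forall>i<length \<tau>. \<forall>j<length \<tau>. \<sigma> ! i < \<sigma> ! j \<longleftrightarrow> \<tau> ! i < \<tau> ! j)"
  then show "standardize \<sigma> = standardize \<tau>"
    using standardize_perms[OF assms(2)] length_standardize[OF assms(2)]
      standardize_less_iff[OF assms(2)] by (intro standardize_eqI) (auto simp: assms)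
qed

lemma standardize_perm: "\<sigma> \<in> perms \<Longrightarrow> standardize \<sigma> = \<sigma>"
  by (rule standardize_eqI) (auto simp: perms_def)

text \<open>A permutation is handled through a model: an integer-valued function on an interval of
  integer positions, of which only the relative order of the values matters.  Integer positions
  allow a permutation to be extended on both sides without renumbering its entries.\<close>

definition pattern :: "(int \<Rightarrow> int) \<Rightarrow> int \<Rightarrow> nat \<Rightarrow> nat list" where
  "pattern h z n = standardize (map (\<lambda>k. h (z + int k)) [0..<n])"

definition same_order_on :: "int set \<Rightarrow> (int \<Rightarrow> int) \<Rightarrow> (int \<Rightarrow> int) \<Rightarrow> bool" where
  "same_order_on X h h' \<longleftrightarrow> (\<forall>x\<in>X. \<forall>y\<in>X. h x < h y \<longleftrightarrow> h' x < h' y)"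

lemma same_order_onD: "same_order_on X h h' \<Longrightarrow> x \<in> X \<Longrightarrow> y \<in> X \<Longrightarrow> h x < h y \<longleftrightarrow> h' x < h' y"
  by (auto simp: same_order_on_def)

lemma same_order_on_sym: "same_order_on X h h' \<Longrightarrow> same_order_on X h' h"
  by (auto simp: same_order_on_def)

lemma same_order_on_trans:
  "same_order_on X h h' \<Longrightarrow> same_order_on X h' h'' \<Longrightarrow> same_order_on X h h''"
  by (auto simp: same_order_on_def)

lemma same_order_on_subset: "same_order_on X h h' \<Longrightarrow> Y \<subseteq> X \<Longrightarrow> same_order_on Y h h'"
  by (auto simp: same_order_on_def)

lemma same_order_on_inj: "same_order_on X h h' \<Longrightarrow> inj_on h X \<Longrightarrow> inj_on h' X"
  unfolding same_order_on_def inj_on_def by (metis linorder_neq_iff)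

lemma distinct_model:
  "inj_on h {z..<z + int n} \<Longrightarrow> distinct (map (\<lambda>k. h (z + int k)) [0..<n])"
  by (force simp: distinct_map inj_on_def)

lemma pattern_props:
  assumes "inj_on h {z..<z + int n}"
  shows pattern_perms: "pattern h z n \<in> perms"
    and length_pattern: "length (pattern h z n) = n"
    and pattern_less_iff: "i < n \<Longrightarrow> j < n \<Longrightarrow>
           pattern h z n ! i < pattern h z n ! j \<longleftrightarrow> h (z + int i) < h (z + int j)"
  using standardize_props[OF distinct_model[OF assms]] by (auto simp: pattern_def)

lemma pattern_eq_iff:
  assumes "inj_on h {z..<z + int n}" "inj_on h' {z'..<z' + int n}"
  shows "pattern h z n = pattern h' z' n \<longleftrightarrow>
    same_order_on {z..<z + int n} h (\<lambda>x. h' (x + (z' - z)))"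
proof -
  have "pattern h z n = pattern h' z' n \<longleftrightarrow>
    (\<forall>i<n. \<forall>j<n. h (z + int i) < h (z + int j) \<longleftrightarrow> h' (z' + int i) < h' (z' + int j))"
    unfolding pattern_def standardize_eq_iff[OF distinct_model[OF assms(1)] distinct_model[OF assms(2)]]
    by simp
  also have "\<dots> \<longleftrightarrow> same_order_on {z..<z + int n} h (\<lambda>x. h' (x + (z' - z)))"
  proof
    assume L: "\<forall>i<n. \<forall>j<n. h (z + int i) < h (z + int j) \<longleftrightarrow> h' (z' + int i) < h' (z' + int j)"
    show "same_order_on {z..<z + int n} h (\<lambda>x. h' (x + (z' - z)))"
      unfolding same_order_on_def
    proof (intro ballI)
      fix x y assume "x \<in> {z..<z + int n}" "y \<in> {z..<z + int n}"
      then show "h x < h y \<longleftrightarrow> h' (x + (z' - z)) < h' (y + (z' - z))"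
        using L[rule_format, of "nat (x - z)" "nat (y - z)"] by (auto simp: algebra_simps)
    qed
  next
    assume R: "same_order_on {z..<z + int n} h (\<lambda>x. h' (x + (z' - z)))"
    then show "\<forall>i<n. \<forall>j<n. h (z + int i) < h (z + int j) \<longleftrightarrow> h' (z' + int i) < h' (z' + int j)"
      by (auto simp: same_order_on_def algebra_simps)
  qed
  finally show ?thesis .
qed

lemma pattern_shift: "pattern (\<lambda>x. h (x + d)) z n = pattern h (z + d) n"
  by (simp add: pattern_def algebra_simps)

lemma pattern_cong_same_order:
  assumes "same_order_on {z..<z + int n} h h'" "inj_on h {z..<z + int n}"
  shows "pattern h z n = pattern h' z n"
  using pattern_eq_iff[OF assms(2) same_order_on_inj[OF assms]] assms by simp

lemma pattern_window:
  assumes "inj_on h {z..<z + int n}" "k + m \<le> n"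
  shows "standardize (take m (drop k (pattern h z n))) = pattern h (z + int k) m"
proof -
  have inj: "inj_on h {z + int k..<z + int k + int m}"
    by (rule inj_on_subset[OF assms(1)]) (use assms(2) in auto)
  have d: "distinct (pattern h z n)" and l: "length (pattern h z n) = n"
    using pattern_perms[OF assms(1)] length_pattern[OF assms(1)] by (auto simp: perms_def)
  show ?thesis
    unfolding pattern_def[of h "z + int k"]
    by (subst standardize_eq_iff)
       (use d l assms distinct_model[OF inj] in
         \<open>auto simp: pattern_less_iff[OF assms(1)] algebra_simps\<close>)
qed

text \<open>Every permutation is its own model, placed at any position.\<close>

definition model_of :: "nat list \<Rightarrow> int \<Rightarrow> int \<Rightarrow> int" where
  "model_of \<sigma> lo z = int (\<sigma> ! nat (z - lo))"

lemma model_of_props: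
  assumes "\<sigma> \<in> perms"
  shows inj_model_of: "inj_on (model_of \<sigma> lo) {lo..<lo + int (length \<sigma>)}"
    and pattern_model_of: "pattern (model_of \<sigma> lo) lo (length \<sigma>) = \<sigma>"
proof -
  show "inj_on (model_of \<sigma> lo) {lo..<lo + int (length \<sigma>)}"
    using assms by (auto simp: inj_on_def model_of_def perms_def nth_eq_iff_index_eq)
  from distinct_model[OF this] show "pattern (model_of \<sigma> lo) lo (length \<sigma>) = \<sigma>"
    unfolding pattern_def
    by (rule standardize_eqI) (auto simp: assms model_of_def)
qed

lemma consec_subperm_pattern_iff:
  assumes "inj_on h' {z'..<z' + int n'}" "inj_on h {z..<z + int n}"
  shows "pattern h z n \<le>\<^sub>f pattern h' z' n' \<longleftrightarrow>
    (\<exists>d. d + n \<le> n' \<and> same_order_on {z..<z + int n} h (\<lambda>x. h' (x + (z' - z + int d))))"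
proof -
  have inj: "inj_on h' {z' + int d..<z' + int d + int n}" if "d + n \<le> n'" for d
    by (rule inj_on_subset[OF assms(1)]) (use that in auto)
  have "pattern h z n \<le>\<^sub>f pattern h' z' n' \<longleftrightarrow>
    (\<exists>d. d + n \<le> n' \<and> pattern h z n = pattern h' (z' + int d) n)"
    unfolding consec_subperm_def length_pattern[OF assms(1)] length_pattern[OF assms(2)]
    using pattern_window[OF assms(1)] by metis
  also have "\<dots> \<longleftrightarrow> (\<exists>d. d + n \<le> n' \<and>
      same_order_on {z..<z + int n} h (\<lambda>x. h' (x + (z' - z + int d))))"
    using pattern_eq_iff[OF assms(2) inj] by (simp add: algebra_simps cong: conj_cong)
  finally show ?thesis .
qed

lemma consec_subperm_refl: "\<sigma> \<in> perms \<Longrightarrow> \<sigma> \<le>\<^sub>f \<sigma>"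
  unfolding consec_subperm_def by (rule exI[of _ 0]) (simp add: standardize_perm)

lemma consec_subperm_trans:
  assumes "\<rho> \<le>\<^sub>f \<sigma>" "\<sigma> \<le>\<^sub>f \<tau>" "\<tau> \<in> perms"
  shows "\<rho> \<le>\<^sub>f \<tau>"
proof -
  let ?h = "model_of \<tau> 0"
  note inj = inj_model_of[OF assms(3), of 0] and pat = pattern_model_of[OF assms(3), of 0]
  from assms(2) obtain i where i: "i + length \<sigma> \<le> length \<tau>"
    "\<sigma> = standardize (take (length \<sigma>) (drop i \<tau>))" by (auto simp: consec_subperm_def)
  then have \<sigma>: "\<sigma> = pattern ?h (int i) (length \<sigma>)"
    using pattern_window[OF inj, of i "length \<sigma>"] pat by simp
  from assms(1) obtain j where j: "j + length \<rho> \<le> length \<sigma>"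
    "\<rho> = standardize (take (length \<rho>) (drop j \<sigma>))" by (auto simp: consec_subperm_def)
  have inj2: "inj_on ?h {int i..<int i + int (length \<sigma>)}"
    by (rule inj_on_subset[OF inj]) (use i in auto)
  have "\<rho> = pattern ?h (int i + int j) (length \<rho>)"
    using pattern_window[OF inj2, of j "length \<rho>"] \<sigma> j by simp
  then have "\<rho> = standardize (take (length \<rho>) (drop (i + j) \<tau>))"
    using pattern_window[OF inj, of "i + j" "length \<rho>"] pat i j by simp
  then show ?thesis using i j unfolding consec_subperm_def
    by (intro exI[of _ "i + j"]) simp
qed

lemma consec_subperm_length: "\<sigma> \<le>\<^sub>f \<tau> \<Longrightarrow> length \<sigma> \<le> length \<tau>"
  by (auto simp: consec_subperm_def)

lemma consec_subperm_eq_length: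
  "\<sigma> \<le>\<^sub>f \<tau> \<Longrightarrow> length \<sigma> = length \<tau> \<Longrightarrow> \<tau> \<in> perms \<Longrightarrow> \<sigma> = \<tau>"
  by (auto simp: consec_subperm_def standardize_perm)

text \<open>A strictly decreasing sequence would have strictly decreasing lengths, so only antichains
  matter.  A sequence that repeats a permutation has two comparable terms anyway, so infinite
  antichains can be excluded by considering all sequences.\<close>

lemma well_quasi_ordered_on_perms_iff:
  assumes "C \<subseteq> perms"
  shows "well_quasi_ordered_on (\<le>\<^sub>f) C \<longleftrightarrow>
    (\<forall>f :: nat \<Rightarrow> nat list. range f \<subseteq> C \<longrightarrow> (\<exists>m n. m \<noteq> n \<and> f m \<le>\<^sub>f f n))" (is "?L \<longleftrightarrow> ?R")
proof
  assume L: ?L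
  show ?R
  proof (intro allI impI, rule ccontr)
    fix f :: "nat \<Rightarrow> nat list"
    assume f: "range f \<subseteq> C" "\<nexists>m n. m \<noteq> n \<and> f m \<le>\<^sub>f f n"
    then have "inj f"
      using assms consec_subperm_refl by (metis (no_types, lifting) injI range_subsetD subsetD)
    then have "infinite (range f)" using range_inj_infinite by blast
    moreover have "pairwise (\<lambda>x y. \<not> x \<le>\<^sub>f y) (range f)"
      using f(2) unfolding pairwise_def by (metis imageE)
    ultimately show False using L f(1) unfolding well_quasi_ordered_on_def by blast
  qed
next
  assume R: ?R
  have "\<nexists>f. \<forall>i::nat. f i \<in> C \<and> f (Suc i) \<le>\<^sub>f f i \<and> f (Suc i) \<noteq> f i"
  proof
    assume "\<exists>f. \<forall>i::nat. f i \<in> C \<and> f (Suc i) \<le>\<^sub>f f i \<and> f (Suc i) \<noteq> f i"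
    then obtain f :: "nat \<Rightarrow> nat list"
      where f: "\<And>i. f i \<in> C" "\<And>i. f (Suc i) \<le>\<^sub>f f i" "\<And>i. f (Suc i) \<noteq> f i" by blast
    have less: "length (f (Suc i)) < length (f i)" for i
      using consec_subperm_length[OF f(2)[of i]] consec_subperm_eq_length[OF f(2)[of i]] f(1,3) assms
      by (metis le_neq_implies_less subsetD)
    have "length (f i) + i \<le> length (f 0)" for i
    proof (induction i)
      case (Suc i)
      then show ?case using less[of i] by linarith
    qed simp
    from this[of "Suc (length (f 0))"] show False by simp
  qed
  moreover have "\<nexists>X. X \<subseteq> C \<and> infinite X \<and> pairwise (\<lambda>x y. \<not> x \<le>\<^sub>f y) X"
  proof
    assume "\<exists>X. X \<subseteq> C \<and> infinite X \<and> pairwise (\<lambda>x y. \<not> x \<le>\<^sub>f y) X"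
    then obtain X where X: "X \<subseteq> C" "infinite X" "pairwise (\<lambda>x y. \<not> x \<le>\<^sub>f y) X" by blast
    obtain f :: "nat \<Rightarrow> nat list" where f: "inj f" "range f \<subseteq> X"
      using infinite_countable_subset[OF X(2)] by blast
    obtain m n where "m \<noteq> n" "f m \<le>\<^sub>f f n" using R f X(1) by blast
    with f X(3) show False by (metis injD pairwiseD range_subsetD)
  qed
  ultimately show ?L unfolding well_quasi_ordered_on_def by blast
qed

section \<open>Realisations of sequences of patterns\<close>

text \<open>Two linear orders that agree on the intersection of their domains have a common extension.
  One element at a time is added; the doubled values leave an odd value free for it.\<close>

lemma insert_element:
  fixes f g :: "int \<Rightarrow> int"
  assumes "finite X" "inj_on f X" "y \<notin> X" "S \<subseteq> X" "same_order_on S f g"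
    and "inj_on g (insert y S)"
  shows "\<exists>h. inj_on h (insert y X) \<and> same_order_on X f h \<and> same_order_on (insert y S) g h"
proof -
  define L where "L = {x \<in> S. g x < g y}"
  have finL: "finite L" unfolding L_def using assms finite_subset by fastforce
  define M where "M = (if L = {} then 2 * Min (f ` X) - 1 else 2 * Max (f ` L) + 1)"
  define h where "h x = (if x = y then M else 2 * f x)" for x
  have low: "h x < h y \<longleftrightarrow> g x < g y" if "x \<in> S" for x
  proof (cases "x \<in> L")
    case True
    then have "f x \<le> Max (f ` L)" using finL by simp
    with True assms(3,4) that show ?thesis unfolding h_def M_def L_def by auto
  next
    case False
    have "M < 2 * f x"
    proof (cases "L = {}")
      case True
      have "Min (f ` X) \<le> f x" using assms(1,4) that by auto
      with True show ?thesis unfolding M_def by simp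
    next
      case 2: False
      have "Max (f ` L) \<in> f ` L" using finL 2 by simp
      then obtain l where l: "l \<in> L" "Max (f ` L) = f l" by auto
      have "g l < g x" using l False that unfolding L_def by auto
      then have "f l < f x" using assms(5) l that unfolding same_order_on_def L_def by auto
      then show ?thesis using l 2 unfolding M_def by simp
    qed
    moreover have "\<not> g x < g y" using False that unfolding L_def by simp
    moreover have "x \<noteq> y" using that assms(3,4) by auto
    ultimately show ?thesis unfolding h_def by simp
  qed
  have odd: "odd M" unfolding M_def by simp
  have neq: "h x \<noteq> h y" if "x \<in> X" for x
    using odd that assms(3) unfolding h_def by auto
  have "same_order_on X f h"
    using assms(3) unfolding same_order_on_def h_def by auto
  moreover have "inj_on h (insert y X)"
    using neq same_order_on_inj[OF \<open>same_order_on X f h\<close> assms(2)]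
    unfolding inj_on_def by (metis insert_iff)
  moreover have "same_order_on (insert y S) g h"
    unfolding same_order_on_def
  proof (intro ballI)
    fix a b assume ab: "a \<in> insert y S" "b \<in> insert y S"
    have S: "g a < g b \<longleftrightarrow> h a < h b" if "a \<in> S" "b \<in> S"
      using that assms(3,4,5) unfolding same_order_on_def h_def by auto
    have up: "g y < g b \<longleftrightarrow> h y < h b" if "b \<in> S"
    proof -
      have "g y \<noteq> g b" using assms(3,4,6) that by (auto simp: inj_on_def)
      moreover have "h y \<noteq> h b" using neq[of b] that assms(4) by auto
      ultimately show ?thesis using low[OF that] by linarith
    qed
    show "g a < g b \<longleftrightarrow> h a < h b"
      using ab S low up by auto
  qed
  ultimately show ?thesis by blast
qed

lemma amalgamation:
  assumes "finite Y" "finite X" "inj_on f X" "inj_on g Y" "same_order_on (X \<inter> Y) f g"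
  shows "\<exists>h. inj_on h (X \<union> Y) \<and> same_order_on X f h \<and> same_order_on Y g h"
proof -
  have "\<exists>h. inj_on h (X \<union> D) \<and> same_order_on X f h \<and> same_order_on ((X \<inter> Y) \<union> D) g h"
    if "finite D" "D \<subseteq> Y - X" for D
    using that
  proof induction
    case empty
    then show ?case using assms same_order_on_sym
      by (intro exI[of _ f]) (auto simp: same_order_on_def)
  next
    case (insert y D)
    then obtain h where h: "inj_on h (X \<union> D)" "same_order_on X f h"
      "same_order_on ((X \<inter> Y) \<union> D) g h" by auto
    have "\<exists>k. inj_on k (insert y (X \<union> D)) \<and> same_order_on (X \<union> D) h k \<and>
             same_order_on (insert y ((X \<inter> Y) \<union> D)) g k"
    proof (rule insert_element)
      show "inj_on g (insert y (X \<inter> Y \<union> D))"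
        by (rule inj_on_subset[OF assms(4)]) (use insert in auto)
    qed (use insert h assms same_order_on_sym in auto)
    then obtain k where k: "inj_on k (insert y (X \<union> D))" "same_order_on (X \<union> D) h k"
      "same_order_on (insert y ((X \<inter> Y) \<union> D)) g k" by blast
    have "same_order_on X f k"
      using same_order_on_trans[OF h(2) same_order_on_subset[OF k(2)]] by auto
    then show ?case using k by auto
  qed
  from this[of "Y - X"] assms(1) obtain h where
    "inj_on h (X \<union> (Y - X))" "same_order_on X f h" "same_order_on ((X \<inter> Y) \<union> (Y - X)) g h"
    by auto
  moreover have "X \<union> (Y - X) = X \<union> Y" "(X \<inter> Y) \<union> (Y - X) = Y" by auto
  ultimately show ?thesis by auto
qed

text \<open>A sequence \<open>u\<close> of patterns prescribes the order of every window, and \<open>h\<close> has to comply with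
  it on the positions from \<open>lo\<close> to \<open>hi - 1\<close>.\<close>

definition realises :: "nat \<Rightarrow> (int \<Rightarrow> nat list) \<Rightarrow> (int \<Rightarrow> int) \<Rightarrow> int \<Rightarrow> int \<Rightarrow> bool" where
  "realises b u h lo hi \<longleftrightarrow> inj_on h {lo..<hi} \<and>
     (\<forall>z. lo \<le> z \<and> z + int b \<le> hi \<longrightarrow> pattern h z b = u z)"

lemma realisesD:
  "realises b u h lo hi \<Longrightarrow> inj_on h {lo..<hi}"
  "realises b u h lo hi \<Longrightarrow> lo \<le> z \<Longrightarrow> z + int b \<le> hi \<Longrightarrow> pattern h z b = u z"
  by (auto simp: realises_def)

lemma realises_subset:
  "realises b u h lo hi \<Longrightarrow> lo \<le> lo' \<Longrightarrow> hi' \<le> hi \<Longrightarrow> realises b u h lo' hi'"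
  unfolding realises_def by (auto elim!: inj_on_subset)

lemma realises_cong:
  "(\<And>z. lo \<le> z \<Longrightarrow> z + int b \<le> hi \<Longrightarrow> u z = u' z) \<Longrightarrow>
    realises b u h lo hi \<longleftrightarrow> realises b u' h lo hi"
  unfolding realises_def by auto

lemma realises_same_order:
  assumes "realises b u h lo hi" "same_order_on {lo..<hi} h h'"
  shows "realises b u h' lo hi"
  unfolding realises_def
proof (intro conjI allI impI)
  show "inj_on h' {lo..<hi}" using same_order_on_inj assms realisesD by blast
  fix z assume z: "lo \<le> z \<and> z + int b \<le> hi"
  have "pattern h z b = pattern h' z b"
  proof (rule pattern_cong_same_order)
    show "same_order_on {z..<z + int b} h h'"
      by (rule same_order_on_subset[OF assms(2)]) (use z in auto)
    show "inj_on h {z..<z + int b}"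
      by (rule inj_on_subset[OF realisesD(1)[OF assms(1)]]) (use z in auto)
  qed
  then show "pattern h' z b = u z" using realisesD(2)[OF assms(1)] z by simp
qed

lemma realises_shift:
  assumes "realises b u h lo hi"
  shows "realises b (\<lambda>z. u (z + d)) (\<lambda>z. h (z + d)) (lo - d) (hi - d)"
  unfolding realises_def
proof (intro conjI allI impI)
  show "inj_on (\<lambda>z. h (z + d)) {lo - d..<hi - d}"
    using realisesD(1)[OF assms] by (force simp: inj_on_def)
qed (use realisesD(2)[OF assms] in \<open>auto simp: pattern_shift\<close>)

text \<open>Realisations glue together as soon as they overlap in at least \<open>b - 1\<close> positions: then
  each window of length \<open>b\<close> lies in one of the two parts.\<close>

lemma realises_glue:
  assumes "realises b u f lo m'" "realises b u g m hi"
    and "lo \<le> m" "m \<le> m'" "m' \<le> hi" "m' - m \<ge> int b - 1"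
    and "same_order_on {m..<m'} f g"
  shows "\<exists>h. realises b u h lo hi \<and> same_order_on {lo..<m'} f h \<and> same_order_on {m..<hi} g h"
proof -
  have "{lo..<m'} \<inter> {m..<hi} = {m..<m'}" "{lo..<m'} \<union> {m..<hi} = {lo..<hi}"
    using assms by auto
  then obtain h where h: "inj_on h {lo..<hi}" "same_order_on {lo..<m'} f h"
    "same_order_on {m..<hi} g h"
    using amalgamation[of "{m..<hi}" "{lo..<m'}" f g] assms realisesD(1) by auto
  have f: "realises b u h lo m'" and g: "realises b u h m hi"
    using realises_same_order assms(1,2) h by blast+
  have "pattern h z b = u z" if "lo \<le> z" "z + int b \<le> hi" for z
  proof (cases "z + int b \<le> m'")
    case True
    then show ?thesis using realisesD(2)[OF f] that by simp
  next
    case False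
    then show ?thesis using realisesD(2)[OF g] that assms by simp
  qed
  then show ?thesis using h unfolding realises_def by blast
qed

text \<open>The condition that consecutive patterns overlap correctly is that they form a walk in a factor
  graph; \<open>lo\<close> and \<open>hi\<close> bound the positions, so the last pattern starts at \<open>hi - b\<close>.\<close>

definition chain :: "nat \<Rightarrow> (int \<Rightarrow> nat list) \<Rightarrow> int \<Rightarrow> int \<Rightarrow> bool" where
  "chain b u lo hi \<longleftrightarrow> (\<forall>z. lo \<le> z \<and> z + int b \<le> hi \<longrightarrow> u z \<in> perms \<and> length (u z) = b) \<and>
     (\<forall>z. lo \<le> z \<and> z + 1 + int b \<le> hi \<longrightarrow>
        standardize (tl (u z)) = standardize (butlast (u (z + 1))))"

lemma chain_subset: "chain b u lo hi \<Longrightarrow> lo \<le> lo' \<Longrightarrow> hi' \<le> hi \<Longrightarrow> chain b u lo' hi'"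
  unfolding chain_def by auto

lemma realises_single:
  assumes "u z \<in> perms" "length (u z) = b"
  shows "realises b u (model_of (u z) z) z (z + int b)"
proof -
  have "z' = z" if "z \<le> z'" "z' + int b \<le> z + int b" for z' using that by simp
  then show ?thesis
    using inj_model_of[OF assms(1), of z] pattern_model_of[OF assms(1), of z] assms(2)
    unfolding realises_def by blast
qed

lemma edge_same_order:
  assumes "pattern h z b = s" "pattern h' (z + 1) b = t" "b \<ge> 1"
    and "inj_on h {z..<z + int b}" "inj_on h' {z + 1..<z + 1 + int b}"
    and "standardize (tl s) = standardize (butlast t)"
  shows "same_order_on {z + 1..<z + int b} h h'"
proof -
  have ls: "length s = b" "length t = b" using length_pattern assms by auto
  have "tl s = take (b - 1) (drop 1 s)" using ls by (simp add: drop_Suc)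
  then have 1: "standardize (tl s) = pattern h (z + 1) (b - 1)"
    using pattern_window[OF assms(4), of 1 "b - 1"] assms(1,3) by simp
  have "butlast t = take (b - 1) (drop 0 t)" using ls by (simp add: butlast_conv_take)
  then have 2: "standardize (butlast t) = pattern h' (z + 1) (b - 1)"
    using pattern_window[OF assms(5), of 0 "b - 1"] assms(2,3) by simp
  have eq: "z + 1 + int (b - 1) = z + int b" using assms(3) by simp
  have "inj_on h {z + 1..<z + 1 + int (b - 1)}" "inj_on h' {z + 1..<z + 1 + int (b - 1)}"
    by (rule inj_on_subset[OF assms(4)], use eq in force)
       (rule inj_on_subset[OF assms(5)], use eq in force)
  from pattern_eq_iff[OF this] 1 2 assms(6) eq show ?thesis by simp
qed

lemma edge_of_model:
  assumes "b \<ge> 1" "inj_on h {z..<z + 1 + int b}"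
  shows "standardize (tl (pattern h z b)) = standardize (butlast (pattern h (z + 1) b))"
proof -
  have i: "inj_on h {z..<z + int b}" "inj_on h {z + 1..<z + 1 + int b}"
    by (rule inj_on_subset[OF assms(2)], auto)+
  have l: "length (pattern h z b) = b" "length (pattern h (z + 1) b) = b"
    using i length_pattern by auto
  have "tl (pattern h z b) = take (b - 1) (drop 1 (pattern h z b))" using l by (simp add: drop_Suc)
  moreover have "butlast (pattern h (z + 1) b) = take (b - 1) (drop 0 (pattern h (z + 1) b))"
    using l by (simp add: butlast_conv_take)
  ultimately show ?thesis
    using pattern_window[OF i(1), of 1 "b - 1"] pattern_window[OF i(2), of 0 "b - 1"] assms(1)
    by simp
qed

lemma realises_extend_right1:
  assumes "b \<ge> 1" "chain b u lo (hi + 1)" "hi - lo \<ge> int b" "realises b u h lo hi"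
  shows "\<exists>h'. realises b u h' lo (hi + 1) \<and> same_order_on {lo..<hi} h h'"
proof -
  define z where "z = hi + 1 - int b"
  have "z - 1 \<ge> lo" "z - 1 + 1 + int b \<le> hi + 1" using assms(3) by (auto simp: z_def)
  then have u: "u z \<in> perms" "length (u z) = b"
    "standardize (tl (u (z - 1))) = standardize (butlast (u (z - 1 + 1)))"
    using assms(2) unfolding chain_def by auto
  note g = realises_single[of u z b, OF u(1,2)]
  have "same_order_on {z - 1 + 1..<z - 1 + int b} h (model_of (u z) z)"
  proof (rule edge_same_order)
    show "pattern h (z - 1) b = u (z - 1)"
      using realisesD(2)[OF assms(4), of "z - 1"] assms(3) unfolding z_def by simp
    show "pattern (model_of (u z) z) (z - 1 + 1) b = u (z - 1 + 1)"
      using realisesD(2)[OF g, of z] by simp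
    show "inj_on h {z - 1..<z - 1 + int b}"
      by (rule inj_on_subset[OF realisesD(1)[OF assms(4)]]) (use assms(3) in \<open>auto simp: z_def\<close>)
    show "inj_on (model_of (u z) z) {z - 1 + 1..<z - 1 + 1 + int b}"
      using realisesD(1)[OF g] by simp
  qed (use u(3) assms(1) in auto)
  moreover have "z - 1 + 1 = z" "z - 1 + int b = hi" by (auto simp: z_def)
  ultimately have "same_order_on {z..<hi} h (model_of (u z) z)" by metis
  moreover have "realises b u (model_of (u z) z) z (hi + 1)" using g unfolding z_def by simp
  ultimately show ?thesis
    using realises_glue[OF assms(4), of "model_of (u z) z" z "hi + 1"] assms
    unfolding z_def by auto
qed

lemma realises_extend_left1:
  assumes "b \<ge> 1" "chain b u (lo - 1) hi" "hi - lo \<ge> int b" "realises b u h lo hi"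
  shows "\<exists>h'. realises b u h' (lo - 1) hi \<and> same_order_on {lo..<hi} h h'"
proof -
  define z where "z = lo - 1"
  have u: "u z \<in> perms" "length (u z) = b"
    "standardize (tl (u z)) = standardize (butlast (u (z + 1)))"
    using assms unfolding chain_def z_def by auto
  note g = realises_single[of u z b, OF u(1,2)]
  have "same_order_on {lo..<z + int b} (model_of (u z) z) h"
    using edge_same_order[of "model_of (u z) z" z b "u z" h "u (z + 1)"]
      realisesD[OF g] realisesD(2)[OF assms(4), of "z + 1"] assms u(3)
      inj_on_subset[OF realisesD(1)[OF assms(4)], of "{z + 1..<z + 1 + int b}"]
    unfolding z_def by auto
  then show ?thesis
    using realises_glue[OF g assms(4)] assms
    unfolding z_def by auto
qed

text \<open>A realisation of a stretch of a walk never obstructs the realisation of the whole walk.\<close>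

lemma realises_extend:
  assumes "b \<ge> 1" "chain b u lo' hi'" "hi - lo \<ge> int b" "realises b u h lo hi"
    and "lo' \<le> lo" "hi \<le> hi'"
  shows "\<exists>h'. realises b u h' lo' hi' \<and> same_order_on {lo..<hi} h h'"
proof -
  have right: "\<exists>h'. realises b u h' lo (hi + int k) \<and> same_order_on {lo..<hi} h h'"
    if "hi + int k \<le> hi'" for k
    using that
  proof (induction k)
    case 0
    then show ?case using assms by (auto simp: same_order_on_def)
  next
    case (Suc k)
    then obtain h1 where h1: "realises b u h1 lo (hi + int k)" "same_order_on {lo..<hi} h h1" by auto
    obtain h2 where h2: "realises b u h2 lo (hi + int k + 1)"
      "same_order_on {lo..<hi + int k} h1 h2"
      using realises_extend_right1[OF assms(1) _ _ h1(1)] chain_subset[OF assms(2), of lo "hi + int k + 1"]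
        Suc assms by auto
    have "same_order_on {lo..<hi} h h2"
      by (rule same_order_on_trans[OF h1(2)]) (rule same_order_on_subset[OF h2(2)], auto)
    then show ?case using h2 by (auto simp: algebra_simps)
  qed
  from right[of "nat (hi' - hi)"] assms obtain h1 where
    h1: "realises b u h1 lo hi'" "same_order_on {lo..<hi} h h1" by auto
  have left: "\<exists>h'. realises b u h' (lo - int k) hi' \<and> same_order_on {lo..<hi'} h1 h'"
    if "lo - int k \<ge> lo'" for k
    using that
  proof (induction k)
    case 0
    then show ?case using h1 by (auto simp: same_order_on_def)
  next
    case (Suc k)
    then obtain h2 where h2: "realises b u h2 (lo - int k) hi'" "same_order_on {lo..<hi'} h1 h2"
      by auto
    obtain h3 where h3: "realises b u h3 (lo - int k - 1) hi'"
      "same_order_on {lo - int k..<hi'} h2 h3"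
      using realises_extend_left1[OF assms(1) _ _ h2(1)] chain_subset[OF assms(2), of "lo - int k - 1" hi']
        Suc assms by auto
    have "same_order_on {lo..<hi'} h1 h3"
      by (rule same_order_on_trans[OF h2(2)]) (rule same_order_on_subset[OF h3(2)], auto)
    then show ?case using h3 by (auto simp: algebra_simps)
  qed
  from left[of "nat (lo - lo')"] assms obtain h2 where
    h2: "realises b u h2 lo' hi'" "same_order_on {lo..<hi'} h1 h2" by auto
  have "same_order_on {lo..<hi} h h2"
    by (rule same_order_on_trans[OF h1(2)]) (rule same_order_on_subset[OF h2(2)], use assms in auto)
  with h2 show ?thesis by blast
qed

lemma realises_exists:
  assumes "b \<ge> 1" "chain b u lo hi" "hi - lo \<ge> int b"
  shows "\<exists>h. realises b u h lo hi"
proof -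
  have "realises b u (model_of (u lo) lo) lo (lo + int b)"
    using assms unfolding chain_def by (intro realises_single) auto
  from realises_extend[OF assms(1,2) _ this] assms(3) show ?thesis by auto
qed

section \<open>Permutations with a given path\<close>

definition window :: "(int \<Rightarrow> 'a) \<Rightarrow> int \<Rightarrow> nat \<Rightarrow> 'a list" where
  "window u lo N = map (\<lambda>k. u (lo + int k)) [0..<N]"

lemma length_window [simp]: "length (window u lo N) = N"
  by (simp add: window_def)

lemma nth_window [simp]: "k < N \<Longrightarrow> window u lo N ! k = u (lo + int k)"
  by (simp add: window_def)

lemma hd_window: "N \<ge> 1 \<Longrightarrow> hd (window u lo N) = u lo"
  by (simp add: window_def hd_map)

lemma last_window: "N \<ge> 1 \<Longrightarrow> last (window u lo N) = u (lo + int (N - 1))"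
  by (simp add: window_def last_map)

lemma pattern_in_perms_of_iff:
  assumes "inj_on h {lo..<lo + int (N + b - 1)}" "N \<ge> 1"
  shows "pattern h lo (N + b - 1) \<in> perms_of b (window u lo N) \<longleftrightarrow>
    realises b u h lo (lo + int (N + b - 1))"
proof -
  have e: "lo + int (N + b - 1) = lo + int N + int b - 1" using assms(2) by simp
  note inj = assms(1)
  have l: "length (pattern h lo (N + b - 1)) = N + b - 1" using length_pattern[OF inj] .
  have path: "path_of b (pattern h lo (N + b - 1)) = window (\<lambda>z. pattern h z b) lo N"
    unfolding path_of_def window_def l
    using pattern_window[OF inj, of _ b] assms(2) by (intro map_cong) auto
  have "path_of b (pattern h lo (N + b - 1)) = window u lo N \<longleftrightarrow>
      (\<forall>k<N. pattern h (lo + int k) b = u (lo + int k))"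
    unfolding path by (auto simp: window_def)
  also have "\<dots> \<longleftrightarrow> (\<forall>z. lo \<le> z \<and> z + int b \<le> lo + int (N + b - 1) \<longrightarrow> pattern h z b = u z)"
  proof (intro iffI allI impI)
    fix z assume "\<forall>k<N. pattern h (lo + int k) b = u (lo + int k)"
      "lo \<le> z \<and> z + int b \<le> lo + int (N + b - 1)"
    then show "pattern h z b = u z"
      using e by (auto dest!: spec[of _ "nat (z - lo)"])
  qed (use e in auto)
  finally show ?thesis
    using pattern_perms[OF inj] l assms unfolding perms_of_def realises_def by auto
qed

lemma perms_of_windowE:
  assumes "\<sigma> \<in> perms_of b (window u lo N)" "N \<ge> 1"
  obtains h where "h = model_of \<sigma> lo" "length \<sigma> = N + b - 1"
    "realises b u h lo (lo + int (N + b - 1))" "\<sigma> = pattern h lo (N + b - 1)"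
proof -
  have \<sigma>: "\<sigma> \<in> perms" "b \<le> length \<sigma>" "path_of b \<sigma> = window u lo N"
    using assms by (auto simp: perms_of_def)
  have "length (path_of b \<sigma>) = length \<sigma> - b + 1" by (simp add: path_of_def)
  with \<sigma> have l: "length \<sigma> = N + b - 1" by simp
  have p: "\<sigma> = pattern (model_of \<sigma> lo) lo (N + b - 1)"
    using pattern_model_of[OF \<sigma>(1), of lo] l by simp
  have "inj_on (model_of \<sigma> lo) {lo..<lo + int (N + b - 1)}"
    using inj_model_of[OF \<sigma>(1), of lo] unfolding l .
  then have "realises b u (model_of \<sigma> lo) lo (lo + int (N + b - 1))"
    using pattern_in_perms_of_iff[of "model_of \<sigma> lo" lo N b u] assms p by simp
  then show thesis by (rule that[OF refl l _ p])
qed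

lemma finite_perms_of: "finite (perms_of b \<pi>)"
proof -
  have "\<sigma> \<in> perms \<and> length \<sigma> \<le> length \<pi> + b" if "\<sigma> \<in> perms_of b \<pi>" for \<sigma>
  proof -
    have "length (path_of b \<sigma>) = length \<sigma> - b + 1" by (simp add: path_of_def)
    then show ?thesis using that by (auto simp: perms_of_def)
  qed
  then have "perms_of b \<pi> \<subseteq> {xs. set xs \<subseteq> {1..length \<pi> + b} \<and> length xs \<le> length \<pi> + b}"
    by (fastforce simp: perms_def)
  then show ?thesis
    by (rule finite_subset) (rule finite_lists_length_le, simp)
qed

text \<open>\<open>rigid\<close> is unambiguity of a path, in terms of models.\<close>

definition rigid :: "nat \<Rightarrow> (int \<Rightarrow> nat list) \<Rightarrow> int \<Rightarrow> int \<Rightarrow> bool" where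
  "rigid b u lo hi \<longleftrightarrow> (\<forall>h h'. realises b u h lo hi \<and> realises b u h' lo hi \<longrightarrow>
     same_order_on {lo..<hi} h h')"

lemma rigidD:
  "rigid b u lo hi \<Longrightarrow> realises b u h lo hi \<Longrightarrow> realises b u h' lo hi \<Longrightarrow>
    same_order_on {lo..<hi} h h'"
  by (auto simp: rigid_def)

lemma ambiguous_window_iff:
  assumes "N \<ge> 1"
  shows "ambiguous b (window u lo N) \<longleftrightarrow> \<not> rigid b u lo (lo + int (N + b - 1))"
proof -
  have "ambiguous b (window u lo N) \<longleftrightarrow>
      (\<exists>\<sigma>\<in>perms_of b (window u lo N). \<exists>\<tau>\<in>perms_of b (window u lo N). \<sigma> \<noteq> \<tau>)"
    unfolding ambiguous_def using finite_perms_of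
    by (metis One_nat_def card_le_Suc0_iff_eq not_less)
  also have "\<dots> \<longleftrightarrow> \<not> rigid b u lo (lo + int (N + b - 1))" (is "?L \<longleftrightarrow> ?R")
  proof
    assume ?L
    then obtain \<sigma> \<tau> where st: "\<sigma> \<in> perms_of b (window u lo N)" "\<tau> \<in> perms_of b (window u lo N)"
      "\<sigma> \<noteq> \<tau>" by blast
    obtain h where h: "realises b u h lo (lo + int (N + b - 1))" "\<sigma> = pattern h lo (N + b - 1)"
      using perms_of_windowE[OF st(1) assms] by blast
    obtain h' where h': "realises b u h' lo (lo + int (N + b - 1))" "\<tau> = pattern h' lo (N + b - 1)"
      using perms_of_windowE[OF st(2) assms] by blast
    show ?R
    proof
      assume "rigid b u lo (lo + int (N + b - 1))"
      then have "same_order_on {lo..<lo + int (N + b - 1)} h h'" using h h' by (auto simp: rigid_def)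
      then show False using pattern_cong_same_order[of lo "N + b - 1" h h'] realisesD(1)[OF h(1)]
          st(3) h(2) h'(2) by simp
    qed
  next
    assume ?R
    then obtain h h' where h: "realises b u h lo (lo + int (N + b - 1))"
      and h': "realises b u h' lo (lo + int (N + b - 1))"
      and ns: "\<not> same_order_on {lo..<lo + int (N + b - 1)} h h'" unfolding rigid_def by blast
    have "pattern h lo (N + b - 1) \<in> perms_of b (window u lo N)"
      "pattern h' lo (N + b - 1) \<in> perms_of b (window u lo N)"
      using pattern_in_perms_of_iff[OF realisesD(1) assms] h h' by blast+
    moreover have "pattern h lo (N + b - 1) \<noteq> pattern h' lo (N + b - 1)"
      using pattern_eq_iff[of h lo "N + b - 1" h' lo] realisesD(1)[OF h] realisesD(1)[OF h'] ns by simp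
    ultimately show ?L by blast
  qed
  finally show ?thesis .
qed

lemma perm_of_window:
  assumes "N \<ge> 1" "rigid b u lo (lo + int (N + b - 1))"
    "realises b u h lo (lo + int (N + b - 1))"
  shows "perms_of b (window u lo N) = {pattern h lo (N + b - 1)}"
    and "perm_of b (window u lo N) = pattern h lo (N + b - 1)"
proof -
  show *: "perms_of b (window u lo N) = {pattern h lo (N + b - 1)}"
  proof (rule set_eqI)
    fix \<sigma>
    show "\<sigma> \<in> perms_of b (window u lo N) \<longleftrightarrow> \<sigma> \<in> {pattern h lo (N + b - 1)}"
    proof
      assume s: "\<sigma> \<in> perms_of b (window u lo N)"
      obtain h' where h': "realises b u h' lo (lo + int (N + b - 1))" "\<sigma> = pattern h' lo (N + b - 1)"
        using perms_of_windowE[OF s assms(1)] by blast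
      have "same_order_on {lo..<lo + int (N + b - 1)} h h'"
        using rigidD[OF assms(2,3) h'(1)] .
      from pattern_cong_same_order[OF this] realisesD(1)[OF assms(3)] h'(2)
      show "\<sigma> \<in> {pattern h lo (N + b - 1)}" by simp
    qed (use pattern_in_perms_of_iff[OF realisesD(1)[OF assms(3)] assms(1), of u] assms in auto)
  qed
  then show "perm_of b (window u lo N) = pattern h lo (N + b - 1)"
    by (simp add: perm_of_def)
qed

text \<open>Two realisations of a shorter stretch extend to the longer one, where they have to agree.\<close>

lemma rigid_subset:
  assumes "b \<ge> 1" "rigid b u lo' hi'" "chain b u lo' hi'" "lo' \<le> lo" "hi \<le> hi'" "hi - lo \<ge> int b"
  shows "rigid b u lo hi"
  unfolding rigid_def
proof (intro allI impI, elim conjE)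
  fix h h' assume h: "realises b u h lo hi" "realises b u h' lo hi"
  obtain k where k: "realises b u k lo' hi'" "same_order_on {lo..<hi} h k"
    using realises_extend[OF assms(1,3,6) h(1) assms(4,5)] by blast
  obtain k' where k': "realises b u k' lo' hi'" "same_order_on {lo..<hi} h' k'"
    using realises_extend[OF assms(1,3,6) h(2) assms(4,5)] by blast
  have "same_order_on {lo..<hi} k k'"
    by (rule same_order_on_subset[OF rigidD[OF assms(2) k(1) k'(1)]]) (use assms in auto)
  then show "same_order_on {lo..<hi} h h'"
    using k(2) k'(2) same_order_on_sym same_order_on_trans by blast
qed

section \<open>Periodic blocks\<close>

text \<open>If two entries on different sides of a stretch of \<open>b - 1\<close> positions were not separated in
  value by an entry of the stretch, then some two entries on different sides would be adjacent in
  value.  No window sees both of them, so exchanging them would contradict rigidity.\<close>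

lemma rigid_separates:
  assumes "rigid b u lo hi" "realises b u h lo hi"
    and "m' - m \<ge> int b - 1" "lo \<le> m" "m' \<le> hi" "x \<in> {lo..<m}" "y \<in> {m'..<hi}" "b \<ge> 1"
  shows "\<exists>z\<in>{m..<m'}. h x < h z \<and> h z < h y \<or> h y < h z \<and> h z < h x"
proof (rule ccontr)
  assume none: "\<not> ?thesis"
  define btw where "btw p q r \<longleftrightarrow> h p < h q \<and> h q < h r \<or> h r < h q \<and> h q < h p" for p q r
  define D where "D = (\<lambda>(l, r). l \<in> {lo..<m} \<and> r \<in> {m'..<hi} \<and> (\<forall>z\<in>{m..<m'}. \<not> btw l z r))"
  have "D (x, y)" using none assms unfolding D_def btw_def by auto
  then obtain lr where lr: "D lr"
    "\<And>lr'. D lr' \<Longrightarrow> nat \<bar>h (fst lr) - h (snd lr)\<bar> \<le> nat \<bar>h (fst lr') - h (snd lr')\<bar>"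
    using ex_has_least_nat[of D "(x, y)" "\<lambda>lr. nat \<bar>h (fst lr) - h (snd lr)\<bar>"] by blast
  obtain l r where [simp]: "lr = (l, r)" by fastforce
  have inj: "inj_on h {lo..<hi}" using realisesD assms by blast
  have l: "l \<in> {lo..<m}" and r: "r \<in> {m'..<hi}" and n: "\<And>z. z \<in> {m..<m'} \<Longrightarrow> \<not> btw l z r"
    using lr(1) unfolding D_def by auto
  have lr': "l \<in> {lo..<hi}" "r \<in> {lo..<hi}" "l < r" "r - l \<ge> int b"
    using l r assms by auto
  have adj: "\<not> btw l e r" if e: "e \<in> {lo..<hi}" for e
  proof
    assume b: "btw l e r"
    consider "e \<in> {lo..<m}" | "e \<in> {m..<m'}" | "e \<in> {m'..<hi}" using e by force
    then show False
    proof cases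
      case 1
      moreover have "\<not> btw e z r" if "z \<in> {m..<m'}" for z
        using n[OF that] b unfolding btw_def by linarith
      ultimately have "D (e, r)" using r unfolding D_def by auto
      from lr(2)[OF this] b show False unfolding btw_def by auto
    next
      case 2
      with n b show False by blast
    next
      case 3
      moreover have "\<not> btw l z e" if "z \<in> {m..<m'}" for z
        using n[OF that] b unfolding btw_def by linarith
      ultimately have "D (l, e)" using l unfolding D_def by auto
      from lr(2)[OF this] b show False unfolding btw_def by auto
    qed
  qed
  have neq: "h l \<noteq> h r" using inj_onD[OF inj _ lr'(1,2)] lr'(3) by blast
  define k where "k = h(l := h r, r := h l)"
  have same: "same_order_on X h k" if "X \<subseteq> {lo..<hi}" and not_both: "\<not> (l \<in> X \<and> r \<in> X)" for X
    unfolding same_order_on_def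
  proof (intro ballI)
    fix p q assume pq: "p \<in> X" "q \<in> X"
    have ne: "h q \<noteq> h l" if "q \<noteq> l" "q \<in> X" for q
      using that \<open>X \<subseteq> _\<close> inj lr' by (auto simp: inj_on_def)
    have ne': "h q \<noteq> h r" if "q \<noteq> r" "q \<in> X" for q
      using that \<open>X \<subseteq> _\<close> inj lr' by (auto simp: inj_on_def)
    have A: "h q < h l \<longleftrightarrow> h q < h r" "h l < h q \<longleftrightarrow> h r < h q" if "q \<in> X" "q \<noteq> l" "q \<noteq> r" for q
      using adj[of q] that ne[of q] ne'[of q] \<open>X \<subseteq> _\<close> unfolding btw_def by auto
    have kl: "k l = h r" "k r = h l" and ko: "\<And>q. q \<noteq> l \<Longrightarrow> q \<noteq> r \<Longrightarrow> k q = h q"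
      using lr'(3) unfolding k_def by auto
    consider "p = q" | "p \<noteq> q" "p = l \<or> p = r" "q \<noteq> l" "q \<noteq> r"
      | "p \<noteq> l" "p \<noteq> r" "q = l \<or> q = r" | "p \<noteq> l" "p \<noteq> r" "q \<noteq> l" "q \<noteq> r"
      using not_both pq by blast
    then show "h p < h q \<longleftrightarrow> k p < k q"
    proof cases
      case 2
      then show ?thesis using A(2)[OF pq(2)] kl ko[of q] by metis
    next
      case 3
      then show ?thesis using A(1)[OF pq(1)] kl ko[of p] by metis
    qed (simp_all add: ko)
  qed
  have "inj_on k {lo..<hi}"
  proof (rule inj_onI)
    define sw where "sw p = (if p = l then r else if p = r then l else p)" for p
    have k_sw: "k p = h (sw p)" for p using lr'(3) by (simp add: k_def sw_def)
    fix p q assume pq: "p \<in> {lo..<hi}" "q \<in> {lo..<hi}" "k p = k q"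
    have "sw p \<in> {lo..<hi}" "sw q \<in> {lo..<hi}" using pq(1,2) lr'(1,2) by (simp_all add: sw_def)
    then have "sw p = sw q" using inj_onD[OF inj] pq(3) unfolding k_sw by blast
    then show "p = q" unfolding sw_def by (simp split: if_splits)
  qed
  moreover have "pattern k z b = u z" if "lo \<le> z" "z + int b \<le> hi" for z
  proof -
    have "same_order_on {z..<z + int b} h k"
      by (rule same) (use that lr' in auto)
    from pattern_cong_same_order[OF this] show ?thesis
      using realisesD(2)[OF assms(2) that] inj_on_subset[OF inj, of "{z..<z + int b}"] that by auto
  qed
  ultimately have "realises b u k lo hi" unfolding realises_def by blast
  from same_order_onD[OF rigidD[OF assms(1,2) this] lr'(1,2)]
  have "h l < h r \<longleftrightarrow> h r < h l" using lr'(3) unfolding k_def by simp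
  then show False using neq by linarith
qed

text \<open>\<open>shrinks\<close> is \<^const>\<open>shrinking\<close>, and \<open>encloses\<close> is \<^const>\<open>lies_in\<close>, for the entries
  \<open>H t i\<close> in position \<open>i\<close> of the \<open>t\<close>-th copy of an iterator of length \<open>n\<close>, counted from the
  connecting path.\<close>

fun shrinks :: "(nat \<Rightarrow> nat \<Rightarrow> int) \<Rightarrow> nat \<Rightarrow> iterator_pair \<Rightarrow> bool" where
  "shrinks H n (Inner i j) \<longleftrightarrow> i < n \<and> j < n \<and> H 0 i < H 0 j \<and>
     (\<forall>k<n. \<not> (H 0 i < H 0 k \<and> H 0 k < H 0 j)) \<and> H 0 i < H 1 i \<and> H 1 i < H 1 j \<and> H 1 j < H 0 j"
| "shrinks H n (Below q) \<longleftrightarrow> q < n \<and> (\<forall>k<n. H 0 q \<le> H 0 k) \<and> H 1 q < H 0 q"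
| "shrinks H n (Above q) \<longleftrightarrow> q < n \<and> (\<forall>k<n. H 0 k \<le> H 0 q) \<and> H 0 q < H 1 q"

fun encloses :: "(nat \<Rightarrow> nat \<Rightarrow> int) \<Rightarrow> nat \<Rightarrow> iterator_pair \<Rightarrow> int \<Rightarrow> bool" where
  "encloses H t (Inner i j) p \<longleftrightarrow> H t i < p \<and> p < H t j"
| "encloses H t (Below q) p \<longleftrightarrow> p < H t q"
| "encloses H t (Above q) p \<longleftrightarrow> H t q < p"



text \<open>\<open>N\<close> copies, of which each moves relative to its predecessor in the same way.  The last
  condition is the separation property for three consecutive copies.\<close>

locale blocks =
  fixes H :: "nat \<Rightarrow> nat \<Rightarrow> int" and n N :: nat
  assumes inj: "\<lbrakk>t < N; t' < N; i < n; j < n; H t i = H t' j\<rbrakk> \<Longrightarrow> t = t' \<and> i = j"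
    and shift: "\<lbrakk>Suc t < N; Suc t' < N; i < n; j < n\<rbrakk> \<Longrightarrow>
      H (Suc t) i < H (Suc t') j \<longleftrightarrow> H t i < H t' j"
    and sep: "\<lbrakk>i < n; j < n\<rbrakk> \<Longrightarrow>
      \<exists>k<n. H 0 i < H 1 k \<and> H 1 k < H 2 j \<or> H 2 j < H 1 k \<and> H 1 k < H 0 i"
    and N: "N \<ge> 3"
begin

lemma shift_iterated:
  "\<lbrakk>t + d < N; t' + d < N; i < n; j < n\<rbrakk> \<Longrightarrow> H (t + d) i < H (t' + d) j \<longleftrightarrow> H t i < H t' j"
  by (induction d) (auto simp: shift)

lemma increasing: "\<lbrakk>i < n; H 0 i < H 1 i; t \<le> t'; t' < N\<rbrakk> \<Longrightarrow> H t i \<le> H t' i"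
proof (induction t')
  case (Suc t')
  have "H t' i < H (Suc t') i"
    using shift_iterated[of 0 t' 1 i i] Suc.prems by simp
  then show ?case using Suc by (cases "t = Suc t'") auto
qed simp

lemma decreasing: "\<lbrakk>i < n; H 1 i < H 0 i; t \<le> t'; t' < N\<rbrakk> \<Longrightarrow> H t' i \<le> H t i"
proof (induction t')
  case (Suc t')
  have "H (Suc t') i < H t' i"
    using shift_iterated[of 1 t' 0 i i] Suc.prems by simp
  then show ?case using Suc by (cases "t = Suc t'") auto
qed simp

text \<open>Otherwise both \<open>H 0 k\<close> and \<open>H 2 i\<close> would lie in the gap between the adjacent entries
  \<open>H 1 i\<close> and \<open>H 1 k\<close>.\<close>

lemma overtakes_next:
  assumes "i < n" "k < n" "H 0 i < H 0 k" "\<forall>l<n. \<not> (H 0 i < H 0 l \<and> H 0 l < H 0 k)"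
    and "H 0 i < H 1 i" "H 0 k < H 1 k"
  shows "H 0 k < H 1 i"
proof (rule ccontr)
  assume "\<not> H 0 k < H 1 i"
  then have 1: "H 1 i < H 0 k" using inj[of 1 0 i k] N assms by force
  have 2: "H 2 i < H 1 k" using shift[of 1 0 i k] 1 N assms by (simp add: numeral_2_eq_2)
  have 3: "H 1 i < H 2 i" using shift[of 0 1 i i] N assms by (simp add: numeral_2_eq_2)
  obtain l where l: "l < n" "H 0 k < H 1 l \<and> H 1 l < H 2 i \<or> H 2 i < H 1 l \<and> H 1 l < H 0 k"
    using sep[OF assms(2,1)] by blast
  then have "H 1 i < H 1 l" "H 1 l < H 1 k" using 1 2 3 assms by auto
  then have "H 0 i < H 0 l" "H 0 l < H 0 k"
    using shift[of 0 0 i l] shift[of 0 0 l k] N assms l by auto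
  then show False using assms(4) l by blast
qed

text \<open>With every further copy, the increasing entry \<open>i\<close> passes at least one more of the entries of
  the first copy above it, as long as these increase too; it only gets stuck at a shrinking
  pair.\<close>

lemma overtakes:
  assumes "i < n" "H 0 i < H 1 i" "H 0 i < p"
    and "\<forall>k<n. H 0 i \<le> H 0 k \<and> H 0 k < p \<longrightarrow> H 0 k < H 1 k"
    and "\<forall>k<n. H 0 k \<noteq> p"
    and "\<forall>g. shrinks H n g \<longrightarrow> \<not> encloses H 0 g p"
    and "m = card {k. k < n \<and> H 0 i \<le> H 0 k \<and> H 0 k < p}"
  shows "(m < N \<longrightarrow> p < H m i) \<and> (\<exists>k<n. p < H 0 k)"
  using assms
proof (induction m arbitrary: i)
  case 0
  define A where "A = {k. k < n \<and> H 0 i \<le> H 0 k \<and> H 0 k < p}"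
  have "i \<in> A" "finite A" using 0 unfolding A_def by auto
  then have "card A \<noteq> 0" by auto
  then show ?case using 0(7) unfolding A_def by simp
next
  case (Suc m)
  define K where "K = {k. k < n \<and> H 0 i < H 0 k}"
  have "K \<noteq> {}"
  proof
    assume "K = {}"
    then have "\<forall>k<n. H 0 k \<le> H 0 i" unfolding K_def by force
    then have "shrinks H n (Above i)" using Suc.prems(1,2) by simp
    moreover have "encloses H 0 (Above i) p" using Suc.prems(3) by simp
    ultimately show False using Suc.prems(6) by blast
  qed
  moreover have "finite K" unfolding K_def by simp
  ultimately obtain k where k: "k \<in> K" "\<And>l. l \<in> K \<Longrightarrow> H 0 k \<le> H 0 l"
    by (metis arg_min_if_finite(1) arg_min_least)
  have k': "k < n" "H 0 i < H 0 k" "\<forall>l<n. \<not> (H 0 i < H 0 l \<and> H 0 l < H 0 k)"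
    using k unfolding K_def by force+
  have updn: "H 0 k < H 1 k \<or> H 1 k < H 0 k" using inj[of 0 1 k k] k' N by force
  show ?case
  proof (cases "p < H 0 k")
    \<comment> \<open>\<open>p\<close> lies between the adjacent entries \<open>i\<close> and \<open>k\<close>; these do not shrink, so \<open>k\<close> increases and is
      overtaken by \<open>i\<close> in the next copy.\<close>
    case True
    have "\<not> H 1 k < H 0 k"
    proof
      assume "H 1 k < H 0 k"
      moreover have "H 1 i < H 1 k" using shift[of 0 0 i k] k' N Suc.prems by simp
      ultimately have "shrinks H n (Inner i k)" using k' Suc.prems(1,2) by simp
      moreover have "encloses H 0 (Inner i k) p" using Suc.prems(3) True by simp
      ultimately show False using Suc.prems(6) by blast
    qed
    then have "H 0 k < H 1 i" using overtakes_next[of i k] updn k' Suc.prems by blast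
    moreover have "{l. l < n \<and> H 0 i \<le> H 0 l \<and> H 0 l < p} = {i}" (is "?A = _")
    proof
      show "?A \<subseteq> {i}"
      proof
        fix l assume l: "l \<in> ?A"
        then have "\<not> H 0 i < H 0 l" using k(2)[of l] True unfolding K_def by force
        then have "H 0 i = H 0 l" using l by simp
        then show "l \<in> {i}" using inj[of 0 0 i l] l N Suc.prems(1) by auto
      qed
    qed (use Suc.prems(1,3) in auto)
    ultimately show ?thesis using Suc.prems(7) True k'(1) by auto
  next
    case False
    then have kp: "H 0 k < p" using Suc.prems(5) k'(1) by (metis linorder_neqE)
    have up: "H 0 k < H 1 k" using Suc.prems(4) k' kp by auto
    have "{l. l < n \<and> H 0 k \<le> H 0 l \<and> H 0 l < p} =
        {l. l < n \<and> H 0 i \<le> H 0 l \<and> H 0 l < p} - {i}" (is "?A = ?B - _")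
    proof
      show "?A \<subseteq> ?B - {i}" using k'(2) by auto
      show "?B - {i} \<subseteq> ?A"
      proof
        fix l assume l: "l \<in> ?B - {i}"
        then have "H 0 i \<noteq> H 0 l" using inj[of 0 0 i l] N Suc.prems(1) by auto
        then have "l \<in> K" using l unfolding K_def by auto
        then show "l \<in> ?A" using k(2) l by auto
      qed
    qed
    moreover have "i \<in> {l. l < n \<and> H 0 i \<le> H 0 l \<and> H 0 l < p}" using Suc.prems by auto
    ultimately have c: "m = card {l. l < n \<and> H 0 k \<le> H 0 l \<and> H 0 l < p}"
      using Suc.prems(7) by simp
    have "\<forall>l<n. H 0 k \<le> H 0 l \<and> H 0 l < p \<longrightarrow> H 0 l < H 1 l"
      using Suc.prems(4) k'(2) by (meson less_imp_le order_trans)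
    from Suc.IH[OF k'(1) up kp this Suc.prems(5,6) c]
    have IH: "m < N \<longrightarrow> p < H m k" "\<exists>k<n. p < H 0 k" by blast+
    have "H 0 k < H 1 i" using overtakes_next[of i k] up k' Suc.prems by blast
    then have "H m k < H (Suc m) i" if "Suc m < N"
      using shift_iterated[of 0 m 1 k i] that k' Suc.prems(1) by simp
    then show ?thesis using IH by force
  qed
qed

text \<open>If only increasing entries of the first copy lie between its \<open>i\<close>-th entry and \<open>p\<close>, then they
  are overtaken one after the other, and \<open>p\<close> is passed by the \<open>n\<close>-th copy.  A decreasing entry between
  them is never overtaken, and then \<open>p\<close> is not passed either.\<close>

lemma stable_increasing:
  assumes "i < n" "H 0 i < H 1 i"
    and "\<forall>t<N. \<forall>k<n. H t k \<noteq> p"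
    and "\<forall>g. shrinks H n g \<longrightarrow> \<not> encloses H 0 g p"
    and "n - 1 \<le> t" "t < N"
  shows "p < H t i \<longleftrightarrow> p < H (n - 1) i"
proof
  assume "p < H (n - 1) i"
  then show "p < H t i" using increasing[OF assms(1,2,5,6)] by simp
next
  assume pt: "p < H t i"
  show "p < H (n - 1) i"
  proof (rule ccontr)
    assume "\<not> p < H (n - 1) i"
    moreover have "n - 1 < N" using assms(5,6) by simp
    then have "H (n - 1) i \<noteq> p" using assms(1,3) by blast
    ultimately have lt: "H (n - 1) i < p" by simp
    have "H 0 i \<le> H (n - 1) i" using increasing[of i 0 "n - 1"] assms by simp
    then have lt0: "H 0 i < p" using lt by simp
    show False
    proof (cases "\<forall>k<n. H 0 i \<le> H 0 k \<and> H 0 k < p \<longrightarrow> H 0 k < H 1 k")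
      case True
      define A where "A = {k. k < n \<and> H 0 i \<le> H 0 k \<and> H 0 k < p}"
      have o: "(card A < N \<longrightarrow> p < H (card A) i)" and ex: "\<exists>k<n. p < H 0 k"
        using overtakes[OF assms(1,2) lt0 True _ assms(4) refl] assms(3) N unfolding A_def by auto
      from ex obtain k where "k \<in> {..<n} - A" unfolding A_def by force
      moreover have "A \<subseteq> {..<n}" unfolding A_def by auto
      ultimately have "A \<subset> {..<n}" by blast
      from psubset_card_mono[OF _ this] have "card A < n" by simp
      then have "H (card A) i \<le> H (n - 1) i"
        using increasing[of i "card A" "n - 1"] assms by simp
      then show False using o lt assms \<open>card A < n\<close> by simp
    next
      case False
      then obtain d where d: "d < n" "H 0 i \<le> H 0 d" "H 0 d < p" "\<not> H 0 d < H 1 d" by blast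
      then have dn: "H 1 d < H 0 d" using inj[of 0 1 d d] N by force
      have "i \<noteq> d" using d assms by auto
      then have "H 0 i < H 0 d" using inj[of 0 0 i d] d N assms by force
      then have "H t i < H t d" using shift_iterated[of 0 t 0 i d] d assms by simp
      also have "\<dots> \<le> H 0 d" using decreasing[of d 0 t] d dn assms by simp
      finally show False using d pt by simp
    qed
  qed
qed

lemma negated: "blocks (\<lambda>t i. - H t i) n N"
proof
  show "\<exists>k<n. - H 0 i < - H 1 k \<and> - H 1 k < - H 2 j \<or> - H 2 j < - H 1 k \<and> - H 1 k < - H 0 i"
    if "i < n" "j < n" for i j
    using sep[OF that] by auto
qed (use inj shift N in auto)

end

fun negate_pair :: "iterator_pair \<Rightarrow> iterator_pair" where
  "negate_pair (Inner i j) = Inner j i"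
| "negate_pair (Below q) = Above q"
| "negate_pair (Above q) = Below q"

lemma shrinks_negate: "shrinks (\<lambda>t i. - H t i) n g \<longleftrightarrow> shrinks H n (negate_pair g)"
  by (cases g) auto

lemma encloses_negate: "encloses (\<lambda>t i. - H t i) t g (- p) \<longleftrightarrow> encloses H t (negate_pair g) p"
  by (cases g) auto

context blocks
begin

text \<open>The reason why splittable pairs are the only obstruction: the position of a value outside all
  shrinking pairs of the first copy is the same relative to all copies from the \<open>n\<close>-th one
  on.\<close>

lemma stable:
  assumes "i < n"
    and "\<forall>t<N. \<forall>k<n. H t k \<noteq> p"
    and "\<forall>g. shrinks H n g \<longrightarrow> \<not> encloses H 0 g p"
    and "n - 1 \<le> t" "t < N" "n - 1 \<le> t'" "t' < N"
  shows "p < H t i \<longleftrightarrow> p < H t' i"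
proof -
  have "p < H t i \<longleftrightarrow> p < H (n - 1) i" if t: "n - 1 \<le> t" "t < N" for t
  proof (cases "H 0 i < H 1 i")
    case True
    then show ?thesis using stable_increasing assms t by blast
  next
    case False
    then have dn: "- H 0 i < - H 1 i" using inj[of 0 1 i i] N assms(1) by force
    have "- p < - H t i \<longleftrightarrow> - p < - H (n - 1) i"
    proof (rule blocks.stable_increasing[OF negated assms(1) dn])
      show "\<forall>g. shrinks (\<lambda>t i. - H t i) n g \<longrightarrow> \<not> encloses (\<lambda>t i. - H t i) 0 g (- p)"
        using assms(3) by (simp add: shrinks_negate encloses_negate)
    qed (use assms t in auto)
    moreover have "n - 1 < N" using t by simp
    then have "p \<noteq> H t i" "p \<noteq> H (n - 1) i" using assms(1,2) t(2) by blast+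
    ultimately show ?thesis by linarith
  qed
  then show ?thesis using assms by blast
qed

text \<open>The lower end of a shrinking pair rises and its upper end falls from copy to copy, so the
  enclosed intervals are nested.\<close>

lemma encloses_decreasing:
  assumes "shrinks H n g" "encloses H t' g p" "t \<le> t'" "t' < N"
  shows "encloses H t g p"
proof (cases g)
  case (Inner i j)
  then have "H t i \<le> H t' i" "H t' j \<le> H t j"
    using assms increasing[of i t t'] decreasing[of j t t'] by auto
  then show ?thesis using Inner assms by auto
next
  case (Below q)
  then show ?thesis using assms decreasing[of q t t'] by auto
next
  case (Above q)
  then show ?thesis using assms increasing[of q t t'] by auto
qed

lemma not_encloses_own:
  assumes "shrinks H n g" "k < n" "t < N"
  shows "\<not> encloses H t g (H 0 k)"
proof
  assume "encloses H t g (H 0 k)"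
  from encloses_decreasing[OF assms(1) this] have "encloses H 0 g (H 0 k)" using assms by simp
  then show False using assms by (cases g) force+
qed

text \<open>The entries are doubled to make room for the new value.\<close>

lemma exists_between_pairs:
  assumes "shrinks H n g" "Suc t < N"
  shows "\<exists>p. odd p \<and> encloses (\<lambda>t i. 2 * H t i) t g p \<and> \<not> encloses (\<lambda>t i. 2 * H t i) (Suc t) g p"
proof (cases g)
  case (Inner i j)
  then have "H t i < H (Suc t) i" "H (Suc t) j < H t j" "H (Suc t) i < H (Suc t) j"
    using assms shift_iterated[of 0 t 1 i i] shift_iterated[of 1 t 0 j j]
      shift_iterated[of 0 "Suc t" 0 i j] by auto
  then show ?thesis using Inner by (intro exI[of _ "2 * H t i + 1"]) auto
next
  case (Below q)
  then have "H (Suc t) q < H t q"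
    using assms shift_iterated[of 1 t 0 q q] by auto
  then show ?thesis using Below by (intro exI[of _ "2 * H (Suc t) q + 1"]) auto
next
  case (Above q)
  then have "H t q < H (Suc t) q"
    using assms shift_iterated[of 0 t 1 q q] by auto
  then show ?thesis using Above by (intro exI[of _ "2 * H t q + 1"]) auto
qed

end

text \<open>The offset \<open>d\<close> between consecutive copies is positive for a terminal cycle and negative for an
  initial one.\<close>

lemma realises_blocks:
  assumes "realises b v h lo hi" and rig: "\<And>lo hi. hi - lo \<ge> int b \<Longrightarrow> rigid b v lo hi"
    and "\<bar>d\<bar> = int n" "b \<ge> 1" "n \<ge> b" "N \<ge> 3"
    and per: "\<And>z. v (z + d) = v z"
    and pos: "\<And>t i. t < N \<Longrightarrow> i < n \<Longrightarrow> s + int t * d + int i \<in> {lo..<hi}"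
  shows "blocks (\<lambda>t i. h (s + int t * d + int i)) n N"
proof
  have injh: "inj_on h {lo..<hi}" using realisesD assms by blast
  have n: "n \<ge> 1" using assms by simp
  have d: "d = int n \<or> d = - int n" using assms(3) by linarith
  show "t = t' \<and> i = j" if "t < N" "t' < N" "i < n" "j < n"
    "h (s + int t * d + int i) = h (s + int t' * d + int j)" for t t' i j
  proof -
    have "s + int t * d + int i = s + int t' * d + int j"
      using inj_onD[OF injh that(5) pos[OF that(1,3)] pos[OF that(2,4)]] .
    then have e: "(int t - int t') * d = int j - int i" by (simp add: algebra_simps)
    have "int t = int t'"
    proof (rule ccontr)
      assume "int t \<noteq> int t'"
      then have "1 \<le> \<bar>int t - int t'\<bar>" by linarith
      then have "int n \<le> \<bar>int t - int t'\<bar> * \<bar>d\<bar>" using assms(3)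
        by (metis mult_cancel_right1 mult_right_mono abs_ge_zero)
      then show False using e that by (simp flip: abs_mult)
    qed
    then show ?thesis using e by simp
  qed
  show "h (s + int (Suc t) * d + int i) < h (s + int (Suc t') * d + int j) \<longleftrightarrow>
      h (s + int t * d + int i) < h (s + int t' * d + int j)"
    if "Suc t < N" "Suc t' < N" "i < n" "j < n" for t t' i j
  proof -
    define lo' hi' where "lo' = max lo (lo - d)" and "hi' = min hi (hi - d)"
    have p: "s + int t * d + int i \<in> {lo'..<hi'}" if "Suc t < N" "i < n" for t i
      using pos[of t i] pos[of "Suc t" i] that unfolding lo'_def hi'_def
      by (auto simp: algebra_simps)
    have len: "hi' - lo' \<ge> int b"
      using p[of 0 0] p[of 0 "n - 1"] p[of 1 0] p[of 1 "n - 1"] assms(5,6) n by auto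
    have "realises b v (\<lambda>z. h (z + d)) (lo - d) (hi - d)"
      using realises_shift[OF assms(1), of d] per by simp
    then have "realises b v (\<lambda>z. h (z + d)) lo' hi'" "realises b v h lo' hi'"
      using realises_subset assms(1) unfolding lo'_def hi'_def by (metis max.cobounded1 max.cobounded2 min.cobounded1 min.cobounded2)+
    from same_order_onD[OF rigidD[OF rig[OF len] this] p[OF that(1,3)] p[OF that(2,4)]]
    have "h (s + int t * d + int i + d) < h (s + int t' * d + int j + d) \<longleftrightarrow>
      h (s + int t * d + int i) < h (s + int t' * d + int j)" .
    moreover have e: "s + int (Suc t) * d + int i = s + int t * d + int i + d" for t i
      by (simp add: algebra_simps)
    ultimately show ?thesis unfolding e by simp
  qed
  show "\<exists>k<n. h (s + int 0 * d + int i) < h (s + int 1 * d + int k) \<and>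
       h (s + int 1 * d + int k) < h (s + int 2 * d + int j) \<or>
       h (s + int 2 * d + int j) < h (s + int 1 * d + int k) \<and>
       h (s + int 1 * d + int k) < h (s + int 0 * d + int i)" if "i < n" "j < n" for i j
  proof -
    have q: "\<exists>k<n. z = s + d + int k" if "z \<in> {s + d..<s + d + int n}" for z
      using that by (intro exI[of _ "nat (z - s - d)"]) auto
    have r: "rigid b v lo hi"
      by (rule rig) (use pos[of 0 0] pos[of 0 "n - 1"] n assms(5,6) in auto)
    have "\<exists>z\<in>{s + d..<s + d + int n}. h (s + int i) < h z \<and> h z < h (s + 2 * d + int j) \<or>
       h (s + 2 * d + int j) < h z \<and> h z < h (s + int i)"
    proof (cases "d = int n")
      case True
      show ?thesis
        by (rule rigid_separates[OF r assms(1)])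
          (use that pos[of 0 i] pos[of 2 j] pos[of 1 0] pos[of 1 "n - 1"] assms n True in auto)
    next
      case False
      then have "d = - int n" using d by simp
      then have "\<exists>z\<in>{s + d..<s + d + int n}. h (s + 2 * d + int j) < h z \<and> h z < h (s + int i) \<or>
          h (s + int i) < h z \<and> h z < h (s + 2 * d + int j)"
        by (intro rigid_separates[OF r assms(1)])
          (use that pos[of 0 i] pos[of 2 j] pos[of 1 0] pos[of 1 "n - 1"] assms n in auto)
      then show ?thesis by blast
    qed
    then show ?thesis using q by fastforce
  qed
qed (use assms in auto)

section \<open>Walks, cycles and bicycles\<close>

lemma set_vwalk_arcs: "set (vwalk_arcs p) = {(p ! i, p ! Suc i) |i. Suc i < length p}"
proof (induction p rule: vwalk_arcs.induct)
  case (3 x y xs)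
  have "{(((x # y # xs) ! i), ((x # y # xs) ! Suc i)) |i. Suc i < length (x # y # xs)} =
      insert (x, y) {((y # xs) ! i, (y # xs) ! Suc i) |i. Suc i < length (y # xs)}"
  proof (intro set_eqI iffI)
    fix e assume "e \<in> {(((x # y # xs) ! i), ((x # y # xs) ! Suc i)) |i. Suc i < length (x # y # xs)}"
    then obtain i where i: "e = ((x # y # xs) ! i, (x # y # xs) ! Suc i)" "Suc i < length (x # y # xs)"
      by blast
    show "e \<in> insert (x, y) {((y # xs) ! i, (y # xs) ! Suc i) |i. Suc i < length (y # xs)}"
    proof (cases i)
      case (Suc j)
      then show ?thesis using i by auto
    qed (use i in auto)
  next
    fix e assume "e \<in> insert (x, y) {((y # xs) ! i, (y # xs) ! Suc i) |i. Suc i < length (y # xs)}"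
    then show "e \<in> {(((x # y # xs) ! i), ((x # y # xs) ! Suc i)) |i. Suc i < length (x # y # xs)}"
    proof
      assume "e = (x, y)"
      then show ?thesis by (intro CollectI exI[of _ 0]) auto
    next
      assume "e \<in> {((y # xs) ! i, (y # xs) ! Suc i) |i. Suc i < length (y # xs)}"
      then obtain i where "e = ((y # xs) ! i, (y # xs) ! Suc i)" "Suc i < length (y # xs)" by blast
      then show ?thesis by (intro CollectI exI[of _ "Suc i"]) auto
    qed
  qed
  with 3 show ?case by simp
qed auto

lemma in_paths_iff:
  "p \<in> paths G \<longleftrightarrow> p \<noteq> [] \<and> set p \<subseteq> pverts G \<and>
     (\<forall>i. Suc i < length p \<longrightarrow> (p ! i, p ! Suc i) \<in> parcs G)"
  unfolding paths_def by (auto simp: vwalk_def set_vwalk_arcs)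

lemma in_paths_mono:
  "p \<in> paths H \<Longrightarrow> subgraph (with_proj H) (with_proj G) \<Longrightarrow> p \<in> paths G"
  by (auto simp: in_paths_iff subgraph_def)

lemma window_in_paths_iff:
  assumes "N \<ge> 1"
  shows "window u lo N \<in> paths G \<longleftrightarrow> (\<forall>z. lo \<le> z \<and> z < lo + int N \<longrightarrow> u z \<in> pverts G) \<and>
     (\<forall>z. lo \<le> z \<and> z + 1 < lo + int N \<longrightarrow> (u z, u (z + 1)) \<in> parcs G)"
proof -
  have "set (window u lo N) \<subseteq> pverts G \<longleftrightarrow> (\<forall>z. lo \<le> z \<and> z < lo + int N \<longrightarrow> u z \<in> pverts G)"
  proof (intro iffI allI impI)
    fix z assume "set (window u lo N) \<subseteq> pverts G" "lo \<le> z \<and> z < lo + int N"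
    then show "u z \<in> pverts G"
      using nth_mem[of "nat (z - lo)" "window u lo N"] by auto
  qed (auto simp: window_def)
  moreover have "(\<forall>i. Suc i < N \<longrightarrow> (window u lo N ! i, window u lo N ! Suc i) \<in> parcs G) \<longleftrightarrow>
     (\<forall>z. lo \<le> z \<and> z + 1 < lo + int N \<longrightarrow> (u z, u (z + 1)) \<in> parcs G)"
  proof (intro iffI allI impI)
    fix z assume a: "\<forall>i. Suc i < N \<longrightarrow> (window u lo N ! i, window u lo N ! Suc i) \<in> parcs G"
      "lo \<le> z \<and> z + 1 < lo + int N"
    then have "Suc (nat (z - lo)) < N" by auto
    with a(1) have "(window u lo N ! nat (z - lo), window u lo N ! Suc (nat (z - lo))) \<in> parcs G"
      by blast
    moreover have "lo + int (Suc (nat (z - lo))) = z + 1" "lo + int (nat (z - lo)) = z"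
      using a(2) by auto
    ultimately show "(u z, u (z + 1)) \<in> parcs G"
      using \<open>Suc (nat (z - lo)) < N\<close> by (metis Suc_lessD nth_window)
  next
    fix i assume "\<forall>z. lo \<le> z \<and> z + 1 < lo + int N \<longrightarrow> (u z, u (z + 1)) \<in> parcs G" "Suc i < N"
    moreover have "lo + int (Suc i) = lo + int i + 1" by simp
    ultimately show "(window u lo N ! i, window u lo N ! Suc i) \<in> parcs G"
      by (simp only: nth_window Suc_lessD) auto
  qed
  moreover have "window u lo N \<noteq> []" using assms by (simp add: window_def)
  ultimately show ?thesis unfolding in_paths_iff by simp
qed

text \<open>The bi-infinite walk round the cycle \<open>X\<close> that is at the first vertex of \<open>X\<close> at index \<open>s\<close>.\<close>

definition cyc :: "'a list \<Rightarrow> int \<Rightarrow> int \<Rightarrow> 'a" where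
  "cyc X s z = X ! nat ((z - s) mod int (length X))"

definition cycle_arcs :: "'a list \<Rightarrow> ('a \<times> 'a) set" where
  "cycle_arcs X = {(X ! i, X ! (Suc i mod length X)) |i. i < length X}"

lemma set_vwalk_arcs_closed_up: "set (vwalk_arcs (closed_up X)) = cycle_arcs X"
proof (cases "X = []")
  case False
  have "closed_up X ! i = X ! i" if "i < length X" for i
    using that by (auto simp: closed_up_def nth_append)
  moreover have "closed_up X ! Suc i = X ! (Suc i mod length X)" if "i < length X" for i
    using that False by (cases "Suc i = length X") (auto simp: closed_up_def nth_append hd_conv_nth)
  moreover have "length (closed_up X) = Suc (length X)" using False by (simp add: closed_up_def)
  ultimately show ?thesis unfolding set_vwalk_arcs cycle_arcs_def
    by (intro Collect_cong) (metis Suc_less_eq)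
qed (simp add: closed_up_def cycle_arcs_def)

lemma cyc_in_set: "X \<noteq> [] \<Longrightarrow> cyc X s z \<in> set X"
  by (simp add: cyc_def nat_less_iff)

lemma cyc_period: "cyc X s (z + int (length X) * k) = cyc X s z"
proof -
  have "(z + int (length X) * k - s) mod int (length X) = (z - s) mod int (length X)"
    by (metis add_diff_eq diff_add_eq mod_mult_self2)
  then show ?thesis by (simp add: cyc_def)
qed

lemma cyc_eq_iff:
  assumes "distinct X" "X \<noteq> []"
  shows "cyc X s z = cyc X s z' \<longleftrightarrow> int (length X) dvd (z - z')"
proof -
  have "cyc X s z = cyc X s z' \<longleftrightarrow>
      nat ((z - s) mod int (length X)) = nat ((z' - s) mod int (length X))"
    unfolding cyc_def using assms by (intro nth_eq_iff_index_eq) (auto simp: nat_less_iff)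
  also have "\<dots> \<longleftrightarrow> (z - s) mod int (length X) = (z' - s) mod int (length X)"
    using assms by (auto simp: nat_eq_iff)
  also have "\<dots> \<longleftrightarrow> int (length X) dvd (z - z')"
    by (simp add: mod_eq_dvd_iff)
  finally show ?thesis .
qed

lemma cyc_add: "cyc X s (z + d) = cyc X (s - d) z"
  by (simp add: cyc_def algebra_simps)

lemma cyc_nth: "i < length X \<Longrightarrow> cyc X s (s + int i) = X ! i"
  by (simp add: cyc_def)

lemma cyc_surj:
  assumes "x \<in> set X"
  obtains z where "lo \<le> z" "z < lo + int (length X)" "cyc X s z = x"
proof -
  obtain i where i: "i < length X" "x = X ! i" using assms by (auto simp: in_set_conv_nth)
  define r where "r = int (length X)"
  have r: "r > 0" using i unfolding r_def by auto
  define z where "z = lo + (s + int i - lo) mod r"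
  have "cyc X s z = cyc X s (s + int i + r * (- ((s + int i - lo) div r)))"
    unfolding z_def by (rule arg_cong[of _ _ "cyc X s"]) (simp add: minus_mult_div_eq_mod[symmetric] algebra_simps)
  also have "\<dots> = x" unfolding r_def using i by (simp only: cyc_period cyc_nth)
  finally show ?thesis using that[of z] r unfolding z_def r_def by simp
qed

lemma cycle_arcs_eq:
  assumes "X \<noteq> []"
  shows "cycle_arcs X = range (\<lambda>z. (cyc X s z, cyc X s (z + 1)))"
proof -
  have succ: "cyc X s (z + 1) = X ! (Suc (nat ((z - s) mod int (length X))) mod length X)" for z
  proof -
    have "int (Suc (nat ((z - s) mod int (length X))) mod length X) =
        ((z - s) mod int (length X) + 1) mod int (length X)"
      using assms by (simp add: zmod_int add.commute)
    also have "\<dots> = (z + 1 - s) mod int (length X)"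
      by (simp add: mod_simps algebra_simps)
    finally have "Suc (nat ((z - s) mod int (length X))) mod length X =
        nat ((z + 1 - s) mod int (length X))" by simp
    then show ?thesis by (simp add: cyc_def)
  qed
  show ?thesis
  proof (intro set_eqI iffI)
    fix e assume "e \<in> cycle_arcs X"
    then obtain i where i: "i < length X" "e = (X ! i, X ! (Suc i mod length X))"
      unfolding cycle_arcs_def by blast
    have "(s + int i - s) mod int (length X) = int i" using i by simp
    then show "e \<in> range (\<lambda>z. (cyc X s z, cyc X s (z + 1)))"
      using i succ[of "s + int i"] cyc_nth[OF i(1), of s] by (intro image_eqI[of _ _ "s + int i"]) auto
  next
    fix e assume "e \<in> range (\<lambda>z. (cyc X s z, cyc X s (z + 1)))"
    then show "e \<in> cycle_arcs X"
      unfolding cycle_arcs_def using succ assms by (auto simp: cyc_def nat_less_iff)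
  qed
qed

lemma cyc_succ: "X \<noteq> [] \<Longrightarrow> (cyc X s z, cyc X s (z + 1)) \<in> cycle_arcs X"
  using cycle_arcs_eq by fast

lemma cycle_arcs_succ:
  assumes "distinct X" "X \<noteq> []" "(cyc X s z, y) \<in> cycle_arcs X"
  shows "y = cyc X s (z + 1)"
proof -
  obtain z' where z': "cyc X s z = cyc X s z'" "y = cyc X s (z' + 1)"
    using assms(3) unfolding cycle_arcs_eq[OF assms(2), of s] by auto
  then have "int (length X) dvd (z' + 1 - (z + 1))"
    using cyc_eq_iff[OF assms(1,2), of s z' z] by simp
  then show ?thesis using z'(2) cyc_eq_iff[OF assms(1,2), of s "z' + 1" "z + 1"] by simp
qed

lemma cycle_arcs_subset: "cycle_arcs X \<subseteq> set X \<times> set X"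
  by (auto simp: cycle_arcs_def intro!: nth_mem mod_less_divisor)

definition graph_cycle :: "'a pair_pre_digraph \<Rightarrow> 'a list \<Rightarrow> bool" where
  "graph_cycle G D \<longleftrightarrow> D \<noteq> [] \<and> distinct D \<and> cycle_arcs D \<subseteq> parcs G"

lemma simple_cycle_closed_up_iff:
  assumes "X \<noteq> []"
  shows "simple_cycle G (closed_up X) \<longleftrightarrow> graph_cycle G X \<and> set X \<subseteq> pverts G"
proof -
  have "length (closed_up X) \<ge> 2" "hd (closed_up X) = last (closed_up X)" "butlast (closed_up X) = X"
    "set (closed_up X) = set X" "closed_up X \<noteq> []"
    using assms by (cases X; auto simp: closed_up_def)+
  then show ?thesis
    using assms unfolding simple_cycle_def path_cycle_def paths_def vwalk_def graph_cycle_def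
    by (auto simp: set_vwalk_arcs_closed_up)
qed

text \<open>The bi-infinite walk round the initial cycle, along the connecting path, whose first vertex
  has index \<open>0\<close>, and round the terminal cycle.  If a cycle is absent, then only the part on the
  other side of it is meaningful.\<close>

definition bicycle_walk :: "'a list \<Rightarrow> 'a list \<Rightarrow> 'a list \<Rightarrow> int \<Rightarrow> 'a" where
  "bicycle_walk I P T z =
     (if z < 0 then cyc I 0 z else if z < int (length P) then P ! nat z
      else cyc T (int (length P) - 1) z)"

text \<open>The indices from \<open>lo\<close> to \<open>hi - 1\<close> lie in the meaningful part of the walk.\<close>

definition in_span :: "'a list \<Rightarrow> 'a list \<Rightarrow> 'a list \<Rightarrow> int \<Rightarrow> int \<Rightarrow> bool" where
  "in_span I P T lo hi \<longleftrightarrow> (I = [] \<longrightarrow> 0 \<le> lo) \<and> (T = [] \<longrightarrow> hi \<le> int (length P))"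

locale bicycle_with_parts =
  fixes B :: "'a pair_pre_digraph" and I P T :: "'a list"
  assumes parts: "bicycle_parts B I P T"
begin

abbreviation u where "u \<equiv> bicycle_walk I P T"
abbreviation e where "e \<equiv> int (length P) - 1"

lemma P: "P \<noteq> []" "distinct P"
  using parts unfolding bicycle_parts_def by (auto simp: vpath_def vwalk_def)

lemma e_nonneg: "e \<ge> 0" using P by (cases P) auto

lemma I: "I \<noteq> [] \<Longrightarrow> distinct I" and T: "T \<noteq> [] \<Longrightarrow> distinct T"
  using parts simple_cycle_closed_up_iff unfolding bicycle_parts_def graph_cycle_def by blast+

lemma I_T: "set I \<inter> set T = {}" using parts unfolding bicycle_parts_def by blast

lemma parcs_eq: "parcs B = cycle_arcs I \<union> {(P ! i, P ! Suc i) |i. Suc i < length P} \<union> cycle_arcs T"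
  using parts unfolding bicycle_parts_def set_vwalk_arcs_closed_up
  by (simp add: set_vwalk_arcs)

lemma pverts_eq: "pverts B = set I \<union> set P \<union> set T"
  using parts unfolding bicycle_parts_def by simp

lemma walk_P: "0 \<le> z \<Longrightarrow> z \<le> e \<Longrightarrow> u z = P ! nat z"
  by (simp add: bicycle_walk_def)

lemma walk_initial: "I \<noteq> [] \<Longrightarrow> z \<le> 0 \<Longrightarrow> u z = cyc I 0 z"
proof (cases "z = 0")
  case True
  assume "I \<noteq> []"
  then show ?thesis using True P parts unfolding bicycle_parts_def
    by (simp add: bicycle_walk_def cyc_def hd_conv_nth)
qed (simp add: bicycle_walk_def)

lemma walk_terminal: "T \<noteq> [] \<Longrightarrow> e \<le> z \<Longrightarrow> u z = cyc T e z"
proof (cases "z = e")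
  case True
  assume "T \<noteq> []"
  moreover have "nat e = length P - 1" "0 \<le> e" using e_nonneg by auto
  ultimately show ?thesis using True P parts unfolding bicycle_parts_def
    by (auto simp add: bicycle_walk_def cyc_def hd_conv_nth last_conv_nth)
next
  case False
  moreover assume "e \<le> z"
  ultimately show ?thesis using e_nonneg by (simp add: bicycle_walk_def)
qed

lemma walk_in_T_iff:
  assumes "T \<noteq> []" "I = [] \<longrightarrow> 0 \<le> z"
  shows "u z \<in> set T \<longleftrightarrow> e \<le> z"
proof
  assume uT: "u z \<in> set T"
  show "e \<le> z"
  proof (rule ccontr)
    assume "\<not> e \<le> z"
    then have ze: "z < e" by simp
    show False
    proof (cases "z < 0")
      case True
      then have "u z \<in> set I" using walk_initial[of z] cyc_in_set[of I 0 z] assms by auto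
      then show False using I_T uT by auto
    next
      case False
      then have "u z = butlast P ! nat z" "nat z < length (butlast P)"
        using ze walk_P[of z] by (auto simp: nth_butlast)
      then have "u z \<in> set (butlast P)" by simp
      then show False using uT parts assms unfolding bicycle_parts_def by auto
    qed
  qed
qed (simp add: walk_terminal cyc_in_set assms)

lemma walk_in_I_iff:
  assumes "I \<noteq> []" "T = [] \<longrightarrow> z \<le> e"
  shows "u z \<in> set I \<longleftrightarrow> z \<le> 0"
proof
  assume uI: "u z \<in> set I"
  show "z \<le> 0"
  proof (rule ccontr)
    assume z0: "\<not> z \<le> 0"
    show False
    proof (cases "z > e")
      case True
      then have "u z \<in> set T" using walk_terminal[of z] cyc_in_set[of T e z] assms by auto
      then show False using I_T uI by auto
    next
      case False
      then have "u z = tl P ! nat (z - 1)" "nat (z - 1) < length (tl P)"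
        using z0 walk_P[of z] by (auto simp: nth_tl nat_diff_distrib')
      then have "u z \<in> set (tl P)" by simp
      then show False using uI parts assms unfolding bicycle_parts_def by auto
    qed
  qed
qed (simp add: walk_initial cyc_in_set assms)

text \<open>A vertex recurs only while the walk winds round one of the cycles, because the connecting path
  is simple and meets the cycles in its end points only.\<close>

lemma walk_repeats:
  assumes "u z = u z'" "z < z'" "in_span I P T z (z' + 1)"
  shows "I \<noteq> [] \<and> z' \<le> 0 \<or> T \<noteq> [] \<and> e \<le> z"
proof (rule ccontr)
  assume a: "\<not> ?thesis"
  have z0: "0 \<le> z"
  proof (cases "I = []")
    case False
    then have "u z' \<notin> set I" using a assms walk_in_I_iff[of z'] by (auto simp: in_span_def)
    then show ?thesis using False assms walk_in_I_iff[of z] by (auto simp: in_span_def)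
  qed (use assms in \<open>auto simp: in_span_def\<close>)
  have ze: "z' \<le> e"
  proof (cases "T = []")
    case False
    then have "u z \<notin> set T" using a assms walk_in_T_iff[of z] by (auto simp: in_span_def)
    then show ?thesis using False assms walk_in_T_iff[of z'] by (auto simp: in_span_def)
  qed (use assms in \<open>auto simp: in_span_def\<close>)
  have "P ! nat z = P ! nat z'" using walk_P z0 ze assms by simp
  then show False using P(2) z0 ze assms by (auto simp: nth_eq_iff_index_eq)
qed

lemma walk_vertex: "in_span I P T z (z + 1) \<Longrightarrow> u z \<in> pverts B"
  unfolding pverts_eq bicycle_walk_def in_span_def using cyc_in_set by auto

lemma walk_arc:
  assumes "in_span I P T z (z + 2)"
  shows "(u z, u (z + 1)) \<in> parcs B"
proof -
  consider "z < 0" | "0 \<le> z" "z < e" | "e \<le> z" by linarith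
  then show ?thesis
  proof cases
    case 1
    then have "I \<noteq> []" using assms by (auto simp: in_span_def)
    then show ?thesis using cyc_succ[of I 0 z] walk_initial 1 unfolding parcs_eq by auto
  next
    case 2
    then have "u (z + 1) = P ! Suc (nat z)" "u z = P ! nat z" "Suc (nat z) < length P"
      using walk_P[of z] walk_P[of "z + 1"] by (auto simp: nat_add_distrib)
    then show ?thesis unfolding parcs_eq by auto
  next
    case 3
    then have "T \<noteq> []" using assms by (auto simp: in_span_def)
    then show ?thesis using cyc_succ[of T e z] walk_terminal 3 unfolding parcs_eq by auto
  qed
qed

lemma walk_window_in_paths:
  assumes "in_span I P T lo (lo + int N)" "N \<ge> 1"
  shows "window u lo N \<in> paths B"
  unfolding window_in_paths_iff[OF assms(2)]
  using walk_vertex walk_arc assms(1) by (auto simp: in_span_def)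

text \<open>A walk that ends at the vertex where the initial cycle and the connecting path meet can be
  read as a window ending at index \<open>0\<close> or at a negative one, depending on whether it is to be
  continued along the path or along the cycle.  The bounds say that the
  window starts in the first round of the terminal cycle at the latest and ends in the last round of
  the initial cycle at the earliest; they make the end points comparable later.\<close>

lemma path_is_window:
  assumes "\<pi> \<in> paths B"
  shows "\<exists>lo. \<pi> = window u lo (length \<pi>) \<and> in_span I P T lo (lo + int (length \<pi>)) \<and>
    lo \<le> e + int (length T) \<and> lo + int (length \<pi>) \<ge> - int (length I)"
  using assms
proof (induction \<pi> rule: rev_induct)
  case Nil
  then show ?case by (simp add: in_paths_iff)
next
  case (snoc y \<pi>)
  show ?case
  proof (cases "\<pi> = []")
    case True
    have "y \<in> set I \<union> set P \<union> set T" using snoc.prems by (auto simp: in_paths_iff pverts_eq)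
    then consider "y \<in> set I" | "y \<in> set P" | "y \<in> set T" by blast
    then have "\<exists>lo. y = u lo \<and> in_span I P T lo (lo + 1) \<and> lo \<le> e + int (length T) \<and> lo + 1 \<ge> - int (length I)"
    proof cases
      case 1
      then obtain z where z: "- int (length I) \<le> z" "z < - int (length I) + int (length I)" "cyc I 0 z = y"
        by (rule cyc_surj)
      moreover have "I \<noteq> []" using 1 by auto
      ultimately show ?thesis using e_nonneg
        by (intro exI[of _ z]) (auto simp: walk_initial in_span_def)
    next
      case 2
      then obtain i where "i < length P" "y = P ! i" by (auto simp: in_set_conv_nth)
      then show ?thesis using walk_P[of "int i"]
        by (intro exI[of _ "int i"]) (auto simp: in_span_def)
    next
      case 3
      then obtain z where z: "e \<le> z" "z < e + int (length T)" "cyc T e z = y"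
        by (rule cyc_surj)
      have "T \<noteq> []" using 3 by auto
      moreover have z0: "0 \<le> z" using z(1) e_nonneg by linarith
      ultimately have "in_span I P T z (z + 1)" by (simp add: in_span_def)
      moreover have "- int (length I) \<le> z + 1" using z0 by simp
      ultimately show ?thesis using z walk_terminal[OF \<open>T \<noteq> []\<close> z(1)]
        by (intro exI[of _ z]) simp
    qed
    then show ?thesis using True by (auto simp: window_def)
  next
    case False
    have prefix: "\<pi> \<in> paths B"
      unfolding in_paths_iff
    proof (intro conjI allI impI)
      fix i assume "Suc i < length \<pi>"
      then have "((\<pi> @ [y]) ! i, (\<pi> @ [y]) ! Suc i) \<in> parcs B"
        using snoc.prems unfolding in_paths_iff by force
      then show "(\<pi> ! i, \<pi> ! Suc i) \<in> parcs B" using \<open>Suc i < length \<pi>\<close> by (simp add: nth_append)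
    qed (use False snoc.prems in \<open>auto simp: in_paths_iff\<close>)
    define N where "N = length \<pi>"
    have N: "N \<ge> 1" using False unfolding N_def by (cases \<pi>) auto
    obtain lo where lo: "\<pi> = window u lo N" "in_span I P T lo (lo + int N)"
      "lo \<le> e + int (length T)" "lo + int N \<ge> - int (length I)"
      using snoc.IH[OF prefix] unfolding N_def by blast
    define z where "z = lo + int N - 1"
    have uz: "\<pi> ! (N - 1) = u z"
      using nth_window[of "N - 1" N u lo] N lo(1) by (simp add: z_def of_nat_diff algebra_simps)
    have "((\<pi> @ [y]) ! (N - 1), (\<pi> @ [y]) ! Suc (N - 1)) \<in> parcs B"
      using snoc.prems N unfolding in_paths_iff N_def by force
    moreover have "(\<pi> @ [y]) ! (N - 1) = u z" "(\<pi> @ [y]) ! Suc (N - 1) = y"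
      using uz N by (auto simp: nth_append N_def)
    ultimately have arc: "(u z, y) \<in> parcs B" by simp
    have append: "\<pi> @ [y] = window u lo' (length (\<pi> @ [y]))"
      if "\<And>k. k < N \<Longrightarrow> u (lo' + int k) = u (lo + int k)" "y = u (lo' + int N)" for lo'
      using that unfolding lo(1) by (simp add: window_def)
    have goal: ?thesis
      if "\<And>k. k < N \<Longrightarrow> u (lo' + int k) = u (lo + int k)" "y = u (lo' + int N)"
        "in_span I P T lo' (lo' + int N + 1)" "lo' \<le> e + int (length T)"
        "lo' + int N + 1 \<ge> - int (length I)" for lo'
      using append[OF that(1,2)] that(3-5) unfolding N_def by (intro exI[of _ lo']) (simp add: algebra_simps)
    consider "(u z, y) \<in> cycle_arcs T" | i where "u z = P ! i" "y = P ! Suc i" "Suc i < length P"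
      | "(u z, y) \<in> cycle_arcs I"
      using arc unfolding parcs_eq by blast
    then show ?thesis
    proof cases
      case 1
      then have Tne: "T \<noteq> []" and "u z \<in> set T" using cycle_arcs_subset[of T] by auto
      then have "e \<le> z" using walk_in_T_iff lo(2) N by (auto simp: in_span_def z_def)
      then have "y = u (z + 1)"
        using cycle_arcs_succ[OF T[OF Tne] Tne, of e z y] 1 walk_terminal[OF Tne] by simp
      then show ?thesis
        by (intro goal[of lo]) (use lo Tne in \<open>auto simp: z_def in_span_def\<close>)
    next
      case (2 i)
      have "u z = u (int i)" using 2 walk_P[of "int i"] by simp
      have "z = int i \<or> I \<noteq> [] \<and> i = 0 \<and> z < 0"
      proof (rule ccontr)
        assume a: "\<not> ?thesis"
        then consider "z < int i" | "int i < z" by force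
        then show False
        proof cases
          case 1
          then have "I \<noteq> [] \<and> int i \<le> 0 \<or> T \<noteq> [] \<and> e \<le> z"
            using walk_repeats[of z "int i"] \<open>u z = u (int i)\<close> lo(2) 2 N by (auto simp: in_span_def z_def)
          then show False using a 1 2 by auto
        next
          case 2
          then have "I \<noteq> [] \<and> z \<le> 0 \<or> T \<noteq> [] \<and> e \<le> int i"
            using walk_repeats[of "int i" z] \<open>u z = u (int i)\<close> lo(2) by (auto simp: in_span_def z_def)
          then show False using a 2 \<open>Suc i < length P\<close> by auto
        qed
      qed
      then show ?thesis
      proof
        assume z: "z = int i"
        then have "y = u (z + 1)" using 2 walk_P[of "int i + 1"] by (simp add: nat_add_distrib)
        then show ?thesis
          by (intro goal[of lo]) (use lo 2 z in \<open>auto simp: z_def in_span_def\<close>)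
      next
        assume z: "I \<noteq> [] \<and> i = 0 \<and> z < 0"
        then have "int (length I) dvd (0 - z)"
          using \<open>u z = u (int i)\<close> walk_initial[of z] walk_initial[of 0] cyc_eq_iff[of I 0 0 z] I by auto
        then obtain k where k: "z = - int (length I) * k" by (metis diff_0 dvdE minus_minus mult_minus_left)
        show ?thesis
        proof (rule goal[of "lo - z"])
          fix j assume j: "j < N"
          have le: "lo + int j \<le> 0" "lo - z + int j \<le> 0" using j z by (auto simp: z_def)
          have "cyc I 0 (lo - z + int j) = cyc I 0 (lo + int j + int (length I) * k)"
            using k by (simp add: algebra_simps)
          then show "u (lo - z + int j) = u (lo + int j)"
            using le z by (simp add: walk_initial cyc_period)
        next
          show "y = u (lo - z + int N)"
            using 2 z walk_P[of 1] by (simp add: z_def)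
        qed (use lo z 2 N e_nonneg in \<open>auto simp: in_span_def z_def\<close>)
      qed
    next
      case 3
      then have Ine: "I \<noteq> []" and "u z \<in> set I" using cycle_arcs_subset[of I] by auto
      then have z0: "z \<le> 0" using walk_in_I_iff lo(2) by (auto simp: in_span_def z_def)
      have y: "y = cyc I 0 (z + 1)"
        using cycle_arcs_succ[OF I[OF Ine] Ine, of 0 z y] 3 walk_initial[OF Ine z0] by simp
      have len: "length I \<ge> 1" using Ine by (cases I) auto
      show ?thesis
      proof (cases "z < 0")
        case True
        then have "lo + int N + 1 \<le> int (length P)" using e_nonneg unfolding z_def by linarith
        then have "in_span I P T lo (lo + int N + 1)" using Ine by (simp add: in_span_def)
        then show ?thesis
          by (rule goal[rotated 2]) (use lo Ine y True in \<open>auto simp: z_def walk_initial\<close>)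
      next
        case False
        show ?thesis
        proof (rule goal[of "lo - int (length I)"])
          fix j assume j: "j < N"
          have "cyc I 0 (lo - int (length I) + int j) = cyc I 0 (lo + int j)"
            using cyc_period[of I 0 "lo + int j" "- 1"] by (simp add: algebra_simps)
          then show "u (lo - int (length I) + int j) = u (lo + int j)"
            using Ine j z0 by (simp add: walk_initial z_def)
        next
          have "cyc I 0 (z + 1) = cyc I 0 (z + 1 - int (length I))"
            using cyc_period[of I 0 "z + 1" "- 1"] by simp
          then show "y = u (lo - int (length I) + int N)"
            using y z0 Ine len by (simp add: walk_initial z_def algebra_simps)
        qed (use lo Ine False z0 len e_nonneg in \<open>auto simp: in_span_def z_def\<close>)
      qed
    qed
  qed
qed

end

section \<open>Decomposition into bicycles\<close>

definition in_free :: "'a pair_pre_digraph \<Rightarrow> 'a list \<Rightarrow> bool" where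
  "in_free G D \<longleftrightarrow> (\<forall>x y. (x, y) \<in> parcs G \<longrightarrow> y \<in> set D \<longrightarrow> (x, y) \<in> cycle_arcs D)"

definition out_free :: "'a pair_pre_digraph \<Rightarrow> 'a list \<Rightarrow> bool" where
  "out_free G D \<longleftrightarrow> (\<forall>x y. (x, y) \<in> parcs G \<longrightarrow> x \<in> set D \<longrightarrow> (x, y) \<in> cycle_arcs D)"

lemma rotate_cycle:
  assumes "graph_cycle G D" "x \<in> set D"
  obtains X where "graph_cycle G X" "hd X = x" "set X = set D" "cycle_arcs X = cycle_arcs D"
proof -
  have D: "D \<noteq> []" "distinct D" "cycle_arcs D \<subseteq> parcs G"
    using assms(1) by (auto simp: graph_cycle_def)
  obtain s where s: "cyc D 0 s = x" using assms(2) by (rule cyc_surj)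
  define X where "X = window (cyc D 0) s (length D)"
  have len: "length X = length D" "X \<noteq> []" using D by (auto simp: X_def window_def)
  have cX: "cyc X 0 z = cyc D 0 (s + z)" for z
  proof -
    have "cyc X 0 z = cyc D 0 (s + z mod int (length D))"
    proof -
      have "z mod int (length D) \<ge> 0" "nat (z mod int (length D)) < length D"
        using D by (auto simp: nat_less_iff)
      moreover have "cyc X 0 z = X ! nat (z mod int (length D))"
        unfolding cyc_def len(1) by simp
      ultimately show ?thesis by (simp add: X_def)
    qed
    also have "\<dots> = cyc D 0 (s + z mod int (length D) + int (length D) * (z div int (length D)))"
      by (rule cyc_period[symmetric])
    also have "\<dots> = cyc D 0 (s + z)" by (simp add: algebra_simps)
    finally show ?thesis .
  qed
  have "distinct X"
    unfolding distinct_conv_nth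
  proof (intro allI impI)
    fix i j assume ij: "i < length X" "j < length X" "i \<noteq> j"
    show "X ! i \<noteq> X ! j"
    proof
      assume "X ! i = X ! j"
      then have "cyc D 0 (s + int i) = cyc D 0 (s + int j)" using ij len by (simp add: X_def)
      then have "int (length D) dvd (int i - int j)" using cyc_eq_iff[OF D(2,1)] by simp
      moreover have "\<bar>int i - int j\<bar> < int (length D)" using ij len by linarith
      ultimately show False using ij(3) zdvd_imp_le[of "int (length D)" "\<bar>int i - int j\<bar>"] by simp
    qed
  qed
  moreover have arcs: "cycle_arcs X = cycle_arcs D"
  proof -
    have "cycle_arcs X = range (\<lambda>z. (cyc D 0 (s + z), cyc D 0 (s + z + 1)))"
      unfolding cycle_arcs_eq[OF len(2), of 0] cX by (simp add: add.assoc)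
    also have "\<dots> = range (\<lambda>z. (cyc D 0 z, cyc D 0 (z + 1)))"
    proof -
      have "range f = range (\<lambda>z. f (s + z))" for f :: "int \<Rightarrow> 'a \<times> 'a"
        by (metis surj_plus image_image)
      from this[of "\<lambda>z. (cyc D 0 z, cyc D 0 (z + 1))"] show ?thesis by simp
    qed
    finally show ?thesis unfolding cycle_arcs_eq[OF D(1), of 0] .
  qed
  moreover have "set X = set D"
  proof -
    have "set X = fst ` cycle_arcs X" if "X \<noteq> []" for X :: "'a list"
      by (force simp: cycle_arcs_def in_set_conv_nth image_iff)
    then show ?thesis using arcs len(2) D(1) by metis
  qed
  moreover have "hd X = x" using s D by (simp add: X_def window_def hd_map)
  ultimately show thesis using that[of X] D(3) len(2) by (auto simp: graph_cycle_def)
qed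

text \<open>Among all returns of a walk to a vertex, a shortest one is a simple cycle.\<close>

lemma repetition_contains_cycle:
  assumes "\<pi> \<in> paths G" "a < c" "c < length \<pi>" "\<pi> ! a = \<pi> ! c"
  obtains D a' c' where "graph_cycle G D" "a \<le> a'" "a' < c'" "c' \<le> c"
    "\<pi> ! a' \<in> set D" "\<pi> ! c' \<in> set D"
proof -
  define R where "R = (\<lambda>(x, y). a \<le> x \<and> x < y \<and> y \<le> c \<and> \<pi> ! x = \<pi> ! y)"
  have "R (a, c)" using assms by (simp add: R_def)
  then obtain xy where xy: "R xy" "\<And>xy'. R xy' \<Longrightarrow> snd xy - fst xy \<le> snd xy' - fst xy'"
    using ex_has_least_nat[of R "(a, c)" "\<lambda>xy. snd xy - fst xy"] by blast
  obtain x y where [simp]: "xy = (x, y)" by fastforce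
  have r: "a \<le> x" "x < y" "y \<le> c" "\<pi> ! x = \<pi> ! y" using xy(1) by (auto simp: R_def)
  define D where "D = map (\<lambda>k. \<pi> ! (x + k)) [0..<y - x]"
  have "distinct D"
    unfolding distinct_conv_nth
  proof (intro allI impI)
    have "\<pi> ! (x + i) \<noteq> \<pi> ! (x + j)" if "i < j" "j < y - x" for i j
    proof
      assume eq: "\<pi> ! (x + i) = \<pi> ! (x + j)"
      have "x + j \<le> c" using that r by linarith
      then have "y - x \<le> (x + j) - (x + i)"
        using xy(2)[of "(x + i, x + j)"] r that eq by (simp add: R_def)
      then show False using that by linarith
    qed
    then show "D ! i \<noteq> D ! j" if "i < length D" "j < length D" "i \<noteq> j" for i j
      using that unfolding D_def by (cases i j rule: linorder_cases) (auto dest: not_sym)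
  qed
  moreover have "cycle_arcs D \<subseteq> parcs G"
  proof -
    have "(D ! i, D ! (Suc i mod length D)) \<in> parcs G" if i: "i < length D" for i
    proof -
      have "D ! (Suc i mod length D) = \<pi> ! (x + Suc i)"
        using i r by (cases "Suc i = y - x") (auto simp: D_def)
      moreover have "(\<pi> ! (x + i), \<pi> ! Suc (x + i)) \<in> parcs G"
        using assms r i unfolding in_paths_iff D_def by auto
      ultimately show ?thesis using i by (simp add: D_def)
    qed
    then show ?thesis unfolding cycle_arcs_def by blast
  qed
  moreover have "D ! 0 = \<pi> ! x" "D \<noteq> []" using r by (auto simp: D_def)
  moreover from this have "\<pi> ! x \<in> set D" by (metis length_greater_0_conv nth_mem)
  ultimately show thesis using that[of D x y] r by (auto simp: graph_cycle_def)
qed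

lemma in_free_walk:
  assumes "in_free G D" "\<pi> \<in> paths G" "q < length \<pi>" "\<pi> ! q \<in> set D" "i < q"
  shows "(\<pi> ! i, \<pi> ! Suc i) \<in> cycle_arcs D"
proof -
  have "(\<pi> ! (q - Suc k), \<pi> ! Suc (q - Suc k)) \<in> cycle_arcs D" if "k < q" for k
    using that
  proof (induction k)
    case 0
    then have "Suc (q - 1) = q" by simp
    then show ?case using assms unfolding in_free_def in_paths_iff by (metis One_nat_def)
  next
    case (Suc k)
    then have "\<pi> ! (q - Suc k) \<in> set D" using cycle_arcs_subset[of D] by auto
    moreover have "q - Suc k = Suc (q - Suc (Suc k))" using Suc.prems by simp
    ultimately show ?case
      using assms Suc.prems unfolding in_free_def in_paths_iff by auto
  qed
  from this[of "q - Suc i"] show ?thesis using assms(5) by simp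
qed

lemma out_free_walk:
  assumes "out_free G D" "\<pi> \<in> paths G" "\<pi> ! p \<in> set D" "p \<le> i" "Suc i < length \<pi>"
  shows "(\<pi> ! i, \<pi> ! Suc i) \<in> cycle_arcs D"
  using assms(4,5)
proof (induction i rule: dec_induct)
  case base
  then show ?case using assms unfolding out_free_def in_paths_iff by auto
next
  case (step i)
  then have "\<pi> ! Suc i \<in> set D" using cycle_arcs_subset[of D] by auto
  then show ?case using assms step.prems unfolding out_free_def in_paths_iff by auto
qed

lemma cycle_closed_set:
  assumes "graph_cycle G D" "x \<in> set D" "x \<in> A" "\<And>x y. (x, y) \<in> cycle_arcs D \<Longrightarrow> x \<in> A \<Longrightarrow> y \<in> A"
  shows "set D \<subseteq> A"
proof
  fix y assume "y \<in> set D"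
  have D: "D \<noteq> []" using assms(1) by (simp add: graph_cycle_def)
  obtain z where z: "0 \<le> z" "cyc D 0 z = x" using assms(2) by (rule cyc_surj)
  obtain z' where z': "z \<le> z'" "cyc D 0 z' = y" using \<open>y \<in> set D\<close> by (rule cyc_surj)
  have "cyc D 0 (z + int k) \<in> A" for k
  proof (induction k)
    case (Suc k)
    have "(cyc D 0 (z + int k), cyc D 0 (z + int (Suc k))) \<in> cycle_arcs D"
      using cyc_succ[OF D, of 0 "z + int k"] by (simp add: algebra_simps)
    then show ?case using Suc assms(4) by blast
  qed (use z assms in simp)
  from this[of "nat (z' - z)"] show "y \<in> A" using z' by simp
qed

lemma cycle_closed_set_backwards:
  assumes "graph_cycle G D" "y \<in> set D" "y \<in> A" "\<And>x y. (x, y) \<in> cycle_arcs D \<Longrightarrow> y \<in> A \<Longrightarrow> x \<in> A"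
  shows "set D \<subseteq> A"
proof (rule ccontr)
  assume "\<not> set D \<subseteq> A"
  then obtain x where "x \<in> set D" "x \<in> - A" by blast
  from cycle_closed_set[OF assms(1) this] assms show False by blast
qed

text \<open>Let \<open>q\<close> be the last index at which the walk is on a cycle without further edges into it, and
  \<open>p\<close> the first one at which it is on a cycle without further edges out of it.  Up to \<open>q\<close> the
  walk follows the former cycle and from \<open>p\<close> on the latter.  In between it meets no cycle at all, so
  it cannot repeat a vertex.\<close>

lemma path_in_bicycle:
  assumes wf: "parcs G \<subseteq> pverts G \<times> pverts G"
    and free: "\<And>D. graph_cycle G D \<Longrightarrow> in_free G D \<or> out_free G D"
    and path: "\<pi> \<in> paths G"
  shows "\<exists>B. bicycle B \<and> subgraph (with_proj B) (with_proj G) \<and> \<pi> \<in> paths B"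
proof -
  define IN where "IN i \<longleftrightarrow> i < length \<pi> \<and> (\<exists>D. graph_cycle G D \<and> in_free G D \<and> \<pi> ! i \<in> set D)" for i
  define OUT where "OUT i \<longleftrightarrow> i < length \<pi> \<and> (\<exists>D. graph_cycle G D \<and> out_free G D \<and> \<pi> ! i \<in> set D)" for i
  have ne: "\<pi> \<noteq> []" using path by (simp add: in_paths_iff)
  have arc: "(\<pi> ! i, \<pi> ! Suc i) \<in> parcs G" if "Suc i < length \<pi>" for i
    using path that by (simp add: in_paths_iff)
  have vert: "\<pi> ! i \<in> pverts G" if "i < length \<pi>" for i
    using path that by (auto simp: in_paths_iff)
  obtain q I where q: "q < length \<pi>" "\<And>i. IN i \<Longrightarrow> i \<le> q"
    and I: "I = [] \<Longrightarrow> q = 0 \<and> (\<forall>i. \<not> IN i)"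
      "I \<noteq> [] \<Longrightarrow> graph_cycle G I \<and> in_free G I \<and> hd I = \<pi> ! q"
  proof (cases "\<exists>i. IN i")
    case True
    define q where "q = (GREATEST i. IN i)"
    have bound: "\<forall>i. IN i \<longrightarrow> i \<le> length \<pi>" by (auto simp: IN_def)
    have q: "IN q" "\<And>i. IN i \<Longrightarrow> i \<le> q"
      using GreatestI_ex_nat[OF True] Greatest_le_nat[of IN] bound unfolding q_def by blast+
    then obtain D where D: "graph_cycle G D" "in_free G D" "\<pi> ! q \<in> set D" by (auto simp: IN_def)
    obtain X where "graph_cycle G X" "hd X = \<pi> ! q" "set X = set D" "cycle_arcs X = cycle_arcs D"
      using D(1,3) by (rule rotate_cycle)
    then show thesis using that[of q X] q D(2) by (auto simp: IN_def in_free_def graph_cycle_def)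
  next
    case False
    then show thesis using that[of 0 "[]"] ne by auto
  qed
  obtain p T where p: "p < length \<pi>" "\<And>i. OUT i \<Longrightarrow> p \<le> i"
    and T: "T = [] \<Longrightarrow> p = length \<pi> - 1 \<and> (\<forall>i. \<not> OUT i)"
      "T \<noteq> [] \<Longrightarrow> graph_cycle G T \<and> out_free G T \<and> hd T = \<pi> ! p"
  proof (cases "\<exists>i. OUT i")
    case True
    define p where "p = (LEAST i. OUT i)"
    have p: "OUT p" "\<And>i. OUT i \<Longrightarrow> p \<le> i"
      using LeastI_ex[OF True] Least_le[of OUT] by (auto simp: p_def)
    then obtain D where D: "graph_cycle G D" "out_free G D" "\<pi> ! p \<in> set D" by (auto simp: OUT_def)
    obtain X where "graph_cycle G X" "hd X = \<pi> ! p" "set X = set D" "cycle_arcs X = cycle_arcs D"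
      using D(1,3) by (rule rotate_cycle)
    then show thesis using that[of p X] p D(2) by (auto simp: OUT_def out_free_def graph_cycle_def)
  next
    case False
    then show thesis using that[of "length \<pi> - 1" "[]"] ne by auto
  qed
  have Iset: "\<pi> ! q \<in> set I" if "I \<noteq> []" using I(2)[OF that] that by (metis hd_in_set)
  have Tset: "\<pi> ! p \<in> set T" if "T \<noteq> []" using T(2)[OF that] that by (metis hd_in_set)
  have Iarc: "(\<pi> ! i, \<pi> ! Suc i) \<in> cycle_arcs I" if "i < q" for i
    using that I in_free_walk[OF _ path q(1), of I i] Iset by (cases "I = []") auto
  have Tarc: "(\<pi> ! i, \<pi> ! Suc i) \<in> cycle_arcs T" if "p \<le> i" "Suc i < length \<pi>" for i
    using that T out_free_walk[OF _ path, of T p i] Tset by (cases "T = []") auto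
  have cycverts: "set X \<subseteq> pverts G" if "graph_cycle G X" for X
  proof -
    have "\<exists>y. (x, y) \<in> cycle_arcs X" if "x \<in> set X" for x
      using that by (auto simp: cycle_arcs_def in_set_conv_nth)
    then show ?thesis using that wf unfolding graph_cycle_def by blast
  qed
  show ?thesis
  proof (cases "I \<noteq> [] \<and> T \<noteq> [] \<and> p \<le> q")
    \<comment> \<open>The two cycles share the vertex with index \<open>q\<close>, hence coincide, and the walk never leaves
      them.\<close>
    case True
    define B where "B = \<lparr>pverts = set T, parcs = cycle_arcs T\<rparr>"
    have T': "graph_cycle G T" "out_free G T" "hd T = \<pi> ! p" and I': "graph_cycle G I" "in_free G I"
      using True T(2) I(2) by auto
    have qT: "\<pi> ! q \<in> set T"
    proof (cases "p = q")
      case False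
      then have "(\<pi> ! (q - 1), \<pi> ! Suc (q - 1)) \<in> cycle_arcs T" using True q by (intro Tarc) auto
      then show ?thesis using False True cycle_arcs_subset[of T] by auto
    qed (use Tset True in auto)
    have IT: "set I \<subseteq> set T"
      using cycle_closed_set[OF I'(1) Iset qT] True T'(2) I'(1) cycle_arcs_subset[of T]
      unfolding out_free_def graph_cycle_def by blast
    have arcs: "(\<pi> ! i, \<pi> ! Suc i) \<in> cycle_arcs T" if "Suc i < length \<pi>" for i
    proof (cases "i < q")
      case True
      then have "\<pi> ! i \<in> set T" using Iarc cycle_arcs_subset[of I] IT by blast
      then show ?thesis using T'(2) arc[OF that] unfolding out_free_def by blast
    next
      case False
      then show ?thesis using Tarc[of i] that True by simp
    qed
    have "\<pi> ! i \<in> set T" if "i < length \<pi>" for i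
    proof (cases "Suc i < length \<pi>")
      case True
      then show ?thesis using arcs cycle_arcs_subset[of T] by blast
    next
      case False
      then show ?thesis
      proof (cases i)
        case 0
        then have "p = i" using p(1) False by simp
        then show ?thesis using Tset True by auto
      next
        case (Suc j)
        then show ?thesis using arcs[of j] that cycle_arcs_subset[of T] by blast
      qed
    qed
    then have "\<pi> \<in> paths B" using arcs ne by (auto simp: in_paths_iff B_def in_set_conv_nth)
    moreover have "bicycle_parts B [] [hd T] T"
      using T'(1) True simple_cycle_closed_up_iff[of T B]
      unfolding bicycle_parts_def vpath_def vwalk_def B_def
      by (auto simp: set_vwalk_arcs_closed_up graph_cycle_def cycle_arcs_def[of "[]"])
    moreover have "subgraph (with_proj B) (with_proj G)"
      using cycverts[OF T'(1)] T'(1) wf cycle_arcs_subset[of T]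
      by (auto simp: subgraph_def B_def graph_cycle_def wf_digraph_def compatible_def)
    ultimately show ?thesis unfolding bicycle_def by blast
  next
    case False
    then have qp: "q \<le> p" "I \<noteq> [] \<Longrightarrow> T \<noteq> [] \<Longrightarrow> q < p"
      using I(1) T(1) p(1) q(1) by force+
    define P where "P = map ((!) \<pi>) [q..<Suc p]"
    have lenP: "length P = Suc p - q" "P \<noteq> []" using qp by (auto simp: P_def)
    have nthP: "P ! i = \<pi> ! (q + i)" if "q + i \<le> p" for i using that by (auto simp: P_def simp del: upt_Suc)
    have noIN: "\<not> IN i" if "q < i" for i using q(2) that by force
    have noOUT: "\<not> OUT i" if "i < p" for i using p(2) that by force
    have distinct: "distinct P"
      unfolding distinct_conv_nth
    proof (intro allI impI)
      have ne: "\<pi> ! a \<noteq> \<pi> ! c" if ac: "q \<le> a" "a < c" "c \<le> p" for a c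
      proof
        assume eq: "\<pi> ! a = \<pi> ! c"
        have c: "c < length \<pi>" using ac p(1) by simp
        obtain D a' c' where D: "graph_cycle G D" "a \<le> a'" "a' < c'" "c' \<le> c"
          "\<pi> ! a' \<in> set D" "\<pi> ! c' \<in> set D"
          using repetition_contains_cycle[OF path ac(2) c eq] .
        from free[OF D(1)] show False
        proof
          assume "in_free G D"
          then have "IN c'" using D c unfolding IN_def by auto
          then show False using noIN[of c'] D ac by simp
        next
          assume "out_free G D"
          then have "OUT a'" using D c unfolding OUT_def by auto
          then show False using noOUT[of a'] D ac by simp
        qed
      qed
      show "P ! i \<noteq> P ! j" if "i < length P" "j < length P" "i \<noteq> j" for i j
        using ne[of "q + i" "q + j"] ne[of "q + j" "q + i"] that lenP nthP[of i] nthP[of j] by force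
    qed
    define B where "B = \<lparr>pverts = set I \<union> set P \<union> set T,
      parcs = cycle_arcs I \<union> set (vwalk_arcs P) \<union> cycle_arcs T\<rparr>"
    have Parc: "set (vwalk_arcs P) = {(\<pi> ! i, \<pi> ! Suc i) |i. q \<le> i \<and> i < p}"
    proof (intro set_eqI iffI)
      fix e assume "e \<in> set (vwalk_arcs P)"
      then obtain i where i: "e = (P ! i, P ! Suc i)" "Suc i < length P" unfolding set_vwalk_arcs by blast
      then have "e = (\<pi> ! (q + i), \<pi> ! Suc (q + i))" using nthP[of i] nthP[of "Suc i"] lenP by auto
      then show "e \<in> {(\<pi> ! i, \<pi> ! Suc i) |i. q \<le> i \<and> i < p}" using i lenP by (intro CollectI exI[of _ "q + i"]) auto
    next
      fix e assume "e \<in> {(\<pi> ! i, \<pi> ! Suc i) |i. q \<le> i \<and> i < p}"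
      then obtain i where i: "e = (\<pi> ! i, \<pi> ! Suc i)" "q \<le> i" "i < p" by blast
      then have "e = (P ! (i - q), P ! Suc (i - q))" using nthP[of "i - q"] nthP[of "Suc (i - q)"] by auto
      then show "e \<in> set (vwalk_arcs P)" unfolding set_vwalk_arcs using i lenP by (intro CollectI exI[of _ "i - q"]) auto
    qed
    have hdP: "hd P = \<pi> ! q" "last P = \<pi> ! p"
      using lenP qp nthP[of 0] nthP[of "p - q"] by (auto simp: hd_conv_nth last_conv_nth)
    have tlP: "set (tl P) = {\<pi> ! i |i. q < i \<and> i \<le> p}"
    proof -
      have "tl P = map ((!) \<pi>) [Suc q..<Suc p]" using qp by (simp add: P_def upt_conv_Cons del: upt_Suc)
      then show ?thesis by (auto simp del: upt_Suc)
    qed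
    have blP: "set (butlast P) = {\<pi> ! i |i. q \<le> i \<and> i < p}"
    proof -
      have "butlast P = map ((!) \<pi>) [q..<p]" using qp by (simp add: P_def)
      then show ?thesis by auto
    qed
    have setP: "set P \<subseteq> pverts G"
    proof -
      have "set P = {\<pi> ! i |i. q \<le> i \<and> i \<le> p}" by (auto simp: P_def simp del: upt_Suc)
      then show ?thesis using vert p(1) by auto
    qed
    have disj: "set I \<inter> set T = {}"
    proof (rule ccontr)
      assume "set I \<inter> set T \<noteq> {}"
      then obtain x where x: "x \<in> set I" "x \<in> set T" by blast
      then have IT: "I \<noteq> []" "T \<noteq> []" by auto
      then have I': "in_free G I" "graph_cycle G I" and T': "graph_cycle G T" using I(2) T(2) by auto
      have "set T \<subseteq> set I"
      proof (rule cycle_closed_set_backwards[OF T' x(2,1)])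
        fix x y assume "(x, y) \<in> cycle_arcs T" "y \<in> set I"
        then have "(x, y) \<in> cycle_arcs I" using I' T' by (auto simp: in_free_def graph_cycle_def)
        then show "x \<in> set I" using cycle_arcs_subset[of I] by blast
      qed
      then have "IN p" using Tset IT I' p(1) unfolding IN_def by blast
      then show False using noIN[OF qp(2)[OF IT]] by simp
    qed
    have "bicycle_parts B I P T"
      unfolding bicycle_parts_def
    proof (intro conjI impI)
      show "simple_cycle B (closed_up I)" if "I \<noteq> []"
        using simple_cycle_closed_up_iff[OF that, of B] I(2)[OF that] by (auto simp: graph_cycle_def B_def)
      show "simple_cycle B (closed_up T)" if "T \<noteq> []"
        using simple_cycle_closed_up_iff[OF that, of B] T(2)[OF that] by (auto simp: graph_cycle_def B_def)
      show "vpath P (with_proj B)" using distinct lenP by (auto simp: vpath_def vwalk_def B_def)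
      show "hd P = hd I" if "I \<noteq> []" using hdP I(2)[OF that] by simp
      show "last P = hd T" if "T \<noteq> []" using hdP T(2)[OF that] by simp
      show "set (tl P) \<inter> set I = {}" if "I \<noteq> []"
      proof -
        have "\<pi> ! i \<notin> set I" if "q < i" "i \<le> p" for i
          using noIN[OF that(1)] I(2)[OF \<open>I \<noteq> []\<close>] that p(1) unfolding IN_def by auto
        then show ?thesis unfolding tlP by auto
      qed
      show "set (butlast P) \<inter> set T = {}" if "T \<noteq> []"
      proof -
        have "\<pi> ! i \<notin> set T" if "i < p" for i
          using noOUT[OF that(1)] T(2)[OF \<open>T \<noteq> []\<close>] that p(1) unfolding OUT_def by auto
        then show ?thesis unfolding blP by auto
      qed
    qed (auto simp: disj B_def set_vwalk_arcs_closed_up)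
    moreover have "\<pi> \<in> paths B"
      unfolding in_paths_iff
    proof (intro conjI allI impI)
      fix i assume "Suc i < length \<pi>"
      then show "(\<pi> ! i, \<pi> ! Suc i) \<in> parcs B"
        using Iarc[of i] Tarc[of i] Parc unfolding B_def by (cases "i < q"; cases "p \<le> i") auto
    next
      have "\<pi> ! i \<in> set I \<union> set P \<union> set T" if i: "i < length \<pi>" for i
      proof -
        consider "i < q" | "q \<le> i" "i \<le> p" | "p < i" by linarith
        then show ?thesis
        proof cases
          case 1
          then show ?thesis using Iarc cycle_arcs_subset[of I] by blast
        next
          case 2
          then show ?thesis by (auto simp: P_def simp del: upt_Suc)
        next
          case 3
          then have "p \<le> i - 1" "Suc (i - 1) = i" by auto
          then show ?thesis using Tarc[of "i - 1"] i cycle_arcs_subset[of T] by auto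
        qed
      qed
      then have "\<forall>x\<in>set \<pi>. x \<in> set I \<union> set P \<union> set T" unfolding all_set_conv_all_nth by blast
      then show "set \<pi> \<subseteq> pverts B" unfolding B_def by auto
    qed (rule ne)
    moreover have "subgraph (with_proj B) (with_proj G)"
    proof -
      have XG: "cycle_arcs X \<subseteq> parcs G \<and> set X \<subseteq> pverts G" if "X = [] \<or> graph_cycle G X" for X
        using that
      proof
        assume "graph_cycle G X"
        then show ?thesis using cycverts unfolding graph_cycle_def by blast
      qed (simp add: cycle_arcs_def)
      have IG: "cycle_arcs I \<subseteq> parcs G" "set I \<subseteq> pverts G" using XG[of I] I(2) by auto
      have TG: "cycle_arcs T \<subseteq> parcs G" "set T \<subseteq> pverts G" using XG[of T] T(2) by auto
      have PG: "set (vwalk_arcs P) \<subseteq> parcs G" unfolding Parc using arc p(1) by auto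
      have "set (vwalk_arcs P) \<subseteq> set P \<times> set P" by (auto simp: set_vwalk_arcs)
      then show ?thesis
        using IG TG PG setP cycle_arcs_subset[of I] cycle_arcs_subset[of T] wf
        unfolding subgraph_def B_def wf_digraph_def compatible_def by auto
    qed
    ultimately show ?thesis unfolding bicycle_def by blast
  qed
qed

text \<open>All bicycles in a finite digraph together form a finite collection.\<close>

lemma bicycle_decomposition:
  assumes fin: "finite (pverts G)" and wf: "parcs G \<subseteq> pverts G \<times> pverts G"
    and free: "\<And>D. graph_cycle G D \<Longrightarrow> in_free G D \<or> out_free G D"
  shows "\<exists>Bs. (\<forall>B\<in>set Bs. bicycle B) \<and> path_complete_decomposition G Bs"
proof -
  define S where "S = {B. bicycle B \<and> subgraph (with_proj B) (with_proj G)}"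
  have "S \<subseteq> (\<lambda>(V, A). \<lparr>pverts = V, parcs = A\<rparr>) ` (Pow (pverts G) \<times> Pow (parcs G))"
  proof
    fix B assume "B \<in> S"
    then have "pverts B \<subseteq> pverts G" "parcs B \<subseteq> parcs G" by (auto simp: S_def subgraph_def)
    then show "B \<in> (\<lambda>(V, A). \<lparr>pverts = V, parcs = A\<rparr>) ` (Pow (pverts G) \<times> Pow (parcs G))"
      by (intro image_eqI[of _ _ "(pverts B, parcs B)"]) auto
  qed
  moreover have "finite (parcs G)" using finite_subset[OF wf] fin by simp
  ultimately have "finite S" using fin by (meson finite_Pow_iff finite_SigmaI finite_imageI finite_subset)
  then obtain Bs where Bs: "set Bs = S" using finite_list by blast
  have "paths G = (\<Union>H\<in>S. paths H)"
    using path_in_bicycle[OF wf free] in_paths_mono unfolding S_def by blast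
  then show ?thesis
    using Bs by (intro exI[of _ Bs]) (auto simp: path_complete_decomposition_def S_def)
qed

section \<open>Antichains from the factor graph\<close>

text \<open>The local condition is what the finite basis is used for: membership is decided by the windows
  of length \<open>b\<close>.  For \<open>b \<le> 1\<close> the factor graph is empty, so this case is treated separately.\<close>

locale finitely_based =
  fixes C :: "nat list set" and b :: nat
  assumes C_perms: "C \<subseteq> perms" and down: "downward_closed C" and b_ge_2: "b \<ge> 2"
    and C_local: "\<lbrakk>\<sigma> \<in> perms; b \<le> length \<sigma>;
      \<And>k. k + b \<le> length \<sigma> \<Longrightarrow> standardize (take b (drop k \<sigma>)) \<in> C\<rbrakk> \<Longrightarrow> \<sigma> \<in> C"
begin

lemma b_pos: "b \<ge> 1" using b_ge_2 by simp

abbreviation G where "G \<equiv> factor_graph b C"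

lemma G_wf: "parcs G \<subseteq> pverts G \<times> pverts G"
  by (auto simp: factor_graph_def)

lemma finite_verts: "finite (pverts G)"
proof (rule finite_subset)
  show "pverts G \<subseteq> {xs. set xs \<subseteq> {1..b} \<and> length xs = b}"
    using C_perms by (auto simp: factor_graph_def perms_def)
qed (rule finite_lists_length_eq, simp)

lemma window_chain:
  assumes "window u lo N \<in> paths G" "N \<ge> 1"
  shows "chain b u lo (lo + int (N + b - 1))"
proof -
  have "lo + int (N + b - 1) = lo + int N + int b - 1" using assms(2) by simp
  then show ?thesis
    using assms(1) C_perms unfolding window_in_paths_iff[OF assms(2)] chain_def
    by (auto simp: factor_graph_def)
qed

lemma window_realisation:
  assumes "window u lo N \<in> paths G" "N \<ge> 1"
  shows "\<exists>h. realises b u h lo (lo + int (N + b - 1))"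
proof (rule realises_exists[OF b_pos window_chain[OF assms]])
  show "lo + int (N + b - 1) - lo \<ge> int b" using assms(2) by simp
qed

lemma realisation_in_C:
  assumes "window u lo N \<in> paths G" "N \<ge> 1" "realises b u h lo (lo + int (N + b - 1))"
  shows "pattern h lo (N + b - 1) \<in> C"
proof (rule C_local)
  note inj = realisesD(1)[OF assms(3)]
  show "pattern h lo (N + b - 1) \<in> perms" using pattern_perms[OF inj] .
  have l: "length (pattern h lo (N + b - 1)) = N + b - 1" using length_pattern[OF inj] .
  show "b \<le> length (pattern h lo (N + b - 1))" using l assms(2) by simp
  fix k assume "k + b \<le> length (pattern h lo (N + b - 1))"
  then have k: "k + b \<le> N + b - 1" "k < N" using l assms(2) by auto
  then have "standardize (take b (drop k (pattern h lo (N + b - 1)))) = u (lo + int k)"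
    using pattern_window[OF inj k(1)] realisesD(2)[OF assms(3), of "lo + int k"] assms(2) by simp
  then show "standardize (take b (drop k (pattern h lo (N + b - 1)))) \<in> C"
    using assms(1) k unfolding window_in_paths_iff[OF assms(2)] by (auto simp: factor_graph_def)
qed

lemma path_of_in_paths:
  assumes "\<sigma> \<in> C" "b \<le> length \<sigma>"
  shows "path_of b \<sigma> \<in> paths G" "\<sigma> \<in> perms_of b (path_of b \<sigma>)"
proof -
  have \<sigma>: "\<sigma> \<in> perms" using assms C_perms by blast
  then show "\<sigma> \<in> perms_of b (path_of b \<sigma>)" using assms by (simp add: perms_of_def)
  let ?h = "model_of \<sigma> 0"
  note inj = inj_model_of[OF \<sigma>, of 0] and pat = pattern_model_of[OF \<sigma>, of 0]
  define N where "N = length \<sigma> - b + 1"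
  have win: "standardize (take b (drop k \<sigma>)) = pattern ?h (int k) b" if "k < N" for k
    using pattern_window[OF inj, of k b] pat that assms(2) unfolding N_def by simp
  then have path: "path_of b \<sigma> = window (\<lambda>z. pattern ?h z b) 0 N"
    unfolding path_of_def N_def[symmetric] window_def by simp
  have "pattern ?h z b \<in> C \<and> length (pattern ?h z b) = b" if "0 \<le> z" "z < int N" for z
  proof -
    have injz: "inj_on ?h {z..<z + int b}"
      by (rule inj_on_subset[OF inj]) (use that assms(2) in \<open>auto simp: N_def\<close>)
    have "pattern ?h z b \<le>\<^sub>f \<sigma>"
      unfolding consec_subperm_def length_pattern[OF injz]
      using win[of "nat z"] that assms(2) by (intro exI[of _ "nat z"]) (auto simp: N_def)
    then show ?thesis using pattern_perms[OF injz] length_pattern[OF injz] down assms(1)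
      unfolding downward_closed_def by blast
  qed
  moreover have "standardize (tl (pattern ?h z b)) = standardize (butlast (pattern ?h (z + 1) b))"
    if "0 \<le> z" "z + 1 < int N" for z
    by (rule edge_of_model[OF b_pos], rule inj_on_subset[OF inj]) (use that assms(2) in \<open>auto simp: N_def\<close>)
  moreover have "N \<ge> 1" by (simp add: N_def)
  ultimately show "path_of b \<sigma> \<in> paths G"
    unfolding path window_in_paths_iff[OF \<open>N \<ge> 1\<close>] by (auto simp: factor_graph_def)
qed

text \<open>How well quasi-order is used: in a sequence of realisations of walks, one of them occurs,
  shifted by some \<open>d\<close>, in another.\<close>

lemma well_quasi_order_embedding:
  assumes "well_quasi_ordered_on (\<le>\<^sub>f) C"
    and path: "\<And>m::nat. window (u m) (lo m) (N m) \<in> paths G" and N: "\<And>m. N m \<ge> 1"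
    and h: "\<And>m. realises b (u m) (h m) (lo m) (lo m + int (N m + b - 1))"
  obtains m n d where "m \<noteq> n" "d + N m \<le> N n"
    "same_order_on {lo m..<lo m + int (N m + b - 1)} (h m) (\<lambda>x. h n (x + (lo n - lo m + int d)))"
    "\<And>z. lo m \<le> z \<Longrightarrow> z < lo m + int (N m) \<Longrightarrow> u m z = u n (z + (lo n - lo m + int d))"
proof -
  define f where "f m = pattern (h m) (lo m) (N m + b - 1)" for m
  note inj = realisesD(1)[OF h]
  have "range f \<subseteq> C" using realisation_in_C[OF path N h] by (auto simp: f_def)
  then obtain m n where mn: "m \<noteq> n" "f m \<le>\<^sub>f f n"
    using assms(1) unfolding well_quasi_ordered_on_perms_iff[OF C_perms] by blast
  then obtain d where d: "d + (N m + b - 1) \<le> N n + b - 1"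
    and same: "same_order_on {lo m..<lo m + int (N m + b - 1)} (h m) (\<lambda>x. h n (x + (lo n - lo m + int d)))"
    unfolding f_def consec_subperm_pattern_iff[OF inj inj] by blast
  have dN: "d + N m \<le> N n" using d N[of m] N[of n] b_pos by linarith
  have "u m z = u n (z + (lo n - lo m + int d))" if z: "lo m \<le> z" "z < lo m + int (N m)" for z
  proof -
    have sub: "{z..<z + int b} \<subseteq> {lo m..<lo m + int (N m + b - 1)}" using z N[of m] by auto
    have "u m z = pattern (h m) z b" using realisesD(2)[OF h, of m z] sub z N[of m] by simp
    also have "\<dots> = pattern (\<lambda>x. h n (x + (lo n - lo m + int d))) z b"
      using pattern_cong_same_order same_order_on_subset[OF same sub] inj_on_subset[OF inj[of m] sub] by blast
    also have "\<dots> = u n (z + (lo n - lo m + int d))"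
      unfolding pattern_shift using dN z N[of m] N[of n] by (intro realisesD(2)[OF h]) auto
    finally show ?thesis .
  qed
  then show thesis using that mn(1) dN same by blast
qed

lemma cycle_vertices:
  assumes "graph_cycle G X"
  shows "set X \<subseteq> pverts G"
proof -
  have "\<exists>y. (x, y) \<in> cycle_arcs X" if "x \<in> set X" for x
    using that by (auto simp: cycle_arcs_def in_set_conv_nth)
  then show ?thesis using assms G_wf unfolding graph_cycle_def by blast
qed

lemma cycle_window_in_paths:
  assumes "graph_cycle G X" "N \<ge> 1"
  shows "window (cyc X s) lo N \<in> paths G"
proof -
  have X: "X \<noteq> []" "cycle_arcs X \<subseteq> parcs G" using assms by (auto simp: graph_cycle_def)
  show ?thesis unfolding window_in_paths_iff[OF assms(2)]
    using cycle_vertices[OF assms(1)] cyc_in_set[OF X(1)] cyc_succ[OF X(1)] X(2) by blast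
qed

lemma cycle_chain:
  assumes "graph_cycle G X"
  shows "chain b (cyc X s) lo hi"
proof -
  have "chain b (cyc X s) lo (lo + int (Suc (nat (hi - lo)) + b - 1))"
    by (rule window_chain[OF cycle_window_in_paths[OF assms]]) auto
  then show ?thesis by (rule chain_subset) auto
qed

text \<open>Walks that enter a cycle by an edge outside it, go round it and leave it by an edge outside
  it form an antichain, since the first edge can only be matched with the first one and the last
  edge with the last one.\<close>

lemma well_quasi_order_free:
  assumes wqo: "well_quasi_ordered_on (\<le>\<^sub>f) C" and D: "graph_cycle G D"
  shows "in_free G D \<or> out_free G D"
proof (rule ccontr)
  assume "\<not> ?thesis"
  then obtain x x' y' y where x: "(x, x') \<in> parcs G" "x' \<in> set D" "(x, x') \<notin> cycle_arcs D"
    and y: "(y', y) \<in> parcs G" "y' \<in> set D" "(y', y) \<notin> cycle_arcs D"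
    unfolding in_free_def out_free_def by blast
  have D': "D \<noteq> []" "distinct D" using D by (auto simp: graph_cycle_def)
  define r where "r = int (length D)"
  have r: "r > 0" using D' by (simp add: r_def)
  obtain s where s: "cyc D 0 s = x'" using x(2) by (rule cyc_surj)
  obtain t where t: "s \<le> t" "cyc D 0 t = y'" using y(2) by (rule cyc_surj)
  define e where "e m = t - s + r * int m" for m
  have e0: "e m \<ge> 0" for m using t r by (simp add: e_def)
  have e_end: "cyc D 0 (s + e m) = y'" for m
    using cyc_period[of D 0 t "int m"] t by (simp add: e_def r_def)
  define u where "u m z = (if z < 0 then x else if z \<le> e m then cyc D 0 (s + z) else y)" for m z
  define N where "N m = nat (e m + 3)" for m
  have N: "int (N m) = e m + 3" "N m \<ge> 1" for m using e0[of m] by (auto simp: N_def)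
  have path: "window (u m) (- 1) (N m) \<in> paths G" for m
  proof -
    have "u m z \<in> pverts G" for z
      using x y G_wf cycle_vertices[OF D] cyc_in_set[OF D'(1)] unfolding u_def by auto
    moreover have "(u m z, u m (z + 1)) \<in> parcs G" if z: "- 1 \<le> z" "z + 1 < - 1 + int (N m)" for z
    proof -
      have "z < e m + 1" using z N(1)[of m] by linarith
      then consider "z = - 1" | "0 \<le> z" "z < e m" | "z = e m" using z(1) by linarith
      then show ?thesis
      proof cases
        case 1
        then show ?thesis using x s e0[of m] by (simp add: u_def)
      next
        case 2
        then have "(u m z, u m (z + 1)) = (cyc D 0 (s + z), cyc D 0 (s + z + 1))"
          by (simp add: u_def algebra_simps)
        then show ?thesis using cyc_succ[OF D'(1), of 0 "s + z"] D by (auto simp: graph_cycle_def)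
      next
        case 3
        then show ?thesis using y e_end[of m] e0[of m] by (simp add: u_def)
      qed
    qed
    ultimately show ?thesis unfolding window_in_paths_iff[OF N(2)] by blast
  qed
  have "\<forall>m. \<exists>h. realises b (u m) h (- 1) (- 1 + int (N m + b - 1))"
    using window_realisation[OF path N(2)] by blast
  then obtain h where h: "\<And>m. realises b (u m) (h m) (- 1) (- 1 + int (N m + b - 1))" by metis
  obtain m n d where mn: "m \<noteq> n" "d + N m \<le> N n"
    and eq: "\<And>z. - 1 \<le> z \<Longrightarrow> z < - 1 + int (N m) \<Longrightarrow> u m z = u n (z + (- 1 - (- 1) + int d))"
    by (rule well_quasi_order_embedding[OF wqo, of u "\<lambda>_. - 1" N h, OF path N(2) h]) (blast intro: that)
  have eq: "u m z = u n (z + int d)" if "- 1 \<le> z" "z \<le> e m + 1" for z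
    using eq[of z] that N by simp
  have de: "int d + e m \<le> e n" using mn(2) N(1)[of m] N(1)[of n] by linarith
  show False
  proof (cases "d = 0")
    case False
    have "x = cyc D 0 (s + int d - 1)"
      using eq[of "- 1"] de e0[of m] False by (simp add: u_def algebra_simps)
    moreover have "x' = cyc D 0 (s + int d)"
      using eq[of 0] de e0[of m] s by (simp add: u_def)
    ultimately show False using x(3) cyc_succ[OF D'(1), of 0 "s + int d - 1"] by simp
  next
    case True
    have "e m \<noteq> e n" using mn(1) r by (simp add: e_def)
    then have "e m + 1 \<le> e n" using de True by simp
    then have "y = cyc D 0 (s + e m + 1)"
      using eq[of "e m + 1"] e0[of m] True by (simp add: u_def algebra_simps)
    then show False using y(3) e_end[of m] cyc_succ[OF D'(1), of 0 "s + e m"] by simp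
  qed
qed

text \<open>Unambiguity of all stretches of cyclic walks, including those that are not closed, such as the
  paths of iterators.\<close>

definition rigid_cycles :: bool where
  "rigid_cycles \<longleftrightarrow> (\<forall>X s lo hi. graph_cycle G X \<and> hi - lo \<ge> int b \<longrightarrow> rigid b (cyc X s) lo hi)"

lemma rigid_single: "rigid b u lo (lo + int b)"
  unfolding rigid_def
proof (intro allI impI, elim conjE)
  fix h h' assume h: "realises b u h lo (lo + int b)" and h': "realises b u h' lo (lo + int b)"
  have "pattern h lo b = pattern h' lo b"
    using realisesD(2)[OF h, of lo] realisesD(2)[OF h', of lo] by simp
  then show "same_order_on {lo..<lo + int b} h h'"
    using pattern_eq_iff[OF realisesD(1)[OF h] realisesD(1)[OF h']] by simp
qed

text \<open>Take the least number \<open>k\<close> of rounds of the cycle that can be realised in two ways \<open>f\<close> and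
  \<open>g\<close>.  Fewer rounds are rigid, so realisations of \<open>k\<close> rounds, each starting one round after its
  predecessor, can be glued together whatever choices between \<open>f\<close> and \<open>g\<close> are made.  The words
  \<open>f g \<dots> g f\<close> give an antichain.\<close>

lemma well_quasi_order_rigid_cycles:
  assumes wqo: "well_quasi_ordered_on (\<le>\<^sub>f) C"
  shows rigid_cycles
  unfolding rigid_cycles_def
proof (intro allI impI, elim conjE, rule ccontr)
  fix X s lo hi assume X: "graph_cycle G X" and len: "hi - lo \<ge> int b"
    and not_rigid: "\<not> rigid b (cyc X s) lo hi"
  have X': "X \<noteq> []" "distinct X" using X by (auto simp: graph_cycle_def)
  define r where "r = int (length X)"
  have r: "r > 0" using X' by (simp add: r_def)
  define v where "v = (\<lambda>z. cyc X s (z + lo))"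
  have v_cyc: "v = cyc X (s - lo)" by (auto simp: v_def cyc_add)
  have per: "v (z + r * k) = v z" for z k unfolding v_cyc r_def by (rule cyc_period)
  define bad where "bad k \<longleftrightarrow> \<not> rigid b v 0 (r * int k + int b)" for k
  have "\<exists>k. bad k"
  proof (rule ccontr)
    assume "\<nexists>k. bad k"
    then have "rigid b v 0 (r * int (nat (hi - lo)) + int b)" unfolding bad_def by blast
    moreover have "r * int (nat (hi - lo)) \<ge> hi - lo" using r len
      by (simp add: mult_le_cancel_right1)
    then have "hi - lo \<le> r * int (nat (hi - lo)) + int b" using len b_pos by linarith
    moreover have "chain b v 0 (r * int (nat (hi - lo)) + int b)"
      unfolding v_cyc by (rule cycle_chain[OF X])
    ultimately have rig: "rigid b v 0 (hi - lo)"
      using rigid_subset[OF b_pos, of v 0 "r * int (nat (hi - lo)) + int b" 0 "hi - lo"] len by linarith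
    have "rigid b (cyc X s) lo hi"
      unfolding rigid_def
    proof (intro allI impI, elim conjE)
      fix h h' assume h: "realises b (cyc X s) h lo hi" "realises b (cyc X s) h' lo hi"
      have "same_order_on {0..<hi - lo} (\<lambda>z. h (z + lo)) (\<lambda>z. h' (z + lo))"
        using rigidD[OF rig] realises_shift[OF h(1), of lo] realises_shift[OF h(2), of lo]
        unfolding v_def by simp
      then show "same_order_on {lo..<hi} h h'"
        unfolding same_order_on_def
      proof (intro ballI)
        fix x y assume a: "\<forall>x\<in>{0..<hi - lo}. \<forall>y\<in>{0..<hi - lo}. (h (x + lo) < h (y + lo)) = (h' (x + lo) < h' (y + lo))"
          "x \<in> {lo..<hi}" "y \<in> {lo..<hi}"
        show "(h x < h y) = (h' x < h' y)"
          using a(1)[rule_format, of "x - lo" "y - lo"] a(2,3) by simp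
      qed
    qed
    then show False using not_rigid by blast
  qed
  then obtain k where k: "bad k" "\<And>k'. bad k' \<Longrightarrow> k \<le> k'"
    using LeastI_ex[of bad] Least_le[of bad] by blast
  have "\<not> bad 0" using rigid_single[of v 0] unfolding bad_def by simp
  then have "k \<noteq> 0" using k(1) by metis
  then have "\<not> bad (k - 1)" using k(2)[of "k - 1"] by auto
  define W where "W = r * int k + int b"
  have short: "rigid b v 0 (W - r)"
    using \<open>\<not> bad (k - 1)\<close> \<open>k \<noteq> 0\<close> unfolding bad_def W_def
    by (simp add: of_nat_diff algebra_simps)
  have Wr: "W - r \<ge> int b" using r \<open>k \<noteq> 0\<close> unfolding W_def by (cases k) (auto simp: algebra_simps)
  obtain f g where f: "realises b v f 0 W" and g: "realises b v g 0 W"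
    and fg: "\<not> same_order_on {0..<W} f g"
    using k(1) unfolding bad_def rigid_def W_def by blast
  have glue: "\<exists>h. realises b v h 0 (r * int m + W) \<and>
      (\<forall>t\<le>m. same_order_on {0..<W} (\<lambda>x. h (x + r * int t)) (w t))"
    if w: "\<And>t. realises b v (w t) 0 W" for w :: "nat \<Rightarrow> int \<Rightarrow> int" and m
  proof (induction m)
    case 0
    then show ?case using w by (intro exI[of _ "w 0"]) (auto simp: same_order_on_def)
  next
    case (Suc m)
    then obtain h where h: "realises b v h 0 (r * int m + W)"
      "\<And>t. t \<le> m \<Longrightarrow> same_order_on {0..<W} (\<lambda>x. h (x + r * int t)) (w t)" by blast
    define o' where "o' = r * int (Suc m)"
    have o': "o' \<ge> 0" "r * int m + W = o' + (W - r)" using r by (auto simp: o'_def algebra_simps)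
    define g' where "g' = (\<lambda>x. w (Suc m) (x - o'))"
    have g': "realises b v g' o' (o' + W)"
    proof -
      have "v (z - o') = v z" for z
        using per[of "z - o'" "int (Suc m)"] by (simp add: o'_def)
      then show ?thesis
        using realises_shift[OF w[of "Suc m"], of "- o'"] unfolding g'_def by (simp add: add.commute)
    qed
    have v_o': "v (z + o') = v z" for z using per by (simp add: o'_def)
    have "same_order_on {o'..<o' + (W - r)} h g'"
    proof -
      have "realises b v (\<lambda>z. h (z + o')) (0 - o') (r * int m + W - o')"
        using realises_shift[OF h(1), of o'] v_o' by simp
      then have "realises b v (\<lambda>z. h (z + o')) 0 (W - r)"
        by (rule realises_subset) (use o' in auto)
      moreover have "realises b v (w (Suc m)) 0 (W - r)"
        using realises_subset[OF w[of "Suc m"], of 0 "W - r"] r by simp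
      ultimately have "same_order_on {0..<W - r} (\<lambda>z. h (z + o')) (w (Suc m))"
        using rigidD[OF short] by blast
      then show ?thesis unfolding same_order_on_def g'_def
      proof (intro ballI)
        fix x y assume a: "\<forall>x\<in>{0..<W - r}. \<forall>y\<in>{0..<W - r}. (h (x + o') < h (y + o')) = (w (Suc m) x < w (Suc m) y)"
          "x \<in> {o'..<o' + (W - r)}" "y \<in> {o'..<o' + (W - r)}"
        then show "(h x < h y) = (w (Suc m) (x - o') < w (Suc m) (y - o'))"
          using a(1)[rule_format, of "x - o'" "y - o'"] by simp
      qed
    qed
    then obtain h' where h': "realises b v h' 0 (o' + W)"
      "same_order_on {0..<o' + (W - r)} h h'" "same_order_on {o'..<o' + W} g' h'"
      using realises_glue[of b v h 0 "o' + (W - r)" g' o' "o' + W"] h(1) g' o' Wr r by auto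
    have "same_order_on {0..<W} (\<lambda>x. h' (x + r * int t)) (w t)" if t: "t \<le> Suc m" for t
    proof (cases "t = Suc m")
      case True
      have "same_order_on {0..<W} (\<lambda>x. h' (x + o')) (w (Suc m))"
        unfolding same_order_on_def
      proof (intro ballI)
        fix x y assume "x \<in> {0..<W}" "y \<in> {0..<W}"
        then show "(h' (x + o') < h' (y + o')) = (w (Suc m) x < w (Suc m) y)"
          using same_order_onD[OF h'(3), of "x + o'" "y + o'"] by (simp add: g'_def)
      qed
      then show ?thesis using True by (simp add: o'_def)
    next
      case False
      then have tm: "t \<le> m" using t by simp
      have "same_order_on {0..<W} (\<lambda>x. h' (x + r * int t)) (\<lambda>x. h (x + r * int t))"
        unfolding same_order_on_def
      proof (intro ballI)
        fix x y assume xy: "x \<in> {0..<W}" "y \<in> {0..<W}"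
        have "r * int t \<le> r * int m" "0 \<le> r * int t" using tm r by auto
        then show "(h' (x + r * int t) < h' (y + r * int t)) = (h (x + r * int t) < h (y + r * int t))"
          using same_order_onD[OF h'(2), of "x + r * int t" "y + r * int t"] xy o'(2) by simp
      qed
      then show ?thesis using h(2)[OF tm] same_order_on_trans by blast
    qed
    then show ?case using h'(1) unfolding o'_def by blast
  qed
  define w where "w m t = (if t = 0 \<or> t = Suc m then f else g)" for m t :: nat
  have "\<forall>m. \<exists>h. realises b v h 0 (r * int (Suc m) + W) \<and>
      (\<forall>t\<le>Suc m. same_order_on {0..<W} (\<lambda>x. h (x + r * int t)) (w m t))"
    using glue[of "w m" "Suc m" for m] f g by (auto simp: w_def)
  then obtain h where h: "\<And>m. realises b v (h m) 0 (r * int (Suc m) + W)"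
    and word: "\<And>m t. t \<le> Suc m \<Longrightarrow> same_order_on {0..<W} (\<lambda>x. h m (x + r * int t)) (w m t)" by metis
  define N where "N m = nat (r * int (Suc m) + r * int k + 1)" for m
  have N: "int (N m) = r * int (Suc m) + r * int k + 1" for m using r by (simp add: N_def)
  have N1: "N m \<ge> 1" for m
  proof -
    have "r * int (Suc m) + r * int k \<ge> 0" using r by simp
    then show ?thesis unfolding N_def by linarith
  qed
  have top: "0 + int (N m + b - 1) = r * int (Suc m) + W" for m
    using N[of m] N1[of m] unfolding W_def by simp
  have path: "window v 0 (N m) \<in> paths G" for m
    unfolding v_cyc by (rule cycle_window_in_paths[OF X N1])
  have h': "realises b v (h m) 0 (0 + int (N m + b - 1))" for m using h top by simp
  obtain m n d where mn: "m \<noteq> n" "d + N m \<le> N n"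
    and same: "same_order_on {0..<0 + int (N m + b - 1)} (h m) (\<lambda>x. h n (x + (0 - 0 + int d)))"
    and eq: "\<And>z. 0 \<le> z \<Longrightarrow> z < 0 + int (N m) \<Longrightarrow> v z = v (z + (0 - 0 + int d))"
    by (rule well_quasi_order_embedding[OF wqo, of "\<lambda>_. v" "\<lambda>_. 0" N h, OF path N1 h'])
      (blast intro: that)
  have "v 0 = v (int d)" using eq[of 0] N1[of m] by simp
  then have "r dvd int d"
    using cyc_eq_iff[OF X'(2,1), of "s - lo" "int d" 0] unfolding v_cyc r_def by simp
  then obtain q' where q': "int d = r * q'" by (elim dvdE)
  then have "q' \<ge> 0" using r by (metis of_nat_0_le_iff zero_le_mult_iff not_less)
  then obtain q where q: "int d = r * int q" using q' nonneg_int_cases by metis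
  have "int d + int (N m) \<le> int (N n)" using mn(2) by linarith
  then have "r * (int q + int m) \<le> r * int n" unfolding N q by (simp add: algebra_simps)
  then have qmn: "q + m \<le> n" using r by (simp flip: of_nat_add)
  have same': "same_order_on {0..<W} (w m t) (w n (t + q))" if t: "t \<le> Suc m" for t
  proof -
    have "same_order_on {0..<W} (\<lambda>x. h m (x + r * int t)) (\<lambda>x. h n (x + r * int (t + q)))"
      unfolding same_order_on_def
    proof (intro ballI)
      fix x y assume xy: "x \<in> {0..<W}" "y \<in> {0..<W}"
      have "r * int t \<le> r * int (Suc m)" "0 \<le> r * int t" using t r by auto
      then have "x + r * int t \<in> {0..<0 + int (N m + b - 1)}" "y + r * int t \<in> {0..<0 + int (N m + b - 1)}"
        using xy unfolding top by auto
      from same_order_onD[OF same this]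
      show "(h m (x + r * int t) < h m (y + r * int t)) = (h n (x + r * int (t + q)) < h n (y + r * int (t + q)))"
        using q by (simp add: algebra_simps)
    qed
    moreover have "t + q \<le> Suc n" using t qmn by linarith
    ultimately show ?thesis
      using same_order_on_trans[OF same_order_on_sym[OF word[OF t]]] same_order_on_trans[OF _ word]
      by blast
  qed
  have "q = 0"
  proof (rule ccontr)
    assume "q \<noteq> 0"
    then have "w n q = g" using qmn by (simp add: w_def)
    then show False using same'[of 0] fg by (simp add: w_def)
  qed
  then have "w n (Suc m) = g" using qmn mn(1) by (simp add: w_def)
  then show False using same'[of "Suc m"] fg \<open>q = 0\<close> by (simp add: w_def)
qed

text \<open>Every stretch of a cyclic walk is contained in a closed one.\<close>

lemma no_ambiguous_cycle_rigid_cycles: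
  assumes "\<nexists>\<pi>. path_cycle G \<pi> \<and> ambiguous b \<pi>"
  shows rigid_cycles
  unfolding rigid_cycles_def
proof (intro allI impI, elim conjE)
  fix X s lo hi assume X: "graph_cycle G X" and len: "hi - lo \<ge> int b"
  define r where "r = length X"
  have r: "r > 0" using X by (simp add: r_def graph_cycle_def)
  define K where "K = Suc (nat (hi - lo))"
  define N where "N = r * K + 1"
  have N: "N \<ge> 2" "int N \<ge> hi - lo"
  proof -
    have "K \<le> r * K" using r by simp
    then show "N \<ge> 2" "int N \<ge> hi - lo" unfolding N_def K_def by linarith+
  qed
  have "path_cycle G (window (cyc X s) lo N)"
    unfolding path_cycle_def
  proof (intro conjI)
    show "window (cyc X s) lo N \<in> paths G" using cycle_window_in_paths[OF X] N by simp
    have "hd (window (cyc X s) lo N) = cyc X s lo"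
      using N by (simp add: hd_window)
    also have "\<dots> = cyc X s (lo + int (N - 1))"
      using cyc_period[of X s lo "int K"] by (simp add: N_def r_def)
    also have "\<dots> = last (window (cyc X s) lo N)"
      using N by (simp add: last_window)
    finally show "hd (window (cyc X s) lo N) = last (window (cyc X s) lo N)" .
  qed (use N in simp)
  then have "\<not> ambiguous b (window (cyc X s) lo N)" using assms by blast
  then have "rigid b (cyc X s) lo (lo + int (N + b - 1))"
    using ambiguous_window_iff[of N b "cyc X s" lo] N by simp
  then show "rigid b (cyc X s) lo hi"
  proof (rule rigid_subset[OF b_pos _ cycle_chain[OF X]])
    have "int (N + b - 1) \<ge> int N" using b_pos by simp
    then show "hi \<le> lo + int (N + b - 1)" using N by linarith
  qed (use len in auto)
qed

text \<open>In a bicycle, a closed walk stays in one of the two cycles, as its first vertex recurs.\<close>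

lemma rigid_cycles_no_ambiguous_cycle:
  assumes rigid_cycles and dec: "path_complete_decomposition G Bs" and bi: "\<forall>B\<in>set Bs. bicycle B"
  shows "\<nexists>\<pi>. path_cycle G \<pi> \<and> ambiguous b \<pi>"
proof (rule notI, elim exE conjE)
  fix \<pi> assume cyc: "path_cycle G \<pi>" and amb: "ambiguous b \<pi>"
  then obtain B where B: "B \<in> set Bs" "\<pi> \<in> paths B" "subgraph (with_proj B) (with_proj G)"
    using dec unfolding path_complete_decomposition_def path_cycle_def by blast
  then obtain I P T where parts: "bicycle_parts B I P T" using bi unfolding bicycle_def by blast
  interpret bicycle_with_parts B I P T by unfold_locales (rule parts)
  obtain lo where lo: "\<pi> = window u lo (length \<pi>)" "in_span I P T lo (lo + int (length \<pi>))"
    using path_is_window[OF B(2)] by blast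
  define N where "N = length \<pi>"
  have N: "N \<ge> 2" "hd \<pi> = last \<pi>" using cyc by (auto simp: N_def path_cycle_def)
  have \<pi>: "\<pi> = window u lo N" using lo(1) by (simp add: N_def)
  have "u lo = u (lo + int (N - 1))"
    using N hd_window[of N u lo] last_window[of N u lo] by (simp add: \<pi>)
  moreover have "lo < lo + int (N - 1)" "in_span I P T lo (lo + int (N - 1) + 1)"
    using N lo(2) by (auto simp: N_def[symmetric])
  ultimately have "I \<noteq> [] \<and> lo + int (N - 1) \<le> 0 \<or> T \<noteq> [] \<and> e \<le> lo"
    using walk_repeats by blast
  then obtain X s where X: "graph_cycle G X" and same: "\<And>z. lo \<le> z \<Longrightarrow> z < lo + int N \<Longrightarrow> u z = cyc X s z"
  proof
    assume a: "I \<noteq> [] \<and> lo + int (N - 1) \<le> 0"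
    then have "graph_cycle G I"
      using parts simple_cycle_closed_up_iff[of I B] B(3)
      by (auto simp: bicycle_parts_def graph_cycle_def subgraph_def)
    then show thesis using that[of I 0] walk_initial a N by auto
  next
    assume a: "T \<noteq> [] \<and> e \<le> lo"
    then have "graph_cycle G T"
      using parts simple_cycle_closed_up_iff[of T B] B(3)
      by (auto simp: bicycle_parts_def graph_cycle_def subgraph_def)
    then show thesis using that[of T e] walk_terminal a by auto
  qed
  have "\<pi> = window (cyc X s) lo N"
    using same unfolding \<pi> by (auto simp: window_def)
  moreover have "rigid b (cyc X s) lo (lo + int (N + b - 1))"
    using assms(1) X N unfolding rigid_cycles_def by auto
  ultimately show False using amb ambiguous_window_iff[of N b "cyc X s" lo] N by simp
qed

end

section \<open>Splitting a shrinking pair\<close>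

text \<open>A value that a pair does not enclose is on the same side of all values enclosed by it, and on
  which side is decided by a comparison with the ends of the pair.\<close>

lemma encloses_same_side:
  assumes "\<And>i. i < n \<Longrightarrow> (w < H 0 i \<longleftrightarrow> w' < H' 0 i) \<and> (H 0 i < w \<longleftrightarrow> H' 0 i < w')"
    and "shrinks H n g" "\<not> encloses H 0 g w" "encloses H 0 g p" "encloses H' 0 g p'"
  shows "(w < p \<longleftrightarrow> w' < p') \<and> (p < w \<longleftrightarrow> p' < w')"
proof (cases g)
  case (Inner i j)
  then have "i < n" "j < n" using assms(2) by auto
  then show ?thesis using assms(1)[of i] assms(1)[of j] assms(3-5) Inner by auto
next
  case (Below q)
  then have "q < n" using assms(2) by auto
  then show ?thesis using assms(1)[of q] assms(3-5) Below by auto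
next
  case (Above q)
  then have "q < n" using assms(2) by auto
  then show ?thesis using assms(1)[of q] assms(3-5) Above by auto
qed

lemma shrinks_cong:
  assumes "\<And>t t' i j. \<lbrakk>t < 2; t' < 2; i < n; j < n\<rbrakk> \<Longrightarrow> H t i < H t' j \<longleftrightarrow> H' t i < H' t' j"
  shows "shrinks H n g \<longleftrightarrow> shrinks H' n g"
proof -
  have *: "H 0 i < H 0 j \<longleftrightarrow> H' 0 i < H' 0 j" "H 0 i < H 1 j \<longleftrightarrow> H' 0 i < H' 1 j"
    "H 1 i < H 0 j \<longleftrightarrow> H' 1 i < H' 0 j" "H 1 i < H 1 j \<longleftrightarrow> H' 1 i < H' 1 j"
    if "i < n" "j < n" for i j using assms that by auto
  have **: "H 0 i \<le> H 0 j \<longleftrightarrow> H' 0 i \<le> H' 0 j" if "i < n" "j < n" for i j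
    using *(1)[OF that(2,1)] by linarith
  show ?thesis by (cases g) (auto simp: *[unfolded One_nat_def] ** cong: conj_cong)
qed

lemma encloses_cong:
  assumes "\<And>i. i < n \<Longrightarrow> (p < H t i \<longleftrightarrow> p' < H' t i) \<and> (H t i < p \<longleftrightarrow> H' t i < p')"
    and "shrinks H n g"
  shows "encloses H t g p \<longleftrightarrow> encloses H' t g p'"
  using assms by (cases g) auto

context finitely_based
begin

text \<open>Let \<open>Z m\<close> be a stretch of \<open>m + 3\<close> rounds of one of the cycles of a bicycle, read as copies
  of the iterator starting at \<open>s\<close>, and \<open>A\<close> the remaining stretch, which overlaps \<open>Z m\<close> in the
  single window \<open>W\<close>.  If the entry in position \<open>x\<^sub>0\<close> of \<open>A\<close> splits a shrinking pair, then it is not in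
  \<open>W\<close>, and no entry of \<open>W\<close> is enclosed by the pair.  Hence nothing prevents it from being moved into
  the pair of the \<open>m\<close>-th copy, but outside that of the next one.  These realisations give an
  antichain, as the bicycle determines how one of them could be embedded into another.\<close>

lemma splitting_antichain:
  fixes d s x\<^sub>0 :: int
  assumes wqo: "well_quasi_ordered_on (\<le>\<^sub>f) C"
    and X: "graph_cycle G X" and v: "v = cyc X \<sigma>" and per: "\<And>z. v (z + d) = v z"
    and d: "\<bar>d\<bar> = int n" and n: "n \<ge> b"
    and Zv: "\<And>m z. zl m \<le> z \<Longrightarrow> z + int b \<le> zh m \<Longrightarrow> u z = v z"
    and blk: "\<And>m t i. t < m + 3 \<Longrightarrow> i < n \<Longrightarrow> s + int t * d + int i \<in> {zl m..<zh m}"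
    and inter: "\<And>m. {al..<ah} \<inter> {zl m..<zh m} = W"
    and union: "\<And>m. {al..<ah} \<union> {zl m..<zh m} = {lo m..<hi m}"
    and cover: "\<And>m z. lo m \<le> z \<Longrightarrow> z + int b \<le> hi m \<Longrightarrow>
        al \<le> z \<and> z + int b \<le> ah \<or> zl m \<le> z \<and> z + int b \<le> zh m"
    and W: "\<And>w. w \<in> W \<Longrightarrow> \<exists>k<n. w + d = s + int k"
    and path: "\<And>m. window u (lo m) (N m) \<in> paths G" and N: "\<And>m. N m \<ge> 1"
    and hi: "\<And>m. hi m = lo m + int (N m + b - 1)"
    and h: "realises b u h L R" and AL: "{al..<ah} \<subseteq> {L..<R}"
    and overlap: "W \<subseteq> {cl..<ch}" "{cl..<ch} \<subseteq> {L..<R}"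
      "\<And>m. {cl..<ch} \<subseteq> {zl m..<zh m}" "ch - cl \<ge> int b"
      "\<And>t i. t < 2 \<Longrightarrow> i < n \<Longrightarrow> s + int t * d + int i \<in> {cl..<ch}"
    and x0: "x\<^sub>0 \<in> {al..<ah}"
    and g: "shrinks (\<lambda>t i. h (s + int t * d + int i)) n g"
      "encloses (\<lambda>t i. h (s + int t * d + int i)) 0 g (h x\<^sub>0)"
    and align: "\<And>m m' \<delta>. x\<^sub>0 \<notin> W \<Longrightarrow>
        (\<And>z. lo m \<le> z \<Longrightarrow> z + int b \<le> hi m \<Longrightarrow>
           u z = u (z + \<delta>) \<and> lo m' \<le> z + \<delta> \<and> z + \<delta> + int b \<le> hi m') \<Longrightarrow> \<delta> = 0"
    and mono: "\<And>m m'. m < m' \<Longrightarrow> N m < N m'"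
  shows False
proof -
  define H where "H h = (\<lambda>t i. h (s + int t * d + int i))" for h :: "int \<Rightarrow> int"
  have H: "H f t i = f (s + int t * d + int i)" for f t i by (simp add: H_def)
  have rig: "rigid b v lo hi" if "hi - lo \<ge> int b" for lo hi
    using well_quasi_order_rigid_cycles[OF wqo] X v that unfolding rigid_cycles_def by blast
  have Zlen: "zh m - zl m \<ge> int b" for m
    using overlap(3)[of m] overlap(4) b_pos by auto
  have "\<exists>f. realises b v f (zl m) (zh m)" for m
    using realises_exists[OF b_pos cycle_chain[OF X] Zlen] v by blast
  then obtain f where fv: "\<And>m. realises b v (f m) (zl m) (zh m)" by metis
  have fu: "realises b u (f m) (zl m) (zh m)" for m
    using realises_cong[of "zl m" b "zh m" u v] Zv fv by blast
  have finj: "inj_on (f m) {zl m..<zh m}" for m using realisesD(1)[OF fv] .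
  have same: "same_order_on {cl..<ch} h (f m)" for m
  proof -
    have "cl < ch" using overlap(4) b_pos by linarith
    then have sub: "L \<le> cl" "ch \<le> R" "zl m \<le> cl" "ch \<le> zh m" using overlap(2) overlap(3)[of m] by auto
    have "realises b v h cl ch"
      using realises_subset[OF h sub(1,2)] realises_cong[of cl b ch u v] Zv[of m] sub by auto
    from rigidD[OF rig[OF overlap(4)] this realises_subset[OF fv sub(3,4)]] show ?thesis .
  qed
  have blocks: "blocks (H (f m)) n (m + 3)" for m
    unfolding H_def using realises_blocks[OF fv rig d b_pos n _ per blk] by simp
  have shr: "shrinks (H (f m)) n g" for m
  proof -
    have "shrinks (H h) n g \<longleftrightarrow> shrinks (H (f m)) n g"
      by (rule shrinks_cong) (use same_order_onD[OF same] overlap(5) in \<open>auto simp: H\<close>)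
    then show ?thesis using g(1) by (simp add: H_def)
  qed
  \<comment> \<open>Shifting by one copy takes \<open>w\<close> to an entry of the first copy, which would then be enclosed by the
    pair of the second copy and so by its own.\<close>
  have own: "\<not> encloses (H (f m)) 0 g (f m w)" if w: "w \<in> W" for m w
  proof
    assume a: "encloses (H (f m)) 0 g (f m w)"
    obtain k where k: "k < n" "w + d = s + int k" using W[OF w] by blast
    have sh: "f m (z + d) < f m (z' + d) \<longleftrightarrow> f m z < f m z'"
      if "z \<in> {zl m..<zh m}" "z' \<in> {zl m..<zh m}" "z + d \<in> {zl m..<zh m}" "z' + d \<in> {zl m..<zh m}" for z z'
    proof -
      define lo' hi' where "lo' = max (zl m) (zl m - d)" and "hi' = min (zh m) (zh m - d)"
      have "realises b v (\<lambda>z. f m (z + d)) (zl m - d) (zh m - d)"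
        using realises_shift[OF fv[of m], of d] per by simp
      then have r: "realises b v (\<lambda>z. f m (z + d)) lo' hi'" "realises b v (f m) lo' hi'"
        using realises_subset fv unfolding lo'_def hi'_def
        by (metis max.cobounded1 max.cobounded2 min.cobounded1 min.cobounded2)+
      have "hi' - lo' \<ge> int b"
        using blk[of 0 m 0] blk[of 0 m "n - 1"] blk[of 1 m 0] blk[of 1 m "n - 1"]
          blk[of 2 m 0] blk[of 2 m "n - 1"] d n b_pos
        unfolding lo'_def hi'_def by auto
      from same_order_onD[OF rigidD[OF rig[OF this] r], of z z'] that show ?thesis
        unfolding lo'_def hi'_def by auto
    qed
    have wZ: "w \<in> {zl m..<zh m}" "w + d \<in> {zl m..<zh m}"
      using w inter[of m] blk[of 0 m k] k by auto
    have pos: "s + int i + d \<in> {zl m..<zh m}" "s + int i \<in> {zl m..<zh m}" if "i < n" for i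
      using blk[of 1 m i] blk[of 0 m i] that by (auto simp: algebra_simps)
    have "encloses (H (f m)) 1 g (f m (w + d))"
    proof (cases g)
      case (Inner i j)
      then have "i < n" "j < n" using shr[of m] by auto
      then show ?thesis using a Inner sh[OF wZ(1) pos(2) wZ(2) pos(1)] sh[OF pos(2) wZ(1) pos(1) wZ(2)]
        by (auto simp: H algebra_simps)
    next
      case (Below q)
      then have "q < n" using shr[of m] by auto
      then show ?thesis using a Below sh[OF wZ(1) pos(2) wZ(2) pos(1)] by (auto simp: H algebra_simps)
    next
      case (Above q)
      then have "q < n" using shr[of m] by auto
      then show ?thesis using a Above sh[OF pos(2) wZ(1) pos(1) wZ(2)] by (auto simp: H algebra_simps)
    qed
    then have "encloses (H (f m)) 1 g (H (f m) 0 k)" using k by (simp add: H)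
    then show False using blocks.not_encloses_own[OF blocks[of m] shr[of m] k(1), of 1] by simp
  qed
  have h_own: "\<not> encloses (H h) 0 g (h w)" if w: "w \<in> W" for w
  proof -
    have "encloses (H h) 0 g (h w) \<longleftrightarrow> encloses (H (f 0)) 0 g (f 0 w)"
    proof (rule encloses_cong)
      show "shrinks (H h) n g" using g(1) by (simp add: H_def)
      have "w \<in> {cl..<ch}" using w overlap(1) by blast
      then show "(h w < H h 0 i) = (f 0 w < H (f 0) 0 i) \<and> (H h 0 i < h w) = (H (f 0) 0 i < f 0 w)"
        if "i < n" for i
        using same_order_onD[OF same[of 0]] overlap(5)[of 0 i] that by (simp add: H)
    qed
    then show ?thesis using own[OF w] by blast
  qed
  have x0W: "x\<^sub>0 \<notin> W" using h_own g(2) by (auto simp: H_def)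
  have x0Z: "x\<^sub>0 \<notin> {zl m..<zh m}" for m using x0W x0 inter[of m] by blast
  have "\<exists>k. realises b u k (lo m) (hi m) \<and> shrinks (H k) n g \<and>
      encloses (H k) m g (k x\<^sub>0) \<and> \<not> encloses (H k) (Suc m) g (k x\<^sub>0)" for m
  proof -
    \<comment> \<open>\<open>f'\<close> places \<open>x\<^sub>0\<close> relative to \<open>Z m\<close>; it agrees with \<open>h\<close> on \<open>W\<close> and \<open>x\<^sub>0\<close>, so both can be
      amalgamated.\<close>
    obtain p where p: "odd p" "encloses (\<lambda>t i. 2 * H (f m) t i) m g p"
      "\<not> encloses (\<lambda>t i. 2 * H (f m) t i) (Suc m) g p"
      using blocks.exists_between_pairs[OF blocks shr, of m m] by auto
    define f' where "f' = (\<lambda>z. 2 * f m z)(x\<^sub>0 := p)"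
    have f': "f' z = 2 * f m z" if "z \<in> {zl m..<zh m}" for z
      using that x0Z[of m] unfolding f'_def by auto
    have f'x: "f' x\<^sub>0 = p" by (simp add: f'_def)
    have Hf': "H f' t i = 2 * H (f m) t i" if "t < m + 3" "i < n" for t i
      using f'[OF blk[OF that]] by (simp add: H)
    have same_f': "same_order_on {zl m..<zh m} (f m) f'"
      unfolding same_order_on_def using f' by auto
    have inj': "inj_on f' ({zl m..<zh m} \<union> {x\<^sub>0})"
    proof -
      have "inj_on f' {zl m..<zh m}" using same_order_on_inj[OF same_f' finj] .
      moreover have "f' x\<^sub>0 \<notin> f' ` {zl m..<zh m}"
      proof
        assume "f' x\<^sub>0 \<in> f' ` {zl m..<zh m}"
        then obtain z where "z \<in> {zl m..<zh m}" "f' x\<^sub>0 = f' z" by blast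
        then have "p = 2 * f m z" using f' f'x by simp
        then show False using p(1) by simp
      qed
      ultimately show ?thesis by (auto simp: inj_on_insert)
    qed
    have "encloses (\<lambda>t i. 2 * H (f m) t i) 0 g p"
    proof -
      interpret b2: blocks "\<lambda>t i. 2 * H (f m) t i" n "m + 3"
      proof -
        interpret blocks "H (f m)" n "m + 3" by (rule blocks)
        show "blocks (\<lambda>t i. 2 * H (f m) t i) n (m + 3)"
          by unfold_locales (use inj shift sep N in auto)
      qed
      have "shrinks (\<lambda>t i. 2 * H (f m) t i) n g"
        using shr[of m] shrinks_cong[of n "H (f m)" "\<lambda>t i. 2 * H (f m) t i"] by simp
      from b2.encloses_decreasing[OF this p(2), of 0] show ?thesis by simp
    qed
    then have enc0: "encloses (H f') 0 g (f' x\<^sub>0)"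
      using shr[of m] Hf' f'x by (cases g) auto
    have "same_order_on ({al..<ah} \<inter> ({zl m..<zh m} \<union> {x\<^sub>0})) h f'"
    proof -
      have WW: "h w < h w' \<longleftrightarrow> f' w < f' w'" if "w \<in> W" "w' \<in> W" for w w'
      proof -
        have "w \<in> {cl..<ch}" "w' \<in> {cl..<ch}" "w \<in> {zl m..<zh m}" "w' \<in> {zl m..<zh m}"
          using that overlap(1) inter[of m] by blast+
        then show ?thesis using same_order_onD[OF same[of m]] f' by simp
      qed
      have Wx: "(h w < h x\<^sub>0 \<longleftrightarrow> f' w < f' x\<^sub>0) \<and> (h x\<^sub>0 < h w \<longleftrightarrow> f' x\<^sub>0 < f' w)" if w: "w \<in> W" for w
      proof (rule encloses_same_side)
        show "(h w < H h 0 i) = (f' w < H f' 0 i) \<and> (H h 0 i < h w) = (H f' 0 i < f' w)" if "i < n" for i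
        proof -
          have "w \<in> {cl..<ch}" "w \<in> {zl m..<zh m}" using w overlap(1) inter[of m] by blast+
          then show ?thesis
            using same_order_onD[OF same[of m]] overlap(5)[of 0 i] that f' Hf'[of 0 i] by (simp add: H)
        qed
        show "encloses (H h) 0 g (h x\<^sub>0)" "shrinks (H h) n g" using g by (simp_all add: H_def)
      qed (use enc0 h_own[OF w] in auto)
      have "{al..<ah} \<inter> ({zl m..<zh m} \<union> {x\<^sub>0}) \<subseteq> W \<union> {x\<^sub>0}" using inter[of m] by blast
      moreover have "same_order_on (W \<union> {x\<^sub>0}) h f'"
        unfolding same_order_on_def using WW Wx by auto
      ultimately show ?thesis using same_order_on_subset by blast
    qed
    then obtain k where k: "inj_on k ({al..<ah} \<union> ({zl m..<zh m} \<union> {x\<^sub>0}))"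
      "same_order_on {al..<ah} h k" "same_order_on ({zl m..<zh m} \<union> {x\<^sub>0}) f' k"
      using amalgamation[of "{zl m..<zh m} \<union> {x\<^sub>0}" "{al..<ah}" h f']
        inj_on_subset[OF realisesD(1)[OF h] AL] inj' by auto
    have "realises b u k (lo m) (hi m)"
      unfolding realises_def
    proof (intro conjI allI impI)
      show "inj_on k {lo m..<hi m}" using inj_on_subset[OF k(1)] union[of m] by blast
      have kA: "realises b u k al ah"
      proof (cases "al < ah")
        case True
        then have "L \<le> al" "ah \<le> R" using AL by auto
        then show ?thesis using realises_same_order[OF realises_subset[OF h] k(2)] by blast
      next
        case False
        then show ?thesis using b_pos by (auto simp: realises_def)
      qed
      have "same_order_on {zl m..<zh m} (f m) k"
        using same_order_on_trans[OF same_f' same_order_on_subset[OF k(3)]] by blast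
      from realises_same_order[OF fu this] have kZ: "realises b u k (zl m) (zh m)" .
      fix z assume "lo m \<le> z \<and> z + int b \<le> hi m"
      then show "pattern k z b = u z" using cover[of m z] realisesD(2)[OF kA] realisesD(2)[OF kZ] by blast
    qed
    moreover have Hk: "H k t i < H k t' j \<longleftrightarrow> H (f m) t i < H (f m) t' j"
      if "t < m + 3" "t' < m + 3" "i < n" "j < n" for t t' i j
      using same_order_onD[OF k(3), of "s + int t * d + int i" "s + int t' * d + int j"]
        blk[OF that(1,3)] blk[OF that(2,4)] f' by (simp add: H)
    then have shk: "shrinks (H k) n g"
      using shr[of m] shrinks_cong[of n "H k" "H (f m)" g] by simp
    moreover have "encloses (H k) t g (k x\<^sub>0) \<longleftrightarrow> encloses (\<lambda>t i. 2 * H (f m) t i) t g p" if t: "t < m + 3" for t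
    proof (rule encloses_cong[OF _ shk])
      fix i assume "i < n"
      then show "(k x\<^sub>0 < H k t i) = (p < 2 * H (f m) t i) \<and> (H k t i < k x\<^sub>0) = (2 * H (f m) t i < p)"
        using same_order_onD[OF k(3), of "s + int t * d + int i" x\<^sub>0]
          same_order_onD[OF k(3), of x\<^sub>0 "s + int t * d + int i"] blk[OF t, of i] f' f'x by (simp add: H)
    qed
    ultimately show ?thesis using p(2,3) by (intro exI[of _ k]) simp
  qed
  then obtain k where k: "\<And>m. realises b u (k m) (lo m) (hi m)" "\<And>m. shrinks (H (k m)) n g"
    "\<And>m. encloses (H (k m)) m g (k m x\<^sub>0)" "\<And>m. \<not> encloses (H (k m)) (Suc m) g (k m x\<^sub>0)" by metis
  have k': "realises b u (k m) (lo m) (lo m + int (N m + b - 1))" for m using k(1) hi by simp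
  obtain m m' \<delta> where mm: "m \<noteq> m'" "\<delta> + N m \<le> N m'"
    and same_k: "same_order_on {lo m..<lo m + int (N m + b - 1)} (k m) (\<lambda>x. k m' (x + (lo m' - lo m + int \<delta>)))"
    and eq: "\<And>z. lo m \<le> z \<Longrightarrow> z < lo m + int (N m) \<Longrightarrow> u z = u (z + (lo m' - lo m + int \<delta>))"
    by (rule well_quasi_order_embedding[OF wqo, of "\<lambda>_. u" lo N k, OF path N k']) (blast intro: that)
  have zero: "lo m' - lo m + int \<delta> = 0"
  proof (rule align[OF x0W])
    have bound: "int (N m + b - 1) = int (N m) + int b - 1" for m using N[of m] by simp
    fix z assume "lo m \<le> z" "z + int b \<le> hi m"
    then show "u z = u (z + (lo m' - lo m + int \<delta>)) \<and> lo m' \<le> z + (lo m' - lo m + int \<delta>) \<and>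
         z + (lo m' - lo m + int \<delta>) + int b \<le> hi m'"
      using eq[of z] mm(2) hi[of m] hi[of m'] bound[of m] bound[of m'] by linarith
  qed
  have "m < m'"
    using mm mono[of m' m] by (cases m m' rule: linorder_cases) auto
  have same_k': "same_order_on {lo m..<hi m} (k m) (k m')" using same_k zero hi by simp
  interpret bl: blocks "H (k m')" n "m' + 3"
  proof -
    have "{zl m'..<zh m'} \<subseteq> {lo m'..<hi m'}" using union[of m'] by blast
    then have sub: "lo m' \<le> zl m'" "zh m' \<le> hi m'"
      unfolding ivl_subset using Zlen[of m'] b_pos by linarith+
    have "realises b v (k m') (zl m') (zh m')"
      using realises_subset[OF k(1) sub] realises_cong[of "zl m'" b "zh m'" u v] Zv by blast
    from realises_blocks[OF this rig d b_pos n _ per blk] show "blocks (H (k m')) n (m' + 3)"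
      unfolding H_def by simp
  qed
  have "encloses (H (k m')) (Suc m) g (k m' x\<^sub>0)"
    using bl.encloses_decreasing[OF k(2,3)[of m'], of "Suc m"] \<open>m < m'\<close> by simp
  moreover have "encloses (H (k m)) (Suc m) g (k m x\<^sub>0) \<longleftrightarrow> encloses (H (k m')) (Suc m) g (k m' x\<^sub>0)"
  proof (rule encloses_cong[OF _ k(2)])
    fix i assume "i < n"
    then have "s + int (Suc m) * d + int i \<in> {lo m..<hi m}" "x\<^sub>0 \<in> {lo m..<hi m}"
      using blk[of "Suc m" m i] union[of m] x0 by auto
    then show "(k m x\<^sub>0 < H (k m) (Suc m) i) = (k m' x\<^sub>0 < H (k m') (Suc m) i) \<and>
         (H (k m) (Suc m) i < k m x\<^sub>0) = (H (k m') (Suc m) i < k m' x\<^sub>0)"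
      using same_order_onD[OF same_k'] by (simp add: H)
  qed
  ultimately show False using k(4) by blast
qed

end

section \<open>Iterators, cores and splittable pairs in terms of models\<close>

lemma nth_concat_replicate:
  "i < k * length X \<Longrightarrow> concat (replicate k X) ! i = X ! (i mod length X)"
proof (induction k arbitrary: i)
  case (Suc k)
  then show ?case
    by (cases "i < length X") (auto simp: nth_append le_mod_geq)
qed simp

lemma length_concat_replicate: "length (concat (replicate k X)) = k * length X"
  by (induction k) auto

lemma length_augmented:
  "length (augmented b X) = (LEAST s. b \<le> length X * s) * length X"
  by (simp add: augmented_def length_concat_replicate)

lemma le_length_augmented: "X \<noteq> [] \<Longrightarrow> b \<le> length (augmented b X)"
  using LeastI[of "\<lambda>s. b \<le> length X * s" b] by (cases X) (auto simp: length_augmented mult.commute)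

lemma augmented_Nil [simp]: "augmented b [] = []"
  by (simp add: augmented_def)

lemma cyc_period_augmented: "cyc X s (z + int (length (augmented b X)) * k) = cyc X s z"
  using cyc_period[of X s z "int (LEAST s. b \<le> length X * s) * k"]
  by (simp add: length_augmented mult.commute mult.left_commute)

lemma nth_augmented:
  assumes "X \<noteq> []" "i < length (augmented b X)"
  shows "augmented b X ! i = cyc X 0 (int i)"
proof -
  have "i < (LEAST s. b \<le> length X * s) * length X" using assms(2) by (simp add: length_augmented)
  then have "augmented b X ! i = X ! (i mod length X)"
    unfolding augmented_def by (rule nth_concat_replicate)
  then show ?thesis by (simp add: cyc_def flip: zmod_int)
qed

lemma nth_concat_replicate_augmented:
  assumes "X \<noteq> []" "i < m * length (augmented b X)"
  shows "concat (replicate m (augmented b X)) ! i = cyc X 0 (int i)"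
proof -
  let ?n = "length (augmented b X)"
  have n: "?n > 0" using assms(2) by (cases ?n) auto
  have "concat (replicate m (augmented b X)) ! i = cyc X 0 (int (i mod ?n))"
    using nth_concat_replicate[OF assms(2)] nth_augmented[OF assms(1), of "i mod ?n"] n by simp
  also have "\<dots> = cyc X 0 (int (i mod ?n) + int ?n * int (i div ?n))"
    by (rule cyc_period_augmented[symmetric])
  also have "int (i mod ?n) + int ?n * int (i div ?n) = int i"
    by (metis mod_mult_div_eq of_nat_add of_nat_mult)
  finally show ?thesis .
qed

lemma nth_concat_replicate_rotate1_augmented:
  assumes "X \<noteq> []" "i < m * length (augmented b X)"
  shows "concat (replicate m (rotate1 (augmented b X))) ! i = cyc X 0 (int i + 1)"
proof -
  let ?n = "length (augmented b X)"
  have n: "?n > 0" using assms(2) by (cases ?n) auto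
  have "concat (replicate m (rotate1 (augmented b X))) ! i = augmented b X ! (Suc (i mod ?n) mod ?n)"
    using nth_concat_replicate[of i m "rotate1 (augmented b X)"] assms(2) n by (simp add: nth_rotate1)
  also have "\<dots> = cyc X 0 (int (Suc i mod ?n))"
    using nth_augmented[OF assms(1), of "Suc i mod ?n"] n by (simp add: mod_Suc_eq)
  also have "\<dots> = cyc X 0 (int (Suc i mod ?n) + int ?n * int (Suc i div ?n))"
    by (rule cyc_period_augmented[symmetric])
  also have "int (Suc i mod ?n) + int ?n * int (Suc i div ?n) = int i + 1"
    by (metis mod_mult_div_eq of_nat_add of_nat_mult of_nat_Suc add.commute)
  finally show ?thesis .
qed

lemma concat_slices: "concat (map (\<lambda>t. take n (drop (t * n) L)) [0..<c]) = take (c * n) L"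
  by (induction c) (auto simp: take_add add.commute[of n])

lemma length_concat_const:
  "(\<And>x. x \<in> set xs \<Longrightarrow> length x = n) \<Longrightarrow> length (concat xs) = length xs * n"
  by (induction xs) auto

lemma perms_succ_iff:
  assumes "\<sigma> \<in> perms" "i < length \<sigma>" "j < length \<sigma>"
  shows "\<sigma> ! j = \<sigma> ! i + 1 \<longleftrightarrow> \<sigma> ! i < \<sigma> ! j \<and> (\<forall>k<length \<sigma>. \<not> (\<sigma> ! i < \<sigma> ! k \<and> \<sigma> ! k < \<sigma> ! j))"
proof
  assume R: "\<sigma> ! i < \<sigma> ! j \<and> (\<forall>k<length \<sigma>. \<not> (\<sigma> ! i < \<sigma> ! k \<and> \<sigma> ! k < \<sigma> ! j))"
  have s: "set \<sigma> = {1..length \<sigma>}" using assms(1) by (simp add: perms_def)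
  have "\<sigma> ! j \<le> length \<sigma>" using s assms(3) nth_mem by fastforce
  then have "\<sigma> ! i + 1 \<in> set \<sigma>" using R s by auto
  then obtain k where k: "k < length \<sigma>" "\<sigma> ! k = \<sigma> ! i + 1" by (metis in_set_conv_nth)
  then have "\<not> \<sigma> ! k < \<sigma> ! j" using R by auto
  then show "\<sigma> ! j = \<sigma> ! i + 1" using k R by linarith
qed auto

lemma perms_min_iff:
  assumes "\<sigma> \<in> perms" "q < length \<sigma>"
  shows "\<sigma> ! q = 1 \<longleftrightarrow> (\<forall>k<length \<sigma>. \<sigma> ! q \<le> \<sigma> ! k)"
proof
  have s: "set \<sigma> = {1..length \<sigma>}" using assms(1) by (simp add: perms_def)
  show "\<forall>k<length \<sigma>. \<sigma> ! q \<le> \<sigma> ! k" if "\<sigma> ! q = 1"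
    using s nth_mem that by fastforce
  assume R: "\<forall>k<length \<sigma>. \<sigma> ! q \<le> \<sigma> ! k"
  have "1 \<in> set \<sigma>" using s assms(2) by auto
  then obtain k where "k < length \<sigma>" "\<sigma> ! k = 1" by (metis in_set_conv_nth)
  moreover have "\<sigma> ! q \<ge> 1" using s assms(2) nth_mem by fastforce
  ultimately show "\<sigma> ! q = 1" using R by force
qed

lemma perms_max_iff:
  assumes "\<sigma> \<in> perms" "q < length \<sigma>"
  shows "\<sigma> ! q = length \<sigma> \<longleftrightarrow> (\<forall>k<length \<sigma>. \<sigma> ! k \<le> \<sigma> ! q)"
proof
  have s: "set \<sigma> = {1..length \<sigma>}" using assms(1) by (simp add: perms_def)
  show "\<forall>k<length \<sigma>. \<sigma> ! k \<le> \<sigma> ! q" if "\<sigma> ! q = length \<sigma>"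
    using s nth_mem that by fastforce
  assume R: "\<forall>k<length \<sigma>. \<sigma> ! k \<le> \<sigma> ! q"
  have "length \<sigma> \<in> set \<sigma>" using s assms(2) by auto
  then obtain k where "k < length \<sigma>" "\<sigma> ! k = length \<sigma>" by (metis in_set_conv_nth)
  moreover have "\<sigma> ! q \<le> length \<sigma>" using s assms(2) nth_mem by fastforce
  ultimately show "\<sigma> ! q = length \<sigma>" using R by force
qed

text \<open>Adjacent values, the least and the greatest one are recognised from the order alone, so the
  iterator may be replaced by any model of its copies.\<close>

lemma shrinking_iff_shrinks:
  assumes "\<delta> \<in> perms" "length \<delta> = n"
    and "\<And>i j. i < n \<Longrightarrow> j < n \<Longrightarrow> \<delta> ! i < \<delta> ! j \<longleftrightarrow> H 0 i < H 0 j"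
    and "\<And>i j. i < n \<Longrightarrow> j < n \<Longrightarrow> x\<^sub>1 ! i < x\<^sub>2 ! j \<longleftrightarrow> H 0 i < H 1 j"
    and "\<And>i j. i < n \<Longrightarrow> j < n \<Longrightarrow> x\<^sub>2 ! i < x\<^sub>1 ! j \<longleftrightarrow> H 1 i < H 0 j"
    and "\<And>i j. i < n \<Longrightarrow> j < n \<Longrightarrow> x\<^sub>2 ! i < x\<^sub>2 ! j \<longleftrightarrow> H 1 i < H 1 j"
  shows "shrinking \<delta> x\<^sub>1 x\<^sub>2 g \<longleftrightarrow> shrinks H n g"
proof -
  have le: "\<delta> ! i \<le> \<delta> ! j \<longleftrightarrow> H 0 i \<le> H 0 j" if "i < n" "j < n" for i j
    using assms(3)[OF that(2,1)] by linarith
  show ?thesis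
  proof (cases g)
    case (Inner i j)
    then show ?thesis
      using perms_succ_iff[OF assms(1), of i j] assms by (auto cong: conj_cong)
  next
    case (Below q)
    then show ?thesis using perms_min_iff[OF assms(1), of q] assms le by (auto cong: conj_cong)
  next
    case (Above q)
    then show ?thesis using perms_max_iff[OF assms(1), of q] assms le by (auto cong: conj_cong)
  qed
qed

lemma lies_in_iff_encloses:
  assumes "shrinks H n g" "\<And>i. i < n \<Longrightarrow> (x ! i < p \<longleftrightarrow> H 0 i < p') \<and> (p < x ! i \<longleftrightarrow> p' < H 0 i)"
  shows "lies_in p x g \<longleftrightarrow> encloses H 0 g p'"
  using assms by (cases g) auto

text \<open>Rigidity of the cycles is the form in which the absence of ambiguous cycles is used.\<close>

locale rigid_bicycle = finitely_based C b + bicycle_with_parts B I P T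
  for C b and B :: "nat list pair_pre_digraph" and I P T +
  assumes sub: "subgraph (with_proj B) (with_proj (factor_graph b C))" and rigid: rigid_cycles
begin

abbreviation nI where "nI \<equiv> length (augmented b I)"
abbreviation nT where "nT \<equiv> length (augmented b T)"
abbreviation s where "s \<equiv> int b + int (length P) - 1"
abbreviation c where "c \<equiv> max nI nT"

text \<open>In a model, the entries of \<open>\<beta>\<close> occupy the positions from \<open>0\<close> to \<open>s - 1\<close>, so the copies of
  \<open>\<alpha>\<close> end at \<open>-1\<close> and those of \<open>\<gamma>\<close> start at \<open>s\<close>.  The first window in the terminal cycle
  is at \<open>e\<close>, and the last one in the initial cycle at \<open>0\<close>.\<close>

definition initial_blocks :: "(int \<Rightarrow> int) \<Rightarrow> nat \<Rightarrow> nat \<Rightarrow> int" where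
  "initial_blocks h t i = h (- int nI + int t * - int nI + int i)"

definition terminal_blocks :: "(int \<Rightarrow> int) \<Rightarrow> nat \<Rightarrow> nat \<Rightarrow> int" where
  "terminal_blocks h t i = h (s + int t * int nT + int i)"

lemma s_eq: "s = e + int b" by simp

lemma s_ge: "s \<ge> int b" using s_eq e_nonneg by linarith

lemma I_cycle: "I \<noteq> [] \<Longrightarrow> graph_cycle G I" and T_cycle: "T \<noteq> [] \<Longrightarrow> graph_cycle G T"
  using simple_cycle_closed_up_iff[of I B] simple_cycle_closed_up_iff[of T B] parts sub
  unfolding bicycle_parts_def graph_cycle_def subgraph_def by auto

lemma rigid_I: "I \<noteq> [] \<Longrightarrow> hi - lo \<ge> int b \<Longrightarrow> rigid b (cyc I r) lo hi"
  and rigid_T: "T \<noteq> [] \<Longrightarrow> hi - lo \<ge> int b \<Longrightarrow> rigid b (cyc T r) lo hi"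
  using rigid I_cycle T_cycle unfolding rigid_cycles_def by blast+

lemma realises_initial:
  assumes "I \<noteq> []" "hi \<le> int b"
  shows "realises b u h lo hi \<longleftrightarrow> realises b (cyc I 0) h lo hi"
  by (rule realises_cong) (use walk_initial assms in auto)

lemma realises_terminal:
  assumes "T \<noteq> []" "e \<le> lo"
  shows "realises b u h lo hi \<longleftrightarrow> realises b (cyc T e) h lo hi"
  by (rule realises_cong) (use walk_terminal assms in auto)

lemma window_in_paths_G:
  "in_span I P T lo (lo + int N) \<Longrightarrow> N \<ge> 1 \<Longrightarrow> window u lo N \<in> paths G"
  using walk_window_in_paths in_paths_mono sub by blast

lemma balanced_path_window:
  "balanced_path b I P T m = window u (- int (m * nI)) (m * nI + length P + m * nT)"
proof (rule nth_equalityI)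
  show len: "length (balanced_path b I P T m) = length (window u (- int (m * nI)) (m * nI + length P + m * nT))"
    by (simp add: balanced_path_def length_concat_replicate)
  fix i assume "i < length (balanced_path b I P T m)"
  then have i: "i < m * nI + length P + m * nT" using len by simp
  have l: "length (concat (replicate m (augmented b I))) = m * nI" by (simp add: length_concat_replicate)
  consider "i < m * nI" | "m * nI \<le> i" "i < m * nI + length P" | "m * nI + length P \<le> i" by linarith
  then have "balanced_path b I P T m ! i = u (- int (m * nI) + int i)"
  proof cases
    case 1
    then have Ine: "I \<noteq> []" by auto
    have neg: "- int (m * nI) + int i \<le> 0" using 1 by linarith
    have "balanced_path b I P T m ! i = cyc I 0 (int i)"
      using 1 nth_concat_replicate_augmented[OF Ine 1] by (simp add: balanced_path_def nth_append l)
    also have "\<dots> = cyc I 0 (int i + int nI * - int m)" by (rule cyc_period_augmented[symmetric])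
    also have "int i + int nI * - int m = - int (m * nI) + int i" by simp
    finally show ?thesis using walk_initial[OF Ine neg] by simp
  next
    case 2
    then have "i - m * nI < length P" by linarith
    then have "balanced_path b I P T m ! i = P ! (i - m * nI)"
      using 2 by (simp add: balanced_path_def nth_append l)
    moreover have "- int (m * nI) + int i = int (i - m * nI)" using 2 by (simp add: of_nat_diff)
    moreover have "u (int (i - m * nI)) = P ! (i - m * nI)"
      using walk_P[of "int (i - m * nI)"] \<open>i - m * nI < length P\<close> by simp
    ultimately show ?thesis by metis
  next
    case 3
    define k where "k = i - m * nI - length P"
    have k: "k < m * nT" "- int (m * nI) + int i = e + (int k + 1)" using 3 i by (auto simp: k_def)
    then have Tne: "T \<noteq> []" by auto
    have "\<not> i - m * nI < length P" "\<not> i < m * nI" using 3 by linarith+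
    then have "balanced_path b I P T m ! i = cyc T 0 (int k + 1)"
      using nth_concat_replicate_rotate1_augmented[OF Tne k(1)] by (simp add: balanced_path_def nth_append l k_def)
    also have "\<dots> = cyc T e (e + (int k + 1))" by (simp add: cyc_def)
    finally show ?thesis using walk_terminal[OF Tne, of "e + (int k + 1)"] k by simp
  qed
  then show "balanced_path b I P T m ! i = window u (- int (m * nI)) (m * nI + length P + m * nT) ! i"
    using i by simp
qed

lemma balanced_size: "int (m * nI + length P + m * nT + b - 1) = int (m * nI) + s + int (m * nT)"
  using P b_pos by (cases P) auto

text \<open>Every copy of an iterator, wherever it occurs in a model, has the same pattern, since the
  windows in a cycle determine it.\<close>

lemma terminal_iterator_pattern:
  assumes "T \<noteq> []" "realises b u h lo hi" "lo \<le> s + int t * int nT" "s + int t * int nT + int nT \<le> hi"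
  shows "pattern h (s + int t * int nT) nT = terminal_iterator b T"
proof -
  have n: "b \<le> nT" using le_length_augmented[OF assms(1)] .
  define N where "N = nT - b + 1"
  define o' where "o' = s + int t * int nT"
  have N: "N \<ge> 1" "N + b - 1 = nT" using n by (auto simp: N_def)
  have "drop b (closed_up (augmented b T)) = window (cyc T e) o' N"
  proof (rule nth_equalityI)
    have ne: "augmented b T \<noteq> []" using n b_pos by auto
    then show len: "length (drop b (closed_up (augmented b T))) = length (window (cyc T e) o' N)"
      using n by (simp add: closed_up_def N_def)
    fix i assume "i < length (drop b (closed_up (augmented b T)))"
    then have i: "i < N" using len by simp
    have "closed_up (augmented b T) ! (b + i) = cyc T 0 (int (b + i))"
    proof (cases "b + i < nT")
      case True
      then show ?thesis using nth_augmented[OF assms(1)] ne by (simp add: closed_up_def nth_append)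
    next
      case False
      then have bi: "b + i = nT" using i n by (simp add: N_def)
      then have "closed_up (augmented b T) ! (b + i) = cyc T 0 0"
        using nth_augmented[OF assms(1), of 0] ne by (simp add: closed_up_def hd_conv_nth nth_append)
      also have "\<dots> = cyc T 0 (0 + int nT * 1)" by (rule cyc_period_augmented[symmetric])
      finally show ?thesis using bi by simp
    qed
    also have "\<dots> = cyc T 0 (int (b + i) + int nT * int t)" by (rule cyc_period_augmented[symmetric])
    also have "\<dots> = cyc T e (o' + int i)"
      using s_eq by (simp add: cyc_def o'_def algebra_simps)
    finally have "closed_up (augmented b T) ! (b + i) = cyc T e (o' + int i)" .
    moreover have "b \<le> length (closed_up (augmented b T))" using n ne by (simp add: closed_up_def)
    ultimately show "drop b (closed_up (augmented b T)) ! i = window (cyc T e) o' N ! i"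
      using i by (simp add: nth_drop)
  qed
  then have it: "terminal_iterator b T = perm_of b (window (cyc T e) o' N)"
    using assms(1) by (simp add: terminal_iterator_def)
  have "0 \<le> int t * int nT" by simp
  then have "e \<le> o'" using s_eq unfolding o'_def by linarith
  moreover have "realises b u h o' (o' + int nT)"
    by (rule realises_subset[OF assms(2)]) (use assms in \<open>auto simp: o'_def\<close>)
  ultimately have "realises b (cyc T e) h o' (o' + int (N + b - 1))"
    using realises_terminal[OF assms(1)] N by simp
  from perm_of_window(2)[OF N(1) _ this] rigid_T[OF assms(1)] n N
  show ?thesis unfolding it o'_def by simp
qed

lemma initial_iterator_pattern:
  assumes "I \<noteq> []" "realises b u h lo hi" "lo \<le> - int nI + int t * - int nI" "int t * - int nI \<le> hi"
  shows "pattern h (- int nI + int t * - int nI) nI = initial_iterator b I"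
proof -
  have n: "b \<le> nI" using le_length_augmented[OF assms(1)] .
  define N where "N = nI - b + 1"
  define o' where "o' = - int nI + int t * - int nI"
  have N: "N \<ge> 1" "N + b - 1 = nI" using n by (auto simp: N_def)
  have "take N (augmented b I) = window (cyc I 0) o' N"
  proof (rule nth_equalityI)
    show len: "length (take N (augmented b I)) = length (window (cyc I 0) o' N)"
      using n b_pos by (simp add: N_def)
    fix i assume "i < length (take N (augmented b I))"
    then have i: "i < N" using len by simp
    then have "augmented b I ! i = cyc I 0 (int i)"
      using nth_augmented[OF assms(1)] n b_pos by (simp add: N_def)
    also have "\<dots> = cyc I 0 (int i + int nI * - (int t + 1))" by (rule cyc_period_augmented[symmetric])
    also have "int i + int nI * - (int t + 1) = o' + int i" by (simp add: o'_def algebra_simps)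
    finally show "take N (augmented b I) ! i = window (cyc I 0) o' N ! i" using i by simp
  qed
  then have it: "initial_iterator b I = perm_of b (window (cyc I 0) o' N)"
    using assms(1) by (simp add: initial_iterator_def N_def)
  have "o' + int nI = - (int t * int nI)" by (simp add: o'_def)
  moreover have "0 \<le> int t * int nI" by simp
  ultimately have "o' + int nI \<le> int b" by linarith
  moreover have "realises b u h o' (o' + int nI)"
    by (rule realises_subset[OF assms(2)]) (use assms in \<open>auto simp: o'_def\<close>)
  ultimately have "realises b (cyc I 0) h o' (o' + int (N + b - 1))"
    using realises_initial[OF assms(1)] N by simp
  from perm_of_window(2)[OF N(1) _ this] rigid_I[OF assms(1)] n N
  show ?thesis unfolding it o'_def by simp
qed

lemma length_iterators:
  "length (initial_iterator b I) = nI" "length (terminal_iterator b T) = nT"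
proof -
  show "length (initial_iterator b I) = nI"
  proof (cases "I = []")
    case False
    have "(0::int) - - int nI \<ge> int b" using le_length_augmented[OF False, of b] by simp
    then obtain h where "realises b (cyc I 0) h (- int nI) 0"
      using realises_exists[OF b_pos cycle_chain[OF I_cycle[OF False]]] by blast
    then have h: "realises b u h (- int nI) 0" using realises_initial[OF False] by simp
    have "pattern h (- int nI) nI = initial_iterator b I"
      using initial_iterator_pattern[OF False h, of 0] by simp
    then show ?thesis using length_pattern[of h "- int nI" nI] realisesD(1)[OF h] by simp
  qed (simp add: initial_iterator_def)
  show "length (terminal_iterator b T) = nT"
  proof (cases "T = []")
    case False
    have "s + int nT - s \<ge> int b" using le_length_augmented[OF False, of b] by simp
    then obtain h where "realises b (cyc T e) h s (s + int nT)"
      using realises_exists[OF b_pos cycle_chain[OF T_cycle[OF False]]] by blast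
    moreover have "e \<le> s" by simp
    ultimately have h: "realises b u h s (s + int nT)" using realises_terminal[OF False] by blast
    have "pattern h s nT = terminal_iterator b T"
      using terminal_iterator_pattern[OF False h, of 0] by simp
    then show ?thesis using length_pattern[of h s nT] realisesD(1)[OF h] by simp
  qed (simp add: terminal_iterator_def)
qed

lemma core_eq: "core b I P T as \<beta> gs \<longleftrightarrow> balanced b I P T c as \<beta> gs"
  unfolding core_def length_iterators ..

text \<open>Cores are lists of lists, whereas shrinking pairs are handled in models.  To test splittability
  in models, each core has to be turned into a model, and conversely.\<close>

lemma model_of_core:
  assumes "core b I P T as \<beta> gs"
  shows "\<exists>h. realises b u h (- int (c * nI)) (s + int (c * nT)) \<and>
    (\<forall>p\<in>set (concat (rev as) @ \<beta>). \<exists>x\<in>{- int (c * nI)..<s}. h x = int p) \<and>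
    (\<forall>p\<in>set (\<beta> @ concat gs). \<exists>x\<in>{0..<s + int (c * nT)}. h x = int p) \<and>
    (\<forall>i<nT. int (hd gs ! i) = terminal_blocks h 0 i) \<and>
    (\<forall>i<nI. int (hd as ! i) = initial_blocks h 0 i)"
proof -
  define L where "L = concat (rev as) @ \<beta> @ concat gs"
  define N where "N = c * nI + length P + c * nT"
  define lo where "lo = - int (c * nI)"
  have bal: "L \<in> perms_of b (window u lo N)"
    "length as = (if I = [] then 0 else c)" "\<forall>\<alpha>\<in>set as. standardize \<alpha> = initial_iterator b I"
    "length gs = (if T = [] then 0 else c)" "\<forall>\<gamma>\<in>set gs. standardize \<gamma> = terminal_iterator b T"
    "length \<beta> = b + (length P - 1)"
    using assms unfolding core_eq balanced_def balanced_path_window L_def N_def lo_def by auto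
  have N: "N \<ge> 1" "lo + int (N + b - 1) = s + int (c * nT)"
    using P balanced_size[of c] unfolding N_def lo_def by (auto simp: Suc_le_eq)
  obtain h where h: "h = model_of L lo" "length L = N + b - 1" "realises b u h lo (s + int (c * nT))"
    using perms_of_windowE[OF bal(1) N(1)] N(2) by metis
  have "distinct L" using bal(1) by (simp add: perms_of_def perms_def)
  then have dist: "distinct \<alpha>" if "\<alpha> \<in> set as \<union> set gs" for \<alpha>
    using that unfolding L_def by (auto simp: distinct_concat_iff)
  have las: "length (concat (rev as)) = c * nI"
  proof -
    have "length \<alpha> = nI" if "\<alpha> \<in> set (rev as)" for \<alpha>
      using length_standardize[OF dist, of \<alpha>] bal(3) length_iterators that by simp
    from length_concat_const[of "rev as", OF this] show ?thesis using bal(2) by auto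
  qed
  have nth_right: "L ! (c * nI + k) = (\<beta> @ concat gs) ! k" for k
    unfolding L_def by (metis las nth_append_length_plus)
  have lgs: "length \<gamma> = nT" if "\<gamma> \<in> set gs" for \<gamma>
    using length_standardize[OF dist, of \<gamma>] bal(5) length_iterators that by simp
  have l\<beta>: "int (length \<beta>) = s" using bal(6) P b_pos by (cases P) auto
  have hL: "h x = int (L ! nat (x - lo))" for x by (simp add: h(1) model_of_def)
  have idx: "\<exists>k. p = L ! k \<and> k < length (concat (rev as)) + length \<beta>" if "p \<in> set (concat (rev as) @ \<beta>)" for p
  proof -
    obtain k where "k < length (concat (rev as) @ \<beta>)" "(concat (rev as) @ \<beta>) ! k = p"
      using \<open>p \<in> set (concat (rev as) @ \<beta>)\<close> unfolding in_set_conv_nth by blast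
    moreover from this have "L ! k = p"
      unfolding L_def append_assoc[symmetric] by (simp only: nth_append_left)
    ultimately show ?thesis by (metis length_append)
  qed
  show ?thesis
  proof (intro exI[of _ h] conjI ballI allI impI)
    show "realises b u h (- int (c * nI)) (s + int (c * nT))" using h(3) unfolding lo_def .
    show "\<exists>x\<in>{- int (c * nI)..<s}. h x = int p" if p: "p \<in> set (concat (rev as) @ \<beta>)" for p
    proof -
      obtain k where k: "p = L ! k" "k < length (concat (rev as)) + length \<beta>" using idx[OF p] by blast
      have "int k < int (c * nI) + s" using k(2) las l\<beta> by linarith
      then show ?thesis using k(1) by (intro bexI[of _ "lo + int k"]) (auto simp: hL lo_def)
    qed
    show "\<exists>x\<in>{0..<s + int (c * nT)}. h x = int p" if p: "p \<in> set (\<beta> @ concat gs)" for p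
    proof -
      obtain k where k: "k < length (\<beta> @ concat gs)" "(\<beta> @ concat gs) ! k = p"
        using p unfolding in_set_conv_nth by blast
      then have "L ! (c * nI + k) = p" using nth_right by simp
      moreover have "int (c * nI + k) < int (length L)" using k(1) las unfolding L_def by simp
      then have "int k < s + int (c * nT)" using h(2) N(2) unfolding lo_def by simp
      moreover have "int k - lo = int (c * nI + k)" by (simp add: lo_def)
      then have "h (int k) = int (L ! (c * nI + k))" unfolding hL by (metis nat_int)
      ultimately show ?thesis by (intro bexI[of _ "int k"]) auto
    qed
    show "int (hd gs ! i) = terminal_blocks h 0 i" if i: "i < nT" for i
    proof -
      have "T \<noteq> []" using i by auto
      then have "gs \<noteq> []" using bal(4) le_length_augmented[of T b] b_pos by auto
      then obtain \<gamma> gs' where gs: "gs = \<gamma> # gs'" by (cases gs) auto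
      have "L ! (c * nI + (length \<beta> + i)) = \<gamma> ! i"
        unfolding nth_right gs using lgs[of \<gamma>] i gs by (simp add: nth_append)
      moreover have "s + int i - lo = int (c * nI + (length \<beta> + i))" using l\<beta> by (simp add: lo_def)
      then have "nat (s + int i - lo) = c * nI + (length \<beta> + i)" by (metis nat_int)
      ultimately show ?thesis unfolding terminal_blocks_def by (simp add: hL gs)
    qed
    show "int (hd as ! i) = initial_blocks h 0 i" if i: "i < nI" for i
    proof -
      have "I \<noteq> []" using i by auto
      then have "as \<noteq> []" using bal(2) le_length_augmented[of I b] b_pos by auto
      then obtain \<alpha> as' where as: "as = \<alpha> # as'" by (cases as) auto
      have "length \<alpha> = nI" using length_standardize[OF dist, of \<alpha>] bal(3) length_iterators as by simp
      moreover have la: "length (concat (rev as')) + nI = c * nI" using las \<open>length \<alpha> = nI\<close> as by simp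
      ultimately have "L ! (length (concat (rev as')) + i) = \<alpha> ! i"
        unfolding L_def as using i by (simp add: nth_append)
      moreover have "- int nI + int i - lo = int (length (concat (rev as')) + i)"
        using arg_cong[OF la, of int] by (simp add: lo_def)
      then have "nat (- int nI + int i - lo) = length (concat (rev as')) + i" by (metis nat_int)
      ultimately show ?thesis unfolding initial_blocks_def by (simp add: hL as)
    qed
  qed
qed

lemma core_of_model:
  assumes h: "realises b u h (- int (c * nI)) (s + int (c * nT))"
  shows "\<exists>as \<beta> gs val. core b I P T as \<beta> gs \<and>
    (\<forall>x\<in>{- int (c * nI)..<s + int (c * nT)}. \<forall>y\<in>{- int (c * nI)..<s + int (c * nT)}.
      val x < val y \<longleftrightarrow> h x < h y) \<and>
    (\<forall>x\<in>{- int (c * nI)..<s}. val x \<in> set (concat (rev as) @ \<beta>)) \<and>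
    (\<forall>x\<in>{0..<s + int (c * nT)}. val x \<in> set (\<beta> @ concat gs)) \<and>
    (\<forall>i<nT. hd gs ! i = val (s + int i)) \<and> (\<forall>i<nI. hd as ! i = val (- int nI + int i))"
proof -
  define N where "N = c * nI + length P + c * nT"
  define lo where "lo = - int (c * nI)"
  define sN where "sN = b + length P - 1"
  have N: "N \<ge> 1" "lo + int (N + b - 1) = s + int (c * nT)"
    using P balanced_size[of c] unfolding N_def lo_def by (auto simp: Suc_le_eq)
  have len: "N + b - 1 = c * nI + sN + c * nT" using P b_pos unfolding N_def sN_def by (cases P) auto
  have sN: "int sN = s" using P b_pos by (cases P) (auto simp: sN_def)
  define L where "L = pattern h lo (N + b - 1)"
  have h': "realises b u h lo (lo + int (N + b - 1))" using h N(2) by (simp add: lo_def)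
  note inj = realisesD(1)[OF h']
  have L: "L \<in> perms_of b (window u lo N)"
    unfolding L_def using pattern_in_perms_of_iff[OF inj N(1)] h' by simp
  have lL: "length L = c * nI + sN + c * nT" using length_pattern[OF inj] len by (simp add: L_def)
  define as where "as = (if I = [] then [] else rev (map (\<lambda>t. take nI (drop (t * nI) L)) [0..<c]))"
  define \<beta> where "\<beta> = take sN (drop (c * nI) L)"
  define gs where "gs = (if T = [] then [] else map (\<lambda>t. take nT (drop (t * nT) (drop (c * nI + sN) L))) [0..<c])"
  define val where "val x = L ! nat (x - lo)" for x
  have cas: "concat (rev as) = take (c * nI) L" using concat_slices by (auto simp: as_def)
  have cgs: "concat gs = drop (c * nI + sN) L"
  proof (cases "T = []")
    case False
    then have "gs = map (\<lambda>t. take nT (drop (t * nT) (drop (c * nI + sN) L))) [0..<c]"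
      by (simp add: gs_def)
    then have "concat gs = take (c * nT) (drop (c * nI + sN) L)" by (simp only: concat_slices)
    then show ?thesis using lL by simp
  qed (simp add: gs_def lL)
  have whole: "concat (rev as) @ \<beta> @ concat gs = L"
    unfolding cas cgs \<beta>_def by (metis append_take_drop_id drop_drop add.commute)
  have "balanced b I P T c as \<beta> gs"
    unfolding balanced_def balanced_path_window whole
  proof (intro conjI ballI)
    show "L \<in> perms_of b (window u (- int (c * nI)) (c * nI + length P + c * nT))"
      using L by (simp add: lo_def N_def)
    show "standardize \<alpha> = initial_iterator b I" if \<alpha>: "\<alpha> \<in> set as" for \<alpha>
    proof -
      have Ine: "I \<noteq> []" using \<alpha> by (auto simp: as_def)
      obtain t where t: "t < c" "\<alpha> = take nI (drop (t * nI) L)"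
        using \<alpha> Ine unfolding as_def by auto
      have tn: "Suc t * nI \<le> c * nI" using t(1) by (intro mult_le_mono1) simp
      have "standardize \<alpha> = pattern h (lo + int (t * nI)) nI"
        unfolding t(2) L_def by (rule pattern_window[OF inj]) (use tn len in simp)
      also have "lo + int (t * nI) = - int nI + int (c - Suc t) * - int nI"
        using t(1) by (simp add: lo_def of_nat_diff algebra_simps)
      also have "pattern h \<dots> nI = initial_iterator b I"
      proof (rule initial_iterator_pattern[OF Ine h])
        have "int nI + int (c - Suc t) * int nI = int (Suc (c - Suc t) * nI)" by simp
        also have "\<dots> \<le> int (c * nI)" using t(1) by (intro of_nat_mono mult_le_mono1) simp
        finally show "- int (c * nI) \<le> - int nI + int (c - Suc t) * - int nI" by simp
        have "0 \<le> int (c - Suc t) * int nI" "0 \<le> int (c * nT)" by simp_all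
        moreover have "0 \<le> s" using s_ge by linarith
        moreover have "int (c - Suc t) * - int nI = - (int (c - Suc t) * int nI)" by simp
        ultimately show "int (c - Suc t) * - int nI \<le> s + int (c * nT)" by linarith
      qed
      finally show ?thesis .
    qed
    show "standardize \<gamma> = terminal_iterator b T" if \<gamma>: "\<gamma> \<in> set gs" for \<gamma>
    proof -
      have Tne: "T \<noteq> []" using \<gamma> by (auto simp: gs_def)
      obtain t where t: "t < c" "\<gamma> = take nT (drop (t * nT) (drop (c * nI + sN) L))"
        using \<gamma> Tne unfolding gs_def by auto
      have tn: "Suc t * nT \<le> c * nT" using t(1) by (intro mult_le_mono1) simp
      have "standardize \<gamma> = standardize (take nT (drop (c * nI + sN + t * nT) L))"
        unfolding t(2) by (simp add: add.commute)
      also have "\<dots> = pattern h (lo + int (c * nI + sN + t * nT)) nT"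
        unfolding L_def by (rule pattern_window[OF inj]) (use tn len in simp)
      also have "lo + int (c * nI + sN + t * nT) = s + int t * int nT"
        by (simp add: lo_def flip: sN)
      also have "pattern h \<dots> nT = terminal_iterator b T"
      proof (rule terminal_iterator_pattern[OF Tne h])
        have "int t * int nT + int nT = int (Suc t * nT)" by simp
        also have "\<dots> \<le> int (c * nT)" using tn by (rule of_nat_mono)
        finally show "s + int t * int nT + int nT \<le> s + int (c * nT)" by simp
        have "0 \<le> int t * int nT" "0 \<le> int (c * nI)" by simp_all
        moreover have "0 \<le> s" using s_ge by linarith
        ultimately show "- int (c * nI) \<le> s + int t * int nT" by linarith
      qed
      finally show ?thesis .
    qed
    show "length \<beta> = b + vwalk_length P" using lL P by (cases P) (auto simp: \<beta>_def sN_def)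
  qed (auto simp: as_def gs_def)
  then have core: "core b I P T as \<beta> gs" by (simp add: core_eq)
  have order: "val x < val y \<longleftrightarrow> h x < h y"
    if "x \<in> {lo..<s + int (c * nT)}" "y \<in> {lo..<s + int (c * nT)}" for x y
  proof -
    have "nat (x - lo) < N + b - 1" "nat (y - lo) < N + b - 1" using that N(2) by auto
    from pattern_less_iff[OF inj this] show ?thesis using that by (simp add: val_def L_def)
  qed
  have left: "val x \<in> set (concat (rev as) @ \<beta>)" if "x \<in> {lo..<s}" for x
  proof -
    have "concat (rev as) @ \<beta> = take (c * nI + sN) L"
      unfolding cas \<beta>_def by (simp add: take_add)
    moreover have k: "nat (x - lo) < c * nI + sN" using that by (simp add: lo_def nat_less_iff flip: sN)
    then have "take (c * nI + sN) L ! nat (x - lo) = val x" by (simp add: val_def)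
    moreover have "nat (x - lo) < length (take (c * nI + sN) L)" using k lL by simp
    ultimately show ?thesis by (metis nth_mem)
  qed
  have right: "val x \<in> set (\<beta> @ concat gs)" if "x \<in> {0..<s + int (c * nT)}" for x
  proof -
    have "\<beta> @ concat gs = drop (c * nI) L"
      unfolding cgs \<beta>_def by (metis append_take_drop_id drop_drop add.commute)
    moreover have k: "nat x < length (drop (c * nI) L)" using that lL by (simp add: nat_less_iff flip: sN)
    moreover have "x - lo = int (c * nI + nat x)" using that by (simp add: lo_def)
    then have "nat (x - lo) = c * nI + nat x" by (metis nat_int)
    then have "drop (c * nI) L ! nat x = val x" using k by (simp add: val_def)
    ultimately show ?thesis by (metis nth_mem)
  qed
  have hdg: "hd gs ! i = val (s + int i)" if i: "i < nT" for i
  proof -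
    have Tne: "T \<noteq> []" using i by auto
    have c0: "c > 0" using i by auto
    have "length gs = c" using Tne by (simp add: gs_def)
    then have "gs \<noteq> []" using c0 by (metis length_0_conv less_irrefl)
    then have "hd gs = gs ! 0" by (simp add: hd_conv_nth)
    also have "gs ! 0 = take nT (drop (c * nI + sN) L)" using Tne c0 by (simp add: gs_def)
    finally have "hd gs = take nT (drop (c * nI + sN) L)" .
    moreover have "s + int i - lo = int (c * nI + sN + i)" by (simp add: lo_def flip: sN)
    then have "nat (s + int i - lo) = c * nI + sN + i" by (metis nat_int)
    moreover have "nT \<le> c * nT" using c0 by simp
    ultimately show ?thesis using i lL by (simp add: val_def)
  qed
  have hda: "hd as ! i = val (- int nI + int i)" if i: "i < nI" for i
  proof -
    have Ine: "I \<noteq> []" using i by auto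
    obtain c' where c': "c = Suc c'" using i by (cases c) auto
    have "hd as = take nI (drop (c' * nI) L)"
      using Ine unfolding as_def c' by simp
    moreover have "- int nI + int i - lo = int (c' * nI + i)" by (simp add: lo_def c')
    then have "nat (- int nI + int i - lo) = c' * nI + i" by (metis nat_int)
    moreover have "c' * nI + nI \<le> length L" using lL c' by simp
    ultimately show ?thesis using i by (simp add: val_def)
  qed
  show ?thesis
    using core order left right hdg hda unfolding lo_def by (intro exI conjI ballI allI impI)
qed

end

context rigid_bicycle
begin

text \<open>Two copies of an iterator in the class of the bicycle lie in the cycle from which the iterator
  stems, as their first and last windows do.  Hence they are unique by rigidity.\<close>

lemma juxtaposition_unique:
  fixes s' :: int
  assumes X: "graph_cycle G X" and n: "n \<ge> b"
    and h: "realises b (cyc X r) h s' (s' + 2 * int n)"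
    and uX: "\<And>z. s' \<le> z \<Longrightarrow> z + int b \<le> s' + 2 * int n \<Longrightarrow> u z = cyc X r z"
    and span: "in_span I P T s' (s' + 2 * int n - int b + 1)"
    and \<delta>: "pattern h s' n = \<delta>" "pattern h (s' + int n) n = \<delta>"
    and key: "\<And>l z. \<lbrakk>in_span I P T l (l + 2 * int n - int b + 1); u l = u s';
        u (l + 2 * int n - int b) = u (s' + 2 * int n - int b); l \<le> z; z \<le> l + 2 * int n - int b\<rbrakk> \<Longrightarrow>
        u z = cyc X r (z + (s' - l))"
  shows "juxtaposition b B \<delta> = (take n (pattern h s' (2 * n)), drop n (pattern h s' (2 * n)))"
proof -
  define N where "N = 2 * n - b + 1"
  have N: "N \<ge> 1" "N + b - 1 = 2 * n" "int N = 2 * int n - int b + 1" using n by (auto simp: N_def)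
  define L where "L = pattern h s' (2 * n)"
  have h2: "realises b (cyc X r) h s' (s' + int (2 * n))" using h by simp
  note inj = realisesD(1)[OF h2]
  have hu: "realises b u h s' (s' + int (2 * n))"
    using h2 realises_cong[of s' b "s' + int (2 * n)" u "cyc X r"] uX by simp
  have lL: "length L = 2 * n" using length_pattern[OF inj] by (simp add: L_def)
  have sub_pat: "standardize (take m (drop k (pattern f l (2 * n)))) = pattern f (l + int k) m"
    if "inj_on f {l..<l + int (2 * n)}" "k + m \<le> 2 * n" for f l k m
    using pattern_window[OF that] .
  have in_class: "L \<in> class_of b B"
  proof -
    have "window u s' N \<in> paths B" using walk_window_in_paths[of s' N] span N by (simp add: algebra_simps)
    moreover have "L \<in> perms_of b (window u s' N)"
      using pattern_in_perms_of_iff[of h s' N b u] inj hu N(1) unfolding N(2) L_def by simp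
    ultimately show ?thesis by (auto simp: class_of_def)
  qed
  have halves: "standardize (take n L) = \<delta>" "standardize (drop n L) = \<delta>"
    using sub_pat[OF inj, of 0 n] sub_pat[OF inj, of n n] \<delta> lL by (auto simp: L_def)
  show ?thesis
    unfolding juxtaposition_def L_def[symmetric]
  proof (rule the_equality)
    show "case (take n L, drop n L) of (x, y) \<Rightarrow> x @ y \<in> class_of b B \<and> standardize x = \<delta> \<and> standardize y = \<delta>"
      using in_class halves by simp
  next
    fix xy :: "nat list \<times> nat list"
    assume a: "case xy of (x, y) \<Rightarrow> x @ y \<in> class_of b B \<and> standardize x = \<delta> \<and> standardize y = \<delta>"
    obtain x y where xy: "xy = (x, y)" by fastforce
    from a obtain \<pi> where \<pi>: "\<pi> \<in> paths B" "x @ y \<in> perms_of b \<pi>"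
      and std: "standardize x = \<delta>" "standardize y = \<delta>" unfolding xy class_of_def by auto
    have "x @ y \<in> perms" using \<pi>(2) by (simp add: perms_of_def)
    then have "distinct x" "distinct y" by (auto simp: perms_def)
    moreover have "length \<delta> = n"
      using \<delta>(1) length_pattern[of h s' n] inj_on_subset[OF inj, of "{s'..<s' + int n}"] by simp
    ultimately have len: "length x = n" "length y = n"
      using std length_standardize by metis+
    obtain l where l: "\<pi> = window u l (length \<pi>)" "in_span I P T l (l + int (length \<pi>))"
      using path_is_window[OF \<pi>(1)] by blast
    define N' where "N' = length \<pi>"
    have win: "\<pi> = window u l N'" using l(1) by (simp add: N'_def)
    have N': "N' \<ge> 1" using \<pi>(1) by (auto simp: in_paths_iff N'_def Suc_le_eq)
    obtain f where f: "length (x @ y) = N' + b - 1" "realises b u f l (l + int (N' + b - 1))"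
      "x @ y = pattern f l (N' + b - 1)"
      using perms_of_windowE[OF \<pi>(2)[unfolded win] N'] by metis
    have N'N: "N' + b - 1 = 2 * n" "N' = N" using f(1) len N N' by auto
    note f = f(2,3)[unfolded N'N(1)]
    note finj = realisesD(1)[OF f(1)]
    have half1: "pattern f l n = \<delta>"
      using sub_pat[OF finj, of 0 n] f(2) len std by (metis add_0_right append_eq_conv_conj drop0 le_add1 mult_2 of_nat_0 add_0)
    have half2: "pattern f (l + int n) n = \<delta>"
      using sub_pat[OF finj, of n n] f(2)[symmetric] len std by simp
    have inj1: "inj_on f {l..<l + int n}" "inj_on f {l + int n..<l + int n + int n}"
      by (rule inj_on_subset[OF finj], simp)+
    have inj2: "inj_on h {s'..<s' + int n}" "inj_on h {s' + int n..<s' + int n + int n}"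
      by (rule inj_on_subset[OF inj], simp)+
    have "pattern f l b = pattern h s' b"
      using pattern_window[OF inj1(1), of 0 b] pattern_window[OF inj2(1), of 0 b] half1 \<delta>(1) n by simp
    then have first: "u l = u s'"
      using realisesD(2)[OF f(1), of l] realisesD(2)[OF hu, of s'] n by simp
    have "pattern f (l + int n + int (n - b)) b = pattern h (s' + int n + int (n - b)) b"
      using pattern_window[OF inj1(2), of "n - b" b] pattern_window[OF inj2(2), of "n - b" b] half2 \<delta>(2) n by simp
    moreover have "z + int n + int (n - b) = z + 2 * int n - int b" for z using n by simp
    ultimately have "pattern f (l + 2 * int n - int b) b = pattern h (s' + 2 * int n - int b) b"
      by (simp only:)
    then have last: "u (l + 2 * int n - int b) = u (s' + 2 * int n - int b)"
      using realisesD(2)[OF f(1), of "l + 2 * int n - int b"] realisesD(2)[OF hu, of "s' + 2 * int n - int b"] n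
      by simp
    have "u z = cyc X r (z + (s' - l))" if "l \<le> z" "z + int b \<le> l + int (2 * n)" for z
    proof (rule key[OF _ first last])
      show "in_span I P T l (l + 2 * int n - int b + 1)"
        using l(2) unfolding N'_def[symmetric] N'N(2) N(3) by (simp add: algebra_simps)
    qed (use that in auto)
    then have "realises b u f l (l + int (2 * n)) \<longleftrightarrow>
        realises b (\<lambda>z. cyc X r (z + (s' - l))) f l (l + int (2 * n))"
      by (rule realises_cong)
    then have "realises b (\<lambda>z. cyc X r (z + (s' - l))) f l (l + int (2 * n))"
      using f(1) by simp
    from realises_shift[OF this, of "l - s'"]
    have "realises b (cyc X r) (\<lambda>z. f (z + (l - s'))) s' (s' + int (2 * n))"
      by (simp add: algebra_simps)
    moreover have "rigid b (cyc X r) s' (s' + int (2 * n))"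
      using rigid X n unfolding rigid_cycles_def by simp
    ultimately have "same_order_on {s'..<s' + int (2 * n)} h (\<lambda>z. f (z + (l - s')))"
      using rigidD h2 by blast
    then have "pattern h s' (2 * n) = pattern f l (2 * n)"
      using pattern_eq_iff[OF inj finj] by simp
    then have "x @ y = L" using f(2) by (simp add: L_def)
    then show "xy = (take n L, drop n L)" using len xy by auto
  qed
qed

lemma terminal_shrinking_iff:
  assumes "T \<noteq> []" "realises b u h lo hi" "lo \<le> s" "s + 2 * int nT \<le> hi"
  shows "(let \<gamma> = terminal_iterator b T; (\<gamma>\<^sub>1, \<gamma>\<^sub>2) = juxtaposition b B \<gamma>
      in shrinking \<gamma> \<gamma>\<^sub>1 \<gamma>\<^sub>2 g) \<longleftrightarrow> shrinks (terminal_blocks h) nT g"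
proof -
  have n: "nT \<ge> b" using le_length_augmented[OF assms(1)] .
  have hu: "realises b u h s (s + 2 * int nT)" using realises_subset[OF assms(2-4)] .
  have h: "realises b (cyc T e) h s (s + 2 * int nT)"
    using hu realises_terminal[OF assms(1), of s] by simp
  have \<gamma>: "pattern h s nT = terminal_iterator b T" "pattern h (s + int nT) nT = terminal_iterator b T"
    using terminal_iterator_pattern[OF assms(1) hu, of 0] terminal_iterator_pattern[OF assms(1) hu, of 1]
    by simp_all
  have jux: "juxtaposition b B (terminal_iterator b T) =
      (take nT (pattern h s (2 * nT)), drop nT (pattern h s (2 * nT)))"
  proof (rule juxtaposition_unique[OF T_cycle[OF assms(1)] n h _ _ \<gamma>])
    show "u z = cyc T e z" if "s \<le> z" for z using walk_terminal[OF assms(1)] that by simp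
    have "0 \<le> s" using s_ge by linarith
    then show "in_span I P T s (s + 2 * int nT - int b + 1)" using assms(1) by (simp add: in_span_def)
    fix l z assume l: "in_span I P T l (l + 2 * int nT - int b + 1)" "u l = u s" "l \<le> z"
    have "u s \<in> set T" using walk_in_T_iff[OF assms(1), of s] \<open>0 \<le> s\<close> by simp
    then have el: "e \<le> l" using walk_in_T_iff[OF assms(1), of l] l by (simp add: in_span_def)
    then have "cyc T e l = cyc T e s" using l(2) walk_terminal[OF assms(1), of l] walk_terminal[OF assms(1), of s] by simp
    then have "int (length T) dvd l - s" using cyc_eq_iff[OF T[OF assms(1)] assms(1)] by blast
    moreover have "z - (z + (s - l)) = l - s" by simp
    ultimately have "cyc T e z = cyc T e (z + (s - l))"
      unfolding cyc_eq_iff[OF T[OF assms(1)] assms(1)] by (simp only:)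
    then show "u z = cyc T e (z + (s - l))" using walk_terminal[OF assms(1), of z] el l(3) by simp
  qed
  define L where "L = pattern h s (2 * nT)"
  have inj: "inj_on h {s..<s + int (2 * nT)}" using realisesD(1)[OF h] by simp
  have lL: "length L = 2 * nT" using length_pattern[OF inj] by (simp add: L_def)
  have less: "L ! i < L ! j \<longleftrightarrow> h (s + int i) < h (s + int j)" if "i < 2 * nT" "j < 2 * nT" for i j
    using pattern_less_iff[OF inj that] by (simp add: L_def)
  have inj1: "inj_on h {s..<s + int nT}" by (rule inj_on_subset[OF inj]) simp
  have "shrinking (terminal_iterator b T) (take nT L) (drop nT L) g \<longleftrightarrow> shrinks (terminal_blocks h) nT g"
  proof (rule shrinking_iff_shrinks)
    show "terminal_iterator b T \<in> perms" using pattern_perms[OF inj1] \<gamma>(1) by simp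
    show "length (terminal_iterator b T) = nT" by (rule length_iterators)
    show "terminal_iterator b T ! i < terminal_iterator b T ! j \<longleftrightarrow> terminal_blocks h 0 i < terminal_blocks h 0 j"
      if "i < nT" "j < nT" for i j
      using pattern_less_iff[OF inj1 that] \<gamma>(1) by (simp add: terminal_blocks_def)
  qed (use less lL in \<open>auto simp: terminal_blocks_def algebra_simps\<close>)
  then show ?thesis by (simp add: jux L_def)
qed

lemma initial_shrinking_iff:
  assumes "I \<noteq> []" "realises b u h lo hi" "lo \<le> - 2 * int nI" "0 \<le> hi"
  shows "(let \<alpha> = initial_iterator b I; (\<alpha>\<^sub>2, \<alpha>\<^sub>1) = juxtaposition b B \<alpha>
      in shrinking \<alpha> \<alpha>\<^sub>1 \<alpha>\<^sub>2 g) \<longleftrightarrow> shrinks (initial_blocks h) nI g"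
proof -
  define s' where "s' = - 2 * int nI"
  have n: "nI \<ge> b" using le_length_augmented[OF assms(1)] .
  have hu: "realises b u h s' (s' + 2 * int nI)"
    by (rule realises_subset[OF assms(2)]) (use assms in \<open>auto simp: s'_def\<close>)
  have h: "realises b (cyc I 0) h s' (s' + 2 * int nI)"
    using hu realises_initial[OF assms(1), of "s' + 2 * int nI"] by (simp add: s'_def)
  have \<alpha>: "pattern h s' nI = initial_iterator b I" "pattern h (s' + int nI) nI = initial_iterator b I"
    using initial_iterator_pattern[OF assms(1) hu, of 1] initial_iterator_pattern[OF assms(1) hu, of 0]
    by (simp_all add: s'_def)
  have jux: "juxtaposition b B (initial_iterator b I) =
      (take nI (pattern h s' (2 * nI)), drop nI (pattern h s' (2 * nI)))"
  proof (rule juxtaposition_unique[OF I_cycle[OF assms(1)] n h _ _ \<alpha>])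
    show "u z = cyc I 0 z" if "z + int b \<le> s' + 2 * int nI" for z
      using walk_initial[OF assms(1)] that by (simp add: s'_def)
    show "in_span I P T s' (s' + 2 * int nI - int b + 1)"
      using assms(1) b_ge_2 by (simp add: in_span_def s'_def)
    fix l z
    define l' where "l' = l + 2 * int nI - int b"
    define s'' where "s'' = s' + 2 * int nI - int b"
    assume l: "in_span I P T l (l + 2 * int nI - int b + 1)"
      "u (l + 2 * int nI - int b) = u (s' + 2 * int nI - int b)" "z \<le> l + 2 * int nI - int b"
    have s''0: "s'' \<le> 0" by (simp add: s''_def s'_def)
    have "u s'' \<in> set I" using walk_in_I_iff[OF assms(1), of s''] s''0 e_nonneg by linarith
    moreover have "u l' = u s''" using l(2) by (simp add: l'_def s''_def)
    moreover have "T = [] \<longrightarrow> l' \<le> e" using l(1) unfolding in_span_def l'_def by linarith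
    ultimately have l'0: "l' \<le> 0" using walk_in_I_iff[OF assms(1), of l'] by simp
    then have "cyc I 0 l' = cyc I 0 s''"
      using \<open>u l' = u s''\<close> walk_initial[OF assms(1), of l'] walk_initial[OF assms(1), of s''] s''0 by simp
    then have "int (length I) dvd l' - s''" using cyc_eq_iff[OF I[OF assms(1)] assms(1)] by blast
    then have "cyc I 0 z = cyc I 0 (z + (s' - l))"
      using cyc_eq_iff[OF I[OF assms(1)] assms(1), of 0 z "z + (s' - l)"] by (simp add: l'_def s''_def)
    then show "u z = cyc I 0 (z + (s' - l))" using walk_initial[OF assms(1), of z] l'0 l(3) by (simp add: l'_def)
  qed
  define L where "L = pattern h s' (2 * nI)"
  have inj: "inj_on h {s'..<s' + int (2 * nI)}" using realisesD(1)[OF h] by simp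
  have lL: "length L = 2 * nI" using length_pattern[OF inj] by (simp add: L_def)
  have less: "L ! i < L ! j \<longleftrightarrow> h (s' + int i) < h (s' + int j)" if "i < 2 * nI" "j < 2 * nI" for i j
    using pattern_less_iff[OF inj that] by (simp add: L_def)
  have inj1: "inj_on h {s'..<s' + int nI}" "inj_on h {s' + int nI..<s' + int nI + int nI}"
    by (rule inj_on_subset[OF inj], simp)+
  have "shrinking (initial_iterator b I) (drop nI L) (take nI L) g \<longleftrightarrow> shrinks (initial_blocks h) nI g"
  proof (rule shrinking_iff_shrinks)
    show "initial_iterator b I \<in> perms" using pattern_perms[OF inj1(1)] \<alpha>(1) by simp
    show "length (initial_iterator b I) = nI" by (rule length_iterators)
    show "initial_iterator b I ! i < initial_iterator b I ! j \<longleftrightarrow> initial_blocks h 0 i < initial_blocks h 0 j"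
      if "i < nI" "j < nI" for i j
      using pattern_less_iff[OF inj1(2) that] \<alpha>(2) by (simp add: initial_blocks_def s'_def)
  qed (use less lL in \<open>auto simp: initial_blocks_def s'_def algebra_simps\<close>)
  then show ?thesis by (simp add: jux L_def)
qed

lemma c_ge_2: "T \<noteq> [] \<or> I \<noteq> [] \<Longrightarrow> c \<ge> 2"
  using le_length_augmented[of T b] le_length_augmented[of I b] b_ge_2 by auto

lemma terminal_core_bound: "T \<noteq> [] \<Longrightarrow> s + 2 * int nT \<le> s + int (c * nT)"
  and initial_core_bound: "I \<noteq> [] \<Longrightarrow> - int (c * nI) \<le> - 2 * int nI"
proof -
  show "s + 2 * int nT \<le> s + int (c * nT)" if "T \<noteq> []"
  proof -
    have "2 * nT \<le> c * nT" using c_ge_2 that by (intro mult_le_mono1) simp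
    then have "int (2 * nT) \<le> int (c * nT)" by (rule of_nat_mono)
    then show ?thesis by simp
  qed
  show "- int (c * nI) \<le> - 2 * int nI" if "I \<noteq> []"
  proof -
    have "2 * nI \<le> c * nI" using c_ge_2 that by (intro mult_le_mono1) simp
    then have "int (2 * nI) \<le> int (c * nI)" by (rule of_nat_mono)
    then show ?thesis by simp
  qed
qed

lemma terminal_splittable_iff:
  assumes "T \<noteq> []"
  shows "terminal_splittable b B I P T g \<longleftrightarrow> (\<exists>h x. realises b u h (- int (c * nI)) (s + int (c * nT)) \<and>
    x \<in> {- int (c * nI)..<s} \<and> shrinks (terminal_blocks h) nT g \<and> encloses (terminal_blocks h) 0 g (h x))"
    (is "?L \<longleftrightarrow> ?R")
proof -
  have "0 \<le> int (c * nI)" by simp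
  then have lo: "- int (c * nI) \<le> s" using s_ge by linarith
  note bound = terminal_core_bound[OF assms]
  show ?thesis
  proof
    assume ?L
    then obtain as \<beta> gs p where core: "core b I P T as \<beta> gs"
      and p: "p \<in> set (concat (rev as) @ \<beta>)" "lies_in p (hd gs) g"
      and shr: "let \<gamma> = terminal_iterator b T; (\<gamma>\<^sub>1, \<gamma>\<^sub>2) = juxtaposition b B \<gamma> in shrinking \<gamma> \<gamma>\<^sub>1 \<gamma>\<^sub>2 g"
      unfolding terminal_splittable_def by blast
    from model_of_core[OF core]
    obtain h where h: "realises b u h (- int (c * nI)) (s + int (c * nT))"
      and left: "\<forall>p\<in>set (concat (rev as) @ \<beta>). \<exists>x\<in>{- int (c * nI)..<s}. h x = int p"
      and right: "\<forall>p\<in>set (\<beta> @ concat gs). \<exists>x\<in>{0..<s + int (c * nT)}. h x = int p"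
      and hd: "\<forall>i<nT. int (hd gs ! i) = terminal_blocks h 0 i"
      and hd_as: "\<forall>i<nI. int (hd as ! i) = initial_blocks h 0 i"
      by (elim exE conjE)
    have sh: "shrinks (terminal_blocks h) nT g"
      using shr terminal_shrinking_iff[OF assms h lo bound] by simp
    obtain x where x: "x \<in> {- int (c * nI)..<s}" "h x = int p" using left[rule_format, OF p(1)] by blast
    have "lies_in p (hd gs) g \<longleftrightarrow> encloses (terminal_blocks h) 0 g (h x)"
    proof (rule lies_in_iff_encloses[OF sh])
      fix i assume i: "i < nT"
      show "(hd gs ! i < p) = (terminal_blocks h 0 i < h x) \<and> (p < hd gs ! i) = (h x < terminal_blocks h 0 i)"
        unfolding x(2) hd[rule_format, OF i, symmetric] by simp
    qed
    then show ?R using h x sh p(2) by blast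
  next
    assume ?R
    then obtain h x where h: "realises b u h (- int (c * nI)) (s + int (c * nT))"
      and x: "x \<in> {- int (c * nI)..<s}" and sh: "shrinks (terminal_blocks h) nT g"
      and enc: "encloses (terminal_blocks h) 0 g (h x)" by blast
    from core_of_model[OF h]
    obtain as \<beta> gs val where core: "core b I P T as \<beta> gs"
      and order: "\<forall>x\<in>{- int (c * nI)..<s + int (c * nT)}. \<forall>y\<in>{- int (c * nI)..<s + int (c * nT)}.
        val x < val y \<longleftrightarrow> h x < h y"
      and left: "\<forall>x\<in>{- int (c * nI)..<s}. val x \<in> set (concat (rev as) @ \<beta>)"
      and right: "\<forall>x\<in>{0..<s + int (c * nT)}. val x \<in> set (\<beta> @ concat gs)"
      and hd: "\<forall>i<nT. hd gs ! i = val (s + int i)"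
      and hd_as: "\<forall>i<nI. hd as ! i = val (- int nI + int i)"
      by (elim exE conjE)
    have "lies_in (val x) (hd gs) g \<longleftrightarrow> encloses (terminal_blocks h) 0 g (h x)"
    proof (rule lies_in_iff_encloses[OF sh])
      fix i assume i: "i < nT"
      then have "s + int i \<in> {- int (c * nI)..<s + int (c * nT)}" "x \<in> {- int (c * nI)..<s + int (c * nT)}"
        using lo bound x by auto
      then show "(hd gs ! i < val x) = (terminal_blocks h 0 i < h x) \<and> (val x < hd gs ! i) = (h x < terminal_blocks h 0 i)"
        using order[rule_format] hd[rule_format, OF i] by (simp add: terminal_blocks_def)
    qed
    then show ?L unfolding terminal_splittable_def
      using terminal_shrinking_iff[OF assms h lo bound] sh core left[rule_format, OF x] enc by blast
  qed
qed

lemma initial_splittable_iff: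
  assumes "I \<noteq> []"
  shows "initial_splittable b B I P T g \<longleftrightarrow> (\<exists>h x. realises b u h (- int (c * nI)) (s + int (c * nT)) \<and>
    x \<in> {0..<s + int (c * nT)} \<and> shrinks (initial_blocks h) nI g \<and> encloses (initial_blocks h) 0 g (h x))"
    (is "?L \<longleftrightarrow> ?R")
proof -
  have "0 \<le> int (c * nT)" by simp
  then have hi: "0 \<le> s + int (c * nT)" using s_ge by linarith
  note bound = initial_core_bound[OF assms]
  show ?thesis
  proof
    assume ?L
    then obtain as \<beta> gs p where core: "core b I P T as \<beta> gs"
      and p: "p \<in> set (\<beta> @ concat gs)" "lies_in p (hd as) g"
      and shr: "let \<alpha> = initial_iterator b I; (\<alpha>\<^sub>2, \<alpha>\<^sub>1) = juxtaposition b B \<alpha> in shrinking \<alpha> \<alpha>\<^sub>1 \<alpha>\<^sub>2 g"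
      unfolding initial_splittable_def by blast
    from model_of_core[OF core]
    obtain h where h: "realises b u h (- int (c * nI)) (s + int (c * nT))"
      and left: "\<forall>p\<in>set (concat (rev as) @ \<beta>). \<exists>x\<in>{- int (c * nI)..<s}. h x = int p"
      and right: "\<forall>p\<in>set (\<beta> @ concat gs). \<exists>x\<in>{0..<s + int (c * nT)}. h x = int p"
      and hd_gs: "\<forall>i<nT. int (hd gs ! i) = terminal_blocks h 0 i"
      and hd: "\<forall>i<nI. int (hd as ! i) = initial_blocks h 0 i"
      by (elim exE conjE)
    have sh: "shrinks (initial_blocks h) nI g"
      using shr initial_shrinking_iff[OF assms h bound hi] by simp
    obtain x where x: "x \<in> {0..<s + int (c * nT)}" "h x = int p" using right[rule_format, OF p(1)] by blast
    have "lies_in p (hd as) g \<longleftrightarrow> encloses (initial_blocks h) 0 g (h x)"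
    proof (rule lies_in_iff_encloses[OF sh])
      fix i assume i: "i < nI"
      show "(hd as ! i < p) = (initial_blocks h 0 i < h x) \<and> (p < hd as ! i) = (h x < initial_blocks h 0 i)"
        unfolding x(2) hd[rule_format, OF i, symmetric] by simp
    qed
    then show ?R using h x sh p(2) by blast
  next
    assume ?R
    then obtain h x where h: "realises b u h (- int (c * nI)) (s + int (c * nT))"
      and x: "x \<in> {0..<s + int (c * nT)}" and sh: "shrinks (initial_blocks h) nI g"
      and enc: "encloses (initial_blocks h) 0 g (h x)" by blast
    from core_of_model[OF h]
    obtain as \<beta> gs val where core: "core b I P T as \<beta> gs"
      and order: "\<forall>x\<in>{- int (c * nI)..<s + int (c * nT)}. \<forall>y\<in>{- int (c * nI)..<s + int (c * nT)}.
        val x < val y \<longleftrightarrow> h x < h y"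
      and left: "\<forall>x\<in>{- int (c * nI)..<s}. val x \<in> set (concat (rev as) @ \<beta>)"
      and right: "\<forall>x\<in>{0..<s + int (c * nT)}. val x \<in> set (\<beta> @ concat gs)"
      and hd_gs: "\<forall>i<nT. hd gs ! i = val (s + int i)"
      and hd: "\<forall>i<nI. hd as ! i = val (- int nI + int i)"
      by (elim exE conjE)
    have "lies_in (val x) (hd as) g \<longleftrightarrow> encloses (initial_blocks h) 0 g (h x)"
    proof (rule lies_in_iff_encloses[OF sh])
      fix i assume i: "i < nI"
      then have "- int nI + int i \<in> {- int (c * nI)..<s + int (c * nT)}" "x \<in> {- int (c * nI)..<s + int (c * nT)}"
        using hi bound x by auto
      then show "(hd as ! i < val x) = (initial_blocks h 0 i < h x) \<and> (val x < hd as ! i) = (h x < initial_blocks h 0 i)"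
        using order[rule_format] hd[rule_format, OF i] by (simp add: initial_blocks_def)
    qed
    then show ?L unfolding initial_splittable_def
      using initial_shrinking_iff[OF assms h bound hi] sh core right[rule_format, OF x] enc by blast
  qed
qed

end

section \<open>Well quasi-order excludes splittable pairs\<close>

context rigid_bicycle
begin

lemma nT_pos: "T \<noteq> [] \<Longrightarrow> nT \<ge> b" and nI_pos: "I \<noteq> [] \<Longrightarrow> nI \<ge> b"
  using le_length_augmented by blast+

lemma walk_e_minus_1: "T \<noteq> [] \<Longrightarrow> (I = [] \<Longrightarrow> 0 \<le> z) \<Longrightarrow> z < e \<Longrightarrow> u z \<notin> set T"
  using walk_in_T_iff[of z] by auto

lemma terminal_block_position:
  assumes "t < m" "i < nT"
  shows "s + int t * int nT + int i \<in> {s..<s + int (m * nT)}"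
proof -
  have "int (Suc t * nT) \<le> int (m * nT)" using assms(1) by (intro of_nat_mono mult_le_mono1) simp
  moreover have "int (Suc t * nT) = int t * int nT + int nT" by simp
  moreover have "0 \<le> int t * int nT" by simp
  ultimately have "0 \<le> int t * int nT + int i" "int t * int nT + int i < int (m * nT)"
    using assms(2) by linarith+
  then show ?thesis unfolding atLeastLessThan_iff by linarith
qed

lemma initial_block_position:
  assumes "t < m" "i < nI"
  shows "- int nI + int t * - int nI + int i \<in> {- int (m * nI)..<0}"
proof -
  have "int (Suc t * nI) \<le> int (m * nI)" using assms(1) by (intro of_nat_mono mult_le_mono1) simp
  moreover have "int (Suc t * nI) = int t * int nI + int nI" "int t * - int nI = - (int t * int nI)"
    by simp_all
  moreover have "0 \<le> int t * int nI" by simp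
  ultimately show ?thesis using assms(2) unfolding atLeastLessThan_iff by linarith
qed

text \<open>The alignment is forced since \<open>u z\<close> lies in the terminal cycle precisely for \<open>e \<le> z\<close>.\<close>

lemma well_quasi_order_not_terminal_splittable:
  assumes wqo: "well_quasi_ordered_on (\<le>\<^sub>f) C" and "T \<noteq> []"
  shows "\<not> terminal_splittable b B I P T g"
proof
  assume "terminal_splittable b B I P T g"
  then obtain h x where h: "realises b u h (- int (c * nI)) (s + int (c * nT))"
    and x: "x \<in> {- int (c * nI)..<s}" and g: "shrinks (terminal_blocks h) nT g"
      "encloses (terminal_blocks h) 0 g (h x)"
    using terminal_splittable_iff[OF assms(2)] by blast
  define al where "al = - int (c * nI)"
  define zh where "zh m = s + int (m + 3) * int nT" for m
  define N where "N m = c * nI + length P + (m + 3) * nT" for m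
  have al: "al \<le> 0" "I = [] \<Longrightarrow> al = 0" by (auto simp: al_def)
  have n: "nT \<ge> b" "nT \<ge> 1" using nT_pos assms(2) b_pos by auto
  have zh: "zh m = al + int (N m + b - 1)" for m
    using P b_pos by (cases P) (auto simp: zh_def al_def N_def algebra_simps)
  have zh_ge: "zh m \<ge> s + 3 * int nT" for m by (simp add: zh_def algebra_simps)
  have core: "s + 2 * int nT \<le> s + int (c * nT)" by (rule terminal_core_bound[OF assms(2)])
  have e0: "0 \<le> e" by (rule e_nonneg)
  show False
  proof (rule splitting_antichain[where X = T and \<sigma> = e and d = "int nT" and n = nT and s = s and x\<^sub>0 = x
        and zl = "\<lambda>_. e" and zh = zh and al = al and ah = s and W = "{e..<s}" and lo = "\<lambda>_. al" and hi = zh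
        and L = al and R = "s + int (c * nT)" and cl = e and ch = "s + 2 * int nT" and u = u and h = h
        and N = N and g = g])
    show "graph_cycle G T" by (rule T_cycle[OF assms(2)])
    show "cyc T e (z + int nT) = cyc T e z" for z
      using cyc_period_augmented[of T e z b 1] by simp
    show "u z = cyc T e z" if "e \<le> z" for z by (rule walk_terminal[OF assms(2) that])
    show "s + int t * int nT + int i \<in> {e..<zh m}" if "t < m + 3" "i < nT" for t m i
    proof -
      have "s + int t * int nT + int i \<in> {s..<s + int ((m + 3) * nT)}"
        by (rule terminal_block_position[OF that])
      then show ?thesis unfolding zh_def atLeastLessThan_iff of_nat_mult by linarith
    qed
    have ale: "al \<le> e" using al(1) e0 by linarith
    have szh: "s \<le> zh m" for m using zh_ge[of m] by linarith
    show "{al..<s} \<inter> {e..<zh m} = {e..<s}" for m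
      using ale szh[of m] by (intro set_eqI) (simp only: Int_iff atLeastLessThan_iff; linarith)
    show "{al..<s} \<union> {e..<zh m} = {al..<zh m}" for m
      using ale szh[of m] b_pos by (intro set_eqI) (simp only: Un_iff atLeastLessThan_iff; linarith)
    show "al \<le> z \<and> z + int b \<le> s \<or> e \<le> z \<and> z + int b \<le> zh m" if "al \<le> z" "z + int b \<le> zh m" for m z
      using that by linarith
    show "\<exists>k<nT. w + int nT = s + int k" if "w \<in> {e..<s}" for w
      using that n by (intro exI[of _ "nat (w + int nT - s)"]) auto
    show "window u al (N m) \<in> paths G" for m
      using window_in_paths_G[of al "N m"] al assms(2) P by (cases P) (auto simp: in_span_def N_def)
    show "N m \<ge> 1" for m using P by (cases P) (auto simp: N_def)
    show "zh m = al + int (N m + b - 1)" for m by (rule zh)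
    show "realises b u h al (s + int (c * nT))" using h by (simp add: al_def)
    show "{al..<s} \<subseteq> {al..<s + int (c * nT)}" by auto
    show "{e..<s} \<subseteq> {e..<s + 2 * int nT}" by auto
    show "{e..<s + 2 * int nT} \<subseteq> {al..<s + int (c * nT)}"
      unfolding ivl_subset using core ale by linarith
    show "{e..<s + 2 * int nT} \<subseteq> {e..<zh m}" for m using zh_ge[of m] by auto
    show "s + int t * int nT + int i \<in> {e..<s + 2 * int nT}" if "t < 2" "i < nT" for t i
    proof -
      have "t = 0 \<or> t = 1" using that by auto
      then show ?thesis using that(2) b_pos by auto
    qed
    show "x \<in> {al..<s}" using x by (simp add: al_def)
    show "shrinks (\<lambda>t i. h (s + int t * int nT + int i)) nT g"
      "encloses (\<lambda>t i. h (s + int t * int nT + int i)) 0 g (h x)"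
      using g by (simp_all add: terminal_blocks_def[abs_def])
    show "\<delta> = 0"
      if "x \<notin> {e..<s}" and shift: "\<And>z. al \<le> z \<Longrightarrow> z + int b \<le> zh m \<Longrightarrow>
           u z = u (z + \<delta>) \<and> al \<le> z + \<delta> \<and> z + \<delta> + int b \<le> zh m'" for m m' \<delta>
    proof -
      have xe: "al \<le> x" "x < e" using x that(1) by (auto simp: al_def)
      have bnd: "e + int b \<le> zh m" using zh_ge[of m] by simp
      have 1: "u e = u (e + \<delta>)" "al \<le> e + \<delta>" using shift[of e] bnd xe by auto
      have 2: "u (e - 1) = u (e - 1 + \<delta>)" using shift[of "e - 1"] bnd xe by auto
      have "I = [] \<Longrightarrow> 0 \<le> e + \<delta>" using 1(2) al(2) by simp
      moreover have "u e \<in> set T" using walk_in_T_iff[OF assms(2), of e] e0 by simp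
      ultimately have "e \<le> e + \<delta>" using walk_e_minus_1[OF assms(2), of "e + \<delta>"] 1(1) by force
      moreover have "u (e - 1) \<notin> set T"
        by (rule walk_e_minus_1[OF assms(2)]) (use xe al in auto)
      then have "\<not> e \<le> e - 1 + \<delta>" using 2 walk_terminal[OF assms(2)] cyc_in_set[OF assms(2)] by metis
      ultimately show "\<delta> = 0" by linarith
    qed
    show "N m < N m'" if "m < m'" for m m'
    proof -
      have "(m + 3) * nT < (m' + 3) * nT" by (rule mult_less_mono1) (use that n in linarith)+
      then show ?thesis by (simp add: N_def)
    qed
  qed (use wqo n b_pos in \<open>auto simp: algebra_simps\<close>)
qed

text \<open>The mirror image: copies are counted to the left, and \<open>u z\<close> lies in the initial cycle precisely
  for \<open>z \<le> 0\<close>.\<close>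

lemma well_quasi_order_not_initial_splittable:
  assumes wqo: "well_quasi_ordered_on (\<le>\<^sub>f) C" and "I \<noteq> []"
  shows "\<not> initial_splittable b B I P T g"
proof
  assume "initial_splittable b B I P T g"
  then obtain h x where h: "realises b u h (- int (c * nI)) (s + int (c * nT))"
    and x: "x \<in> {0..<s + int (c * nT)}" and g: "shrinks (initial_blocks h) nI g"
      "encloses (initial_blocks h) 0 g (h x)"
    using initial_splittable_iff[OF assms(2)] by blast
  define ah where "ah = s + int (c * nT)"
  define zl where "zl m = - (int (m + 3) * int nI)" for m
  define N where "N m = (m + 3) * nI + length P + c * nT" for m
  have ah: "ah \<ge> s" "T = [] \<Longrightarrow> ah = s" by (auto simp: ah_def)
  have sb: "s \<ge> int b" by (rule s_ge)
  have n: "nI \<ge> b" "nI \<ge> 1" using nI_pos assms(2) b_pos by auto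
  have zl: "ah = zl m + int (N m + b - 1)" for m
    using P b_pos by (cases P) (auto simp: zl_def ah_def N_def algebra_simps)
  have zl_le: "zl m \<le> - (3 * int nI)" for m by (simp add: zl_def algebra_simps)
  have core: "- int (c * nI) \<le> - 2 * int nI" by (rule initial_core_bound[OF assms(2)])
  show False
  proof (rule splitting_antichain[where X = I and \<sigma> = 0 and d = "- int nI" and n = nI and s = "- int nI" and x\<^sub>0 = x
        and zl = zl and zh = "\<lambda>_. int b" and al = 0 and ah = ah and W = "{0..<int b}" and lo = zl and hi = "\<lambda>_. ah"
        and L = "- int (c * nI)" and R = ah and cl = "- 2 * int nI" and ch = "int b" and u = u and h = h
        and N = N and g = g])
    show "graph_cycle G I" by (rule I_cycle[OF assms(2)])
    show "cyc I 0 (z + - int nI) = cyc I 0 z" for z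
      using cyc_period_augmented[of I 0 z b "- 1"] by simp
    show "u z = cyc I 0 z" if "z + int b \<le> int b" for z by (rule walk_initial[OF assms(2)]) (use that in simp)
    show "- int nI + int t * - int nI + int i \<in> {zl m..<int b}" if "t < m + 3" "i < nI" for t m i
    proof -
      have "- int nI + int t * - int nI + int i \<in> {- int ((m + 3) * nI)..<0}"
        by (rule initial_block_position[OF that])
      then show ?thesis unfolding zl_def atLeastLessThan_iff of_nat_mult by linarith
    qed
    have bah: "int b \<le> ah" using ah(1) sb by linarith
    have zl0: "zl m \<le> 0" for m using zl_le[of m] by linarith
    show "{0..<ah} \<inter> {zl m..<int b} = {0..<int b}" for m
      using bah zl0[of m] by (intro set_eqI) (simp only: Int_iff atLeastLessThan_iff; linarith)
    show "{0..<ah} \<union> {zl m..<int b} = {zl m..<ah}" for m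
      using bah zl0[of m] b_pos by (intro set_eqI) (simp only: Un_iff atLeastLessThan_iff; linarith)
    show "0 \<le> z \<and> z + int b \<le> ah \<or> zl m \<le> z \<and> z + int b \<le> int b" if "zl m \<le> z" "z + int b \<le> ah" for m z
      using that by linarith
    show "\<exists>k<nI. w + - int nI = - int nI + int k" if "w \<in> {0..<int b}" for w
      using that n by (intro exI[of _ "nat w"]) auto
    show "window u (zl m) (N m) \<in> paths G" for m
    proof (rule window_in_paths_G)
      show "in_span I P T (zl m) (zl m + int (N m))"
        using assms(2) by (auto simp: in_span_def zl_def N_def algebra_simps)
    qed (use P in \<open>cases P; auto simp: N_def\<close>)
    show "N m \<ge> 1" for m using P by (cases P) (auto simp: N_def)
    show "ah = zl m + int (N m + b - 1)" for m by (rule zl)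
    show "realises b u h (- int (c * nI)) ah" using h by (simp add: ah_def)
    show "{0..<ah} \<subseteq> {- int (c * nI)..<ah}" by auto
    show "{0..<int b} \<subseteq> {- 2 * int nI..<int b}" by auto
    show "{- 2 * int nI..<int b} \<subseteq> {- int (c * nI)..<ah}"
      unfolding ivl_subset using core bah by linarith
    show "{- 2 * int nI..<int b} \<subseteq> {zl m..<int b}" for m using zl_le[of m] by auto
    show "- int nI + int t * - int nI + int i \<in> {- 2 * int nI..<int b}" if "t < 2" "i < nI" for t i
    proof -
      have "t = 0 \<or> t = 1" using that by auto
      then show ?thesis using that(2) b_pos by auto
    qed
    show "x \<in> {0..<ah}" using x by (simp add: ah_def)
    show "shrinks (\<lambda>t i. h (- int nI + int t * - int nI + int i)) nI g"
      "encloses (\<lambda>t i. h (- int nI + int t * - int nI + int i)) 0 g (h x)"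
      using g by (simp_all add: initial_blocks_def[abs_def])
    show "\<delta> = 0"
      if "x \<notin> {0..<int b}" and shift: "\<And>z. zl m \<le> z \<Longrightarrow> z + int b \<le> ah \<Longrightarrow>
           u z = u (z + \<delta>) \<and> zl m' \<le> z + \<delta> \<and> z + \<delta> + int b \<le> ah" for m m' \<delta>
    proof -
      have xb: "int b \<le> x" "x < ah" using x that(1) by (auto simp: ah_def)
      have bnd: "zl m \<le> 0" using zl_le[of m] by simp
      have 1: "u 0 = u \<delta>" "\<delta> + int b \<le> ah" using shift[of 0] bnd xb by auto
      have 2: "u 1 = u (1 + \<delta>)" "1 + \<delta> + int b \<le> ah" using shift[of 1] bnd xb by auto
      have Te: "T = [] \<longrightarrow> \<delta> \<le> e" "T = [] \<longrightarrow> 1 + \<delta> \<le> e" "T = [] \<longrightarrow> 1 \<le> e" "T = [] \<longrightarrow> 0 \<le> e"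
        using 1(2) 2(2) ah(2) xb by auto
      have "\<delta> \<le> 0" using walk_in_I_iff[OF assms(2) Te(1)] walk_in_I_iff[OF assms(2) Te(4)] 1(1) by simp
      moreover have "\<not> 1 + \<delta> \<le> 0"
        using walk_in_I_iff[OF assms(2) Te(2)] walk_in_I_iff[OF assms(2) Te(3)] 2(1) by simp
      ultimately show "\<delta> = 0" by linarith
    qed
    show "N m < N m'" if "m < m'" for m m'
    proof -
      have "(m + 3) * nI < (m' + 3) * nI" by (rule mult_less_mono1) (use that n in linarith)+
      then show ?thesis by (simp add: N_def)
    qed
  qed (use wqo n b_pos in \<open>auto simp: algebra_simps\<close>)
qed

section \<open>Cores determine balanced permutations\<close>

definition unsplittable :: bool where
  "unsplittable \<longleftrightarrow> (T \<noteq> [] \<longrightarrow> (\<forall>g. \<not> terminal_splittable b B I P T g)) \<and>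
     (I \<noteq> [] \<longrightarrow> (\<forall>g. \<not> initial_splittable b B I P T g))"

text \<open>At least three copies are asked for because separation involves three of them.\<close>

definition balanced_model :: "nat \<Rightarrow> (int \<Rightarrow> int) \<Rightarrow> bool" where
  "balanced_model m h \<longleftrightarrow> m \<ge> c \<and> m \<ge> 3 \<and> realises b u h (- int (m * nI)) (s + int (m * nT))"

lemma range_mono:
  assumes "k \<le> m"
  shows "- int (m * nI) \<le> - int (k * nI)" "s + int (k * nT) \<le> s + int (m * nT)"
proof -
  have "int (k * nI) \<le> int (m * nI)" "int (k * nT) \<le> int (m * nT)"
    using assms by (simp_all only: of_nat_le_iff mult_le_mono1)
  then show "- int (m * nI) \<le> - int (k * nI)" "s + int (k * nT) \<le> s + int (m * nT)" by linarith+
qed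

lemma balanced_model_core:
  assumes "balanced_model m h"
  shows "realises b u h (- int (c * nI)) (s + int (c * nT))"
  using assms realises_subset range_mono[of c m] unfolding balanced_model_def by blast

lemma terminal_blocks_blocks:
  assumes "T \<noteq> []" "balanced_model m h"
  shows "blocks (terminal_blocks h) nT m"
proof -
  have "- int (m * nI) \<le> 0" by simp
  then have "- int (m * nI) \<le> s" using s_ge by linarith
  then have "realises b u h s (s + int (m * nT))"
    using assms(2) realises_subset unfolding balanced_model_def by blast
  then have h: "realises b (cyc T e) h s (s + int (m * nT))" using realises_terminal[OF assms(1), of s] by simp
  have "blocks (\<lambda>t i. h (s + int t * int nT + int i)) nT m"
  proof (rule realises_blocks[OF h rigid_T[OF assms(1)] _ b_pos nT_pos[OF assms(1)]])
    show "cyc T e (z + int nT) = cyc T e z" for z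
      using cyc_period_augmented[of T e z b 1] by simp
  qed (use assms terminal_block_position in \<open>auto simp: balanced_model_def\<close>)
  then show ?thesis by (simp add: terminal_blocks_def[abs_def])
qed

lemma initial_blocks_blocks:
  assumes "I \<noteq> []" "balanced_model m h"
  shows "blocks (initial_blocks h) nI m"
proof -
  have "0 \<le> int (m * nT)" by simp
  then have "0 \<le> s + int (m * nT)" using s_ge by linarith
  then have "realises b u h (- int (m * nI)) 0"
    using assms(2) realises_subset unfolding balanced_model_def by blast
  then have h: "realises b (cyc I 0) h (- int (m * nI)) 0" using realises_initial[OF assms(1), of 0] by simp
  have "blocks (\<lambda>t i. h (- int nI + int t * - int nI + int i)) nI m"
  proof (rule realises_blocks[OF h rigid_I[OF assms(1)] _ b_pos nI_pos[OF assms(1)]])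
    show "cyc I 0 (z + - int nI) = cyc I 0 z" for z
      using cyc_period_augmented[of I 0 z b "- 1"] by simp
  qed (use assms initial_block_position in \<open>auto simp: balanced_model_def\<close>)
  then show ?thesis by (simp add: initial_blocks_def[abs_def])
qed

text \<open>The position in the core that plays the role of the position \<open>x\<close>.\<close>

definition core_position :: "int \<Rightarrow> int" where
  "core_position x =
     (if x \<ge> s + int (c * nT) then s + int (c - 1) * int nT + (x - s) mod int nT
      else if x < - int (c * nI) then - int nI + int (c - 1) * - int nI + x mod int nI
      else x)"

lemma balanced_model_neq:
  assumes "balanced_model m h" "x \<in> {- int (m * nI)..<s + int (m * nT)}" "y \<in> {- int (m * nI)..<s + int (m * nT)}"
    and "x \<noteq> y"
  shows "h x \<noteq> h y"
  using assms realisesD(1) unfolding balanced_model_def inj_on_def by blast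

lemma block_of_right:
  assumes "s + int (c * nT) \<le> x" "x < s + int (m * nT)"
  obtains t i where "c \<le> t" "t < m" "i < nT" "x = s + int t * int nT + int i"
    "core_position x = s + int (c - 1) * int nT + int i" "T \<noteq> []"
proof -
  have "int (m * nT) > int (c * nT)" using assms by linarith
  then have Tne: "T \<noteq> []" by auto
  have n: "nT > 0" using nT_pos[OF Tne] b_pos by linarith
  define k where "k = nat (x - s)"
  have "0 \<le> int (c * nT)" by simp
  then have k: "x = s + int k" using assms unfolding k_def by linarith
  have "int (c * nT) \<le> int k" "int k < int (m * nT)" using assms unfolding k by linarith+
  then have "c \<le> k div nT" "k div nT < m"
    unfolding less_eq_div_iff_mult_less_eq[OF n] div_less_iff_less_mult[OF n] of_nat_le_iff of_nat_less_iff .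
  moreover have "x = s + int (k div nT) * int nT + int (k mod nT)"
    unfolding k by (simp flip: of_nat_mult of_nat_add)
  moreover have "core_position x = s + int (c - 1) * int nT + int (k mod nT)"
    using assms(1) unfolding core_position_def by (simp add: k zmod_int)
  moreover have "k mod nT < nT" using n by simp
  ultimately show thesis using that[of "k div nT" "k mod nT"] Tne by blast
qed

lemma block_of_left:
  assumes "- int (m * nI) \<le> x" "x < - int (c * nI)"
  obtains t i where "c \<le> t" "t < m" "i < nI" "x = - int nI + int t * - int nI + int i"
    "core_position x = - int nI + int (c - 1) * - int nI + int i" "I \<noteq> []"
proof -
  have "int (m * nI) > int (c * nI)" using assms by linarith
  then have Ine: "I \<noteq> []" by auto
  have n: "nI > 0" using nI_pos[OF Ine] b_pos by linarith
  define k where "k = nat (- x - 1)"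
  have "0 \<le> int (c * nI)" by simp
  then have k: "x = - int k - 1" using assms unfolding k_def by linarith
  have "int (c * nI) \<le> int k" "int k < int (m * nI)" using assms unfolding k by linarith+
  then have t: "c \<le> k div nI" "k div nI < m"
    unfolding less_eq_div_iff_mult_less_eq[OF n] div_less_iff_less_mult[OF n] of_nat_le_iff of_nat_less_iff .
  define i where "i = nI - 1 - k mod nI"
  have i: "i < nI" "int i = int nI - 1 - int (k mod nI)"
    using n mod_less_divisor[OF n, of k] unfolding i_def by linarith+
  have "int k = int (k div nI) * int nI + int (k mod nI)"
    by (simp flip: of_nat_mult of_nat_add)
  then have x: "x = - int nI + int (k div nI) * - int nI + int i"
    unfolding k i(2) by simp
  have "x mod int nI = int i"
  proof -
    have "x = int i + int nI * (- 1 - int (k div nI))" unfolding x by (simp add: algebra_simps)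
    then have "x mod int nI = int i mod int nI" by (metis mod_mult_self2)
    then show ?thesis using i(1) by simp
  qed
  moreover have "\<not> s + int (c * nT) \<le> x"
    using s_ge assms(2) by (smt (verit) of_nat_0_le_iff)
  ultimately have "core_position x = - int nI + int (c - 1) * - int nI + int i"
    using assms(2) unfolding core_position_def by simp
  then show thesis using that[OF t i(1) x _ Ine] by blast
qed

lemma core_unsplit:
  assumes "unsplittable" "balanced_model m h"
  shows "T \<noteq> [] \<Longrightarrow> x \<in> {- int (c * nI)..<s} \<Longrightarrow> shrinks (terminal_blocks h) nT g \<Longrightarrow>
      \<not> encloses (terminal_blocks h) 0 g (h x)"
    and "I \<noteq> [] \<Longrightarrow> x \<in> {0..<s + int (c * nT)} \<Longrightarrow> shrinks (initial_blocks h) nI g \<Longrightarrow>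
      \<not> encloses (initial_blocks h) 0 g (h x)"
  using balanced_model_core[OF assms(2)] assms(1) terminal_splittable_iff initial_splittable_iff
  unfolding unsplittable_def by blast+

lemma c_block: "T \<noteq> [] \<Longrightarrow> nT - 1 \<le> c - 1 \<and> c - 1 < c" "I \<noteq> [] \<Longrightarrow> nI - 1 \<le> c - 1 \<and> c - 1 < c"
  using c_ge_2 by auto

lemma right_stable_if:
  assumes bal: "balanced_model m h" and x: "x \<in> {- int (m * nI)..<s}"
    and un: "\<And>g. T \<noteq> [] \<Longrightarrow> shrinks (terminal_blocks h) nT g \<Longrightarrow> \<not> encloses (terminal_blocks h) 0 g (h x)"
    and y: "s + int (c * nT) \<le> y" "y < s + int (m * nT)"
  shows "(h x < h y \<longleftrightarrow> h x < h (core_position y)) \<and> (h y < h x \<longleftrightarrow> h (core_position y) < h x)"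
proof -
  obtain t i where t: "c \<le> t" "t < m" "i < nT" "y = s + int t * int nT + int i"
    "core_position y = s + int (c - 1) * int nT + int i" "T \<noteq> []" using block_of_right[OF y] .
  interpret blocks "terminal_blocks h" nT m using terminal_blocks_blocks[OF t(6) bal] .
  have cm: "c - 1 < m" "nT - 1 \<le> c - 1" "nT - 1 \<le> t" using c_block(1)[OF t(6)] t(1,2) by linarith+
  have m0: "0 \<le> int (m * nI)" "0 \<le> int (m * nT)" by simp_all
  have neq: "terminal_blocks h t k \<noteq> h x" if "t < m" "k < nT" for t k
    unfolding terminal_blocks_def
  proof (rule balanced_model_neq[OF bal])
    show "s + int t * int nT + int k \<in> {- int (m * nI)..<s + int (m * nT)}"
      using terminal_block_position[OF that] m0 s_ge unfolding atLeastLessThan_iff by linarith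
    show "x \<in> {- int (m * nI)..<s + int (m * nT)}"
      using x m0 unfolding atLeastLessThan_iff by linarith
    show "s + int t * int nT + int k \<noteq> x"
      using terminal_block_position[OF that] x unfolding atLeastLessThan_iff by linarith
  qed
  have "h x < terminal_blocks h t i \<longleftrightarrow> h x < terminal_blocks h (c - 1) i"
    by (rule stable) (use neq un t cm in auto)
  moreover have "terminal_blocks h t i = h y" "terminal_blocks h (c - 1) i = h (core_position y)"
    using t by (auto simp: terminal_blocks_def)
  ultimately show ?thesis using neq[OF t(2,3)] neq[OF cm(1) t(3)] by auto
qed

lemma left_stable_if:
  assumes bal: "balanced_model m h" and x: "x \<in> {0..<s + int (m * nT)}"
    and un: "\<And>g. I \<noteq> [] \<Longrightarrow> shrinks (initial_blocks h) nI g \<Longrightarrow> \<not> encloses (initial_blocks h) 0 g (h x)"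
    and y: "- int (m * nI) \<le> y" "y < - int (c * nI)"
  shows "(h x < h y \<longleftrightarrow> h x < h (core_position y)) \<and> (h y < h x \<longleftrightarrow> h (core_position y) < h x)"
proof -
  obtain t i where t: "c \<le> t" "t < m" "i < nI" "y = - int nI + int t * - int nI + int i"
    "core_position y = - int nI + int (c - 1) * - int nI + int i" "I \<noteq> []" using block_of_left[OF y] .
  interpret blocks "initial_blocks h" nI m using initial_blocks_blocks[OF t(6) bal] .
  have cm: "c - 1 < m" "nI - 1 \<le> c - 1" "nI - 1 \<le> t" using c_block(2)[OF t(6)] t(1,2) by linarith+
  have m0: "0 \<le> int (m * nI)" "0 \<le> int (m * nT)" by simp_all
  have neq: "initial_blocks h t k \<noteq> h x" if "t < m" "k < nI" for t k
    unfolding initial_blocks_def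
  proof (rule balanced_model_neq[OF bal])
    show "- int nI + int t * - int nI + int k \<in> {- int (m * nI)..<s + int (m * nT)}"
      using initial_block_position[OF that] m0 s_ge unfolding atLeastLessThan_iff by linarith
    show "x \<in> {- int (m * nI)..<s + int (m * nT)}"
      using x m0 unfolding atLeastLessThan_iff by linarith
    show "- int nI + int t * - int nI + int k \<noteq> x"
      using initial_block_position[OF that] x unfolding atLeastLessThan_iff by linarith
  qed
  have "h x < initial_blocks h t i \<longleftrightarrow> h x < initial_blocks h (c - 1) i"
    by (rule stable) (use neq un t cm in auto)
  moreover have "initial_blocks h t i = h y" "initial_blocks h (c - 1) i = h (core_position y)"
    using t by (auto simp: initial_blocks_def)
  ultimately show ?thesis using neq[OF t(2,3)] neq[OF cm(1) t(3)] by auto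
qed

lemma core_position_left:
  assumes "- int (m * nI) \<le> y" "y < - int (c * nI)"
  shows "core_position y \<in> {- int (c * nI)..<0}"
proof -
  obtain i where i: "i < nI" "core_position y = - int nI + int (c - 1) * - int nI + int i" "I \<noteq> []"
    using block_of_left[OF assms] .
  have "c - 1 < c" using c_block(2)[OF i(3)] by simp
  from initial_block_position[OF this i(1)] show ?thesis using i(2) by simp
qed

lemma core_position_right:
  assumes "s + int (c * nT) \<le> y" "y < s + int (m * nT)"
  shows "core_position y \<in> {s..<s + int (c * nT)}"
proof -
  obtain i where i: "i < nT" "core_position y = s + int (c - 1) * int nT + int i" "T \<noteq> []"
    using block_of_right[OF assms] .
  have "c - 1 < c" using c_block(1)[OF i(3)] by simp
  from terminal_block_position[OF this i(1)] show ?thesis using i(2) by simp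
qed

text \<open>Splittable pairs are only tested on cores, but an entry of a copy of \<open>\<alpha>\<close> outside the core
  lies on the same side of the entries of \<open>\<gamma>\<^sub>1\<close> as the corresponding entry inside, since these do
  not split \<open>\<alpha>\<close>.  So it does not split \<open>\<gamma>\<close> either.\<close>

lemma right_stable:
  assumes un: "unsplittable" and bal: "balanced_model m h" and x: "x \<in> {- int (m * nI)..<s}"
    and y: "s + int (c * nT) \<le> y" "y < s + int (m * nT)"
  shows "(h x < h y \<longleftrightarrow> h x < h (core_position y)) \<and> (h y < h x \<longleftrightarrow> h (core_position y) < h x)"
proof (rule right_stable_if[OF bal x _ y])
  fix g assume T': "T \<noteq> []" and g: "shrinks (terminal_blocks h) nT g"
  show "\<not> encloses (terminal_blocks h) 0 g (h x)"
  proof (cases "- int (c * nI) \<le> x")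
    case True
    then show ?thesis using core_unsplit(1)[OF un bal T' _ g] x by simp
  next
    case False
    then have xl: "- int (m * nI) \<le> x" "x < - int (c * nI)" using x by auto
    have "encloses (terminal_blocks h) 0 g (h x) \<longleftrightarrow> encloses (terminal_blocks h) 0 g (h (core_position x))"
    proof (rule encloses_cong[OF _ g])
      fix i assume i: "i < nT"
      have c: "0 < c" using c_ge_2 T' by auto
      have z: "s + int 0 * int nT + int i \<in> {s..<s + int (c * nT)}"
        by (rule terminal_block_position[OF c i])
      have cm: "c \<le> m" using bal by (simp add: balanced_model_def)
      have "s + int 0 * int nT + int i = s + int i" by simp
      then have z1: "s + int i \<in> {0..<s + int (c * nT)}" "s + int i \<in> {0..<s + int (m * nT)}"
        using z s_ge range_mono(2)[OF cm] unfolding atLeastLessThan_iff by linarith+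
      from left_stable_if[OF bal z1(2) _ xl] core_unsplit(2)[OF un bal _ z1(1)]
      have "(h (s + int i) < h x) = (h (s + int i) < h (core_position x)) \<and>
        (h x < h (s + int i)) = (h (core_position x) < h (s + int i))" by blast
      then show "(h x < terminal_blocks h 0 i) = (h (core_position x) < terminal_blocks h 0 i) \<and>
        (terminal_blocks h 0 i < h x) = (terminal_blocks h 0 i < h (core_position x))"
        by (simp add: terminal_blocks_def)
    qed
    moreover have "core_position x \<in> {- int (c * nI)..<s}" using core_position_left[OF xl] s_ge unfolding atLeastLessThan_iff by linarith
    ultimately show ?thesis using core_unsplit(1)[OF un bal T' _ g] by blast
  qed
qed

lemma left_stable:
  assumes un: "unsplittable" and bal: "balanced_model m h" and x: "x \<in> {0..<s + int (m * nT)}"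
    and y: "- int (m * nI) \<le> y" "y < - int (c * nI)"
  shows "(h x < h y \<longleftrightarrow> h x < h (core_position y)) \<and> (h y < h x \<longleftrightarrow> h (core_position y) < h x)"
proof (rule left_stable_if[OF bal x _ y])
  fix g assume I': "I \<noteq> []" and g: "shrinks (initial_blocks h) nI g"
  show "\<not> encloses (initial_blocks h) 0 g (h x)"
  proof (cases "x < s + int (c * nT)")
    case True
    then show ?thesis using core_unsplit(2)[OF un bal I' _ g] x by simp
  next
    case False
    then have xr: "s + int (c * nT) \<le> x" "x < s + int (m * nT)" using x by auto
    have "encloses (initial_blocks h) 0 g (h x) \<longleftrightarrow> encloses (initial_blocks h) 0 g (h (core_position x))"
    proof (rule encloses_cong[OF _ g])
      fix i assume i: "i < nI"
      have c: "0 < c" using c_ge_2 I' by auto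
      have z: "- int nI + int 0 * - int nI + int i \<in> {- int (c * nI)..<0}"
        by (rule initial_block_position[OF c i])
      have cm: "c \<le> m" using bal by (simp add: balanced_model_def)
      have "- int nI + int 0 * - int nI + int i = - int nI + int i" by simp
      then have z1: "- int nI + int i \<in> {- int (c * nI)..<s}" "- int nI + int i \<in> {- int (m * nI)..<s}"
        using z s_ge range_mono(1)[OF cm] unfolding atLeastLessThan_iff by linarith+
      from right_stable_if[OF bal z1(2) _ xr] core_unsplit(1)[OF un bal _ z1(1)]
      have "(h (- int nI + int i) < h x) = (h (- int nI + int i) < h (core_position x)) \<and>
        (h x < h (- int nI + int i)) = (h (core_position x) < h (- int nI + int i))" by blast
      then show "(h x < initial_blocks h 0 i) = (h (core_position x) < initial_blocks h 0 i) \<and>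
        (initial_blocks h 0 i < h x) = (initial_blocks h 0 i < h (core_position x))"
        by (simp add: initial_blocks_def)
    qed
    moreover have "core_position x \<in> {0..<s + int (c * nT)}" using core_position_right[OF xr] s_ge unfolding atLeastLessThan_iff by linarith
    ultimately show ?thesis using core_unsplit(2)[OF un bal I' _ g] by blast
  qed
qed

text \<open>Two entries that both lie in the initial, or both in the terminal, part are compared by
  rigidity.  Otherwise either of them can be replaced by its counterpart in the core without
  changing the comparison.\<close>

lemma core_determines:
  assumes un: "unsplittable" and bal: "balanced_model m h" "balanced_model m h'"
    and core: "same_order_on {- int (c * nI)..<s + int (c * nT)} h h'"
  shows "same_order_on {- int (m * nI)..<s + int (m * nT)} h h'"
proof -
  let ?R = "{- int (m * nI)..<s + int (m * nT)}" and ?K = "{- int (c * nI)..<s + int (c * nT)}"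
  define Q where "Q x y \<longleftrightarrow> (h x < h y \<longleftrightarrow> h' x < h' y) \<and> (h y < h x \<longleftrightarrow> h' y < h' x)" for x y
  have r: "realises b u h (- int (m * nI)) (s + int (m * nT))" "realises b u h' (- int (m * nI)) (s + int (m * nT))"
    using bal by (auto simp: balanced_model_def)
  have cm: "c \<le> m" using bal(1) by (simp add: balanced_model_def)
  have m0: "0 \<le> int (m * nI)" "0 \<le> int (m * nT)" "0 \<le> int (c * nI)" "0 \<le> int (c * nT)" by simp_all
  have coreQ: "Q x y" if "x \<in> ?K" "y \<in> ?K" for x y
    using core that unfolding same_order_on_def Q_def by blast
  have TQ: "Q x y" if Tne: "T \<noteq> []" and xy: "x \<in> ?R" "y \<in> ?R" "e \<le> x" "e \<le> y" for x y
  proof -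
    have "- int (m * nI) \<le> e" using m0 e_nonneg by linarith
    then have "realises b (cyc T e) h e (s + int (m * nT))" "realises b (cyc T e) h' e (s + int (m * nT))"
      using realises_subset[OF r(1)] realises_subset[OF r(2)] realises_terminal[OF Tne, of e] by blast+
    moreover have "rigid b (cyc T e) e (s + int (m * nT))" using m0 by (intro rigid_T[OF Tne]) simp
    ultimately have "same_order_on {e..<s + int (m * nT)} h h'" using rigidD by blast
    then show ?thesis using xy unfolding same_order_on_def Q_def by auto
  qed
  have IQ: "Q x y" if Ine: "I \<noteq> []" and xy: "x \<in> ?R" "y \<in> ?R" "x < int b" "y < int b" for x y
  proof -
    have "int b \<le> s + int (m * nT)" using m0 s_ge by linarith
    then have "realises b (cyc I 0) h (- int (m * nI)) (int b)" "realises b (cyc I 0) h' (- int (m * nI)) (int b)"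
      using realises_subset[OF r(1)] realises_subset[OF r(2)] realises_initial[OF Ine, of "int b"] by blast+
    moreover have "rigid b (cyc I 0) (- int (m * nI)) (int b)" using m0 by (intro rigid_I[OF Ine]) simp
    ultimately have "same_order_on {- int (m * nI)..<int b} h h'" using rigidD by blast
    then show ?thesis using xy unfolding same_order_on_def Q_def by auto
  qed
  have right: "Q x y" if x: "x \<in> {- int (m * nI)..<s}" and y: "s + int (c * nT) \<le> y" "y < s + int (m * nT)"
    and q: "Q x (core_position y)" for x y
    using right_stable[OF un bal(1) x y] right_stable[OF un bal(2) x y] q unfolding Q_def by blast
  have left: "Q x y" if x: "x \<in> {0..<s + int (m * nT)}" and y: "- int (m * nI) \<le> y" "y < - int (c * nI)"
    and q: "Q x (core_position y)" for x y
    using left_stable[OF un bal(1) x y] left_stable[OF un bal(2) x y] q unfolding Q_def by blast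
  have sym: "Q x y \<Longrightarrow> Q y x" for x y unfolding Q_def by blast
  have far: "Q x y" if xy: "x \<in> ?R" "y \<in> ?R" "y \<notin> ?K" for x y
  proof -
    consider "s + int (c * nT) \<le> y" | "y < - int (c * nI)" using xy by force
    then show ?thesis
    proof cases
      case 1
      have yR: "y < s + int (m * nT)" using xy by simp
      then have Tne: "T \<noteq> []" using block_of_right[OF 1] by blast
      show ?thesis
      proof (cases "e \<le> x")
        case True
        have "e \<le> y" using 1 m0 b_pos by linarith
        then show ?thesis using TQ[OF Tne xy(1,2) True] by blast
      next
        case False
        note p = core_position_right[OF 1 yR]
        have pK: "core_position y \<in> ?K" using p m0 s_ge unfolding atLeastLessThan_iff by linarith
        have "Q x (core_position y)"
        proof (cases "x \<in> ?K")
          case True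
          then show ?thesis using coreQ pK by blast
        next
          case False
          then have xl: "- int (m * nI) \<le> x" "x < - int (c * nI)" using xy \<open>\<not> e \<le> x\<close> m0 b_pos unfolding atLeastLessThan_iff by linarith+
          have "core_position x \<in> ?K" using core_position_left[OF xl] m0 s_ge unfolding atLeastLessThan_iff by linarith
          then have "Q (core_position y) (core_position x)" using coreQ pK by blast
          moreover have "core_position y \<in> {0..<s + int (m * nT)}"
            using p s_ge range_mono(2)[OF cm] unfolding atLeastLessThan_iff by linarith
          ultimately show ?thesis using left[OF _ xl] sym by blast
        qed
        moreover have "x \<in> {- int (m * nI)..<s}" using xy False b_pos unfolding atLeastLessThan_iff by linarith
        ultimately show ?thesis using right[OF _ 1 yR] by blast
      qed
    next
      case 2
      have yR: "- int (m * nI) \<le> y" using xy by simp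
      then have Ine: "I \<noteq> []" using block_of_left[OF yR 2] by blast
      show ?thesis
      proof (cases "x < int b")
        case True
        have "y < int b" using 2 m0 by linarith
        then show ?thesis using IQ[OF Ine xy(1,2) True] by blast
      next
        case False
        note p = core_position_left[OF yR 2]
        have pK: "core_position y \<in> ?K" using p m0 s_ge unfolding atLeastLessThan_iff by linarith
        have "Q x (core_position y)"
        proof (cases "x \<in> ?K")
          case True
          then show ?thesis using coreQ pK by blast
        next
          case False
          then have xr: "s + int (c * nT) \<le> x" "x < s + int (m * nT)" using xy \<open>\<not> x < int b\<close> m0 unfolding atLeastLessThan_iff by linarith+
          have "core_position x \<in> ?K" using core_position_right[OF xr] m0 s_ge unfolding atLeastLessThan_iff by linarith
          then have "Q (core_position y) (core_position x)" using coreQ pK by blast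
          moreover have "core_position y \<in> {- int (m * nI)..<s}"
            using p s_ge range_mono(1)[OF cm] unfolding atLeastLessThan_iff by linarith
          ultimately show ?thesis using right[OF _ xr] sym by blast
        qed
        moreover have "x \<in> {0..<s + int (m * nT)}" using xy False unfolding atLeastLessThan_iff by linarith
        ultimately show ?thesis using left[OF _ yR 2] by blast
      qed
    qed
  qed
  have "Q x y" if "x \<in> ?R" "y \<in> ?R" for x y
    using coreQ far[OF that] sym[OF far[OF that(2,1)]] by blast
  then show ?thesis unfolding same_order_on_def Q_def by blast
qed

end

section \<open>Bicycles without splittable pairs\<close>

text \<open>Dickson's lemma in dimension two.  An index with least \<open>a\<close> will do, unless its value of
  \<open>z\<close> exceeds all others; then some value of \<open>z\<close> recurs infinitely often, and among these indices one with least
  \<open>a\<close> will do.\<close>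

lemma dickson:
  fixes a z :: "nat \<Rightarrow> nat"
  assumes "infinite S"
  shows "\<exists>i\<in>S. \<exists>j\<in>S. i \<noteq> j \<and> a i \<le> a j \<and> z i \<le> z j"
proof -
  have least: "\<exists>i\<in>S'. \<forall>j\<in>S'. a i \<le> a j" if "infinite S'" for S' :: "nat set"
  proof -
    have "\<exists>x. x \<in> S'" using that by (metis finite.emptyI ex_in_conv)
    then obtain i where "i \<in> S'" "\<forall>j. j \<in> S' \<longrightarrow> a i \<le> a j"
      using ex_has_least_nat[of "\<lambda>x. x \<in> S'" _ a] by blast
    then show ?thesis by blast
  qed
  obtain i where i: "i \<in> S" "\<forall>j\<in>S. a i \<le> a j" using least[OF assms] by blast
  show ?thesis
  proof (cases "\<exists>j\<in>S. j \<noteq> i \<and> z i \<le> z j")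
    case True
    then show ?thesis using i by metis
  next
    case False
    then have "z ` S \<subseteq> {..z i}" by force
    then have "finite (z ` S)" using finite_subset by blast
    then obtain k where "infinite {j \<in> S. z j = z k}"
      using pigeonhole_infinite[OF assms] by blast
    then obtain S' where S': "infinite S'" "S' = {j \<in> S. z j = z k}" by blast
    obtain i' where i': "i' \<in> S'" "\<forall>j\<in>S'. a i' \<le> a j" using least[OF S'(1)] by blast
    have "infinite (S' - {i'})" using S'(1) by simp
    then obtain j where "j \<in> S'" "j \<noteq> i'" by (metis Diff_iff finite.emptyI ex_in_conv insertCI)
    then show ?thesis using i' S'(2) by (intro bexI[of _ i'] bexI[of _ j]) auto
  qed
qed

context rigid_bicycle
begin

text \<open>The path of the permutation can be prolonged on both sides to one of a balanced permutation,
  and realisations extend.\<close>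

lemma stretch_of_balanced:
  assumes "\<sigma> \<in> C" "b \<le> length \<sigma>" "path_of b \<sigma> \<in> paths B"
  shows "\<exists>m h lo len. balanced_model m h \<and> \<sigma> = pattern h lo len \<and>
    - int (m * nI) \<le> lo \<and> lo + int len \<le> s + int (m * nT) \<and>
    lo \<le> e + int (length T) \<and> lo + int len \<ge> - int (length I)"
proof -
  obtain lo where lo: "path_of b \<sigma> = window u lo (length (path_of b \<sigma>))"
    "in_span I P T lo (lo + int (length (path_of b \<sigma>)))" "lo \<le> e + int (length T)"
    "lo + int (length (path_of b \<sigma>)) \<ge> - int (length I)"
    using path_is_window[OF assms(3)] by blast
  define N where "N = length (path_of b \<sigma>)"
  define len where "len = N + b - 1"
  have N: "N \<ge> 1" by (simp add: N_def path_of_def)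
  have "\<sigma> \<in> perms_of b (window u lo N)"
    using path_of_in_paths(2)[OF assms(1,2)] lo(1) by (simp add: N_def)
  then obtain h0 where h0: "realises b u h0 lo (lo + int len)" "\<sigma> = pattern h0 lo len"
    using perms_of_windowE[OF _ N] unfolding len_def by metis
  have lenN: "int len = int N + int b - 1" using N by (simp add: len_def)
  define m where "m = c + 3 + nat \<bar>lo\<bar> + nat \<bar>lo + int len\<bar>"
  have mc: "m \<ge> c" "m \<ge> 3" by (auto simp: m_def)
  have left: "- int (m * nI) \<le> lo"
  proof (cases "I = []")
    case True
    then show ?thesis using lo(2) by (simp add: in_span_def)
  next
    case False
    then have "m * 1 \<le> m * nI" using nI_pos b_pos by (intro mult_le_mono2) force
    then have "int (m * 1) \<le> int (m * nI)" by (rule of_nat_mono)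
    then have "int m \<le> int (m * nI)" unfolding mult_1_right .
    then show ?thesis unfolding m_def by linarith
  qed
  have right: "lo + int len \<le> s + int (m * nT)"
  proof (cases "T = []")
    case True
    then show ?thesis using lo(2) lenN by (simp add: in_span_def N_def)
  next
    case False
    then have "m * 1 \<le> m * nT" using nT_pos b_pos by (intro mult_le_mono2) force
    then have "int (m * 1) \<le> int (m * nT)" by (rule of_nat_mono)
    then have "int m \<le> int (m * nT)" unfolding mult_1_right .
    moreover have "0 \<le> s" using s_ge by linarith
    ultimately show ?thesis unfolding m_def by linarith
  qed
  define K where "K = m * nI + length P + m * nT"
  have K: "- int (m * nI) + int (K + b - 1) = s + int (m * nT)"
    using balanced_size[of m] by (simp add: K_def)
  have "chain b u (- int (m * nI)) (- int (m * nI) + int (K + b - 1))"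
  proof (rule window_chain[OF window_in_paths_G])
    show "in_span I P T (- int (m * nI)) (- int (m * nI) + int K)"
      by (auto simp: in_span_def K_def)
  qed (use P in \<open>cases P; auto simp: K_def\<close>)+
  then have "chain b u (- int (m * nI)) (s + int (m * nT))" unfolding K .
  moreover have "lo + int len - lo \<ge> int b" using lenN N by simp
  ultimately obtain h where h: "realises b u h (- int (m * nI)) (s + int (m * nT))"
    "same_order_on {lo..<lo + int len} h0 h"
    using realises_extend[OF b_pos _ _ h0(1) left right] by blast
  have "\<sigma> = pattern h lo len"
    using h0(2) pattern_cong_same_order[OF h(2) realisesD(1)[OF h0(1)]] by simp
  moreover have "balanced_model m h" using h(1) mc by (simp add: balanced_model_def)
  moreover have "lo + int len \<ge> - int (length I)" using lo(4) lenN b_pos by (simp add: N_def)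
  ultimately show ?thesis using left right lo(3) by blast
qed

lemma balanced_model_mono:
  assumes "balanced_model m h" "m' \<le> m" "c \<le> m' \<and> 3 \<le> m'"
  shows "balanced_model m' h"
  using assms realises_subset[OF _ range_mono[OF assms(2)]] unfolding balanced_model_def by blast

text \<open>If two balanced permutations have the same core, then a stretch of one is contained in a stretch
  of the other as soon as this is so for their end points, counted from the connecting path.  There
  are only finitely many cores, and Dickson's lemma takes care of the end points.\<close>

lemma unsplittable_no_antichain:
  fixes f :: "nat \<Rightarrow> nat list"
  assumes un: unsplittable and S: "infinite S"
    and f: "\<And>k. k \<in> S \<Longrightarrow> f k \<in> C \<and> b \<le> length (f k) \<and> path_of b (f k) \<in> paths B"
  shows "\<exists>i\<in>S. \<exists>j\<in>S. i \<noteq> j \<and> f i \<le>\<^sub>f f j"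
proof -
  have "\<forall>k\<in>S. \<exists>m h lo len. balanced_model m h \<and> f k = pattern h lo len \<and>
    - int (m * nI) \<le> lo \<and> lo + int len \<le> s + int (m * nT) \<and>
    lo \<le> e + int (length T) \<and> lo + int len \<ge> - int (length I)"
    using f stretch_of_balanced by blast
  then obtain m h lo len where bal: "\<And>k. k \<in> S \<Longrightarrow> balanced_model (m k) (h k)"
    and pat: "\<And>k. k \<in> S \<Longrightarrow> f k = pattern (h k) (lo k) (len k)"
    and inside: "\<And>k. k \<in> S \<Longrightarrow> - int (m k * nI) \<le> lo k \<and> lo k + int (len k) \<le> s + int (m k * nT)"
    and ends: "\<And>k. k \<in> S \<Longrightarrow> lo k \<le> e + int (length T) \<and> lo k + int (len k) \<ge> - int (length I)"
    by metis
  define cs where "cs = c * nI + length P + c * nT + b - 1"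
  have cs: "- int (c * nI) + int cs = s + int (c * nT)"
    using balanced_size[of c] unfolding cs_def by linarith
  define \<kappa> where "\<kappa> k = pattern (h k) (- int (c * nI)) cs" for k
  have core_inj: "inj_on (h k) {- int (c * nI)..<- int (c * nI) + int cs}" if "k \<in> S" for k
    using realisesD(1)[OF balanced_model_core[OF bal[OF that]]] unfolding cs .
  have "\<kappa> ` S \<subseteq> {xs. set xs \<subseteq> {1..cs} \<and> length xs = cs}"
    using pattern_perms[OF core_inj] length_pattern[OF core_inj] by (auto simp: \<kappa>_def perms_def)
  then have "finite (\<kappa> ` S)" by (rule finite_subset) (rule finite_lists_length_eq, simp)
  from pigeonhole_infinite[OF S this] obtain k0 where "infinite {k \<in> S. \<kappa> k = \<kappa> k0}" by blast
  from dickson[OF this, of "\<lambda>k. nat (e + int (length T) - lo k)" "\<lambda>k. nat (lo k + int (len k) + int (length I))"]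
  obtain i j where ij: "i \<in> S" "j \<in> S" "\<kappa> i = \<kappa> j" "i \<noteq> j"
    and le: "nat (e + int (length T) - lo i) \<le> nat (e + int (length T) - lo j)"
      "nat (lo i + int (len i) + int (length I)) \<le> nat (lo j + int (len j) + int (length I))" by auto
  have sub: "lo j \<le> lo i" "lo i + int (len i) \<le> lo j + int (len j)"
    using le ends[OF ij(1)] ends[OF ij(2)] by linarith+
  define m0 where "m0 = min (m i) (m j)"
  have m0: "m0 \<le> m i" "m0 \<le> m j" "m0 = m i \<or> m0 = m j" unfolding m0_def by linarith+
  have bal0: "balanced_model m0 (h i)" "balanced_model m0 (h j)"
  proof -
    have "c \<le> m0 \<and> 3 \<le> m0"
      using bal[OF ij(1)] bal[OF ij(2)] m0(3) unfolding balanced_model_def by metis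
    then show "balanced_model m0 (h i)" "balanced_model m0 (h j)"
      using balanced_model_mono[OF bal m0(1)] balanced_model_mono[OF bal m0(2)] ij by blast+
  qed
  have "same_order_on {- int (c * nI)..<s + int (c * nT)} (h i) (h j)"
    using ij(3) pattern_eq_iff[OF core_inj[OF ij(1)] core_inj[OF ij(2)]] unfolding \<kappa>_def cs by simp
  from core_determines[OF un bal0 this]
  have same: "same_order_on {- int (m0 * nI)..<s + int (m0 * nT)} (h i) (h j)" .
  have "- int (m0 * nI) \<le> lo i" "lo i + int (len i) \<le> s + int (m0 * nT)"
    using m0(3) inside[OF ij(1)] inside[OF ij(2)] sub by auto
  then have same_i: "same_order_on {lo i..<lo i + int (len i)} (h i) (h j)"
    by (intro same_order_on_subset[OF same]) auto
  have inj: "inj_on (h k) {lo k..<lo k + int (len k)}" if "k \<in> S" for k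
    using bal[OF that] inside[OF that] realisesD(1) unfolding balanced_model_def
    by (elim conjE, intro inj_on_subset[OF realisesD(1)]) auto
  have "pattern (h i) (lo i) (len i) \<le>\<^sub>f pattern (h j) (lo j) (len j)"
    unfolding consec_subperm_pattern_iff[OF inj[OF ij(2)] inj[OF ij(1)]]
  proof (intro exI[of _ "nat (lo i - lo j)"] conjI)
    show "nat (lo i - lo j) + len i \<le> len j" using sub by linarith
    have "lo j - lo i + int (nat (lo i - lo j)) = 0" using sub by simp
    then show "same_order_on {lo i..<lo i + int (len i)} (h i)
        (\<lambda>x. h j (x + (lo j - lo i + int (nat (lo i - lo j)))))" using same_i by simp
  qed
  then show ?thesis using ij pat by auto
qed

end

section \<open>The characterisation\<close>

context finitely_based
begin

lemma well_quasi_order_no_splittable_pair: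
  assumes wqo: "well_quasi_ordered_on (\<le>\<^sub>f) C" and sub: "subgraph (with_proj B) (with_proj G)"
  shows "\<not> has_splittable_pair b B"
proof
  assume "has_splittable_pair b B"
  then obtain I P T where parts: "bicycle_parts B I P T"
    and split: "I \<noteq> [] \<and> (\<exists>g. initial_splittable b B I P T g) \<or> T \<noteq> [] \<and> (\<exists>g. terminal_splittable b B I P T g)"
    unfolding has_splittable_pair_def by blast
  interpret rigid_bicycle C b B I P T
    by unfold_locales (rule parts sub well_quasi_order_rigid_cycles[OF wqo])+
  show False
    using split well_quasi_order_not_initial_splittable[OF wqo] well_quasi_order_not_terminal_splittable[OF wqo]
    by blast
qed

lemma well_quasi_order_if_no_splittable_pair:
  assumes bi: "\<forall>B\<in>set Bs. bicycle B" and dec: "path_complete_decomposition G Bs"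
    and amb: "\<nexists>\<pi>. path_cycle G \<pi> \<and> ambiguous b \<pi>"
    and split: "\<forall>B\<in>set Bs. \<not> has_splittable_pair b B"
  shows "well_quasi_ordered_on (\<le>\<^sub>f) C"
  unfolding well_quasi_ordered_on_perms_iff[OF C_perms]
proof (intro allI impI)
  fix f :: "nat \<Rightarrow> nat list" assume f: "range f \<subseteq> C"
  have fp: "f k \<in> perms" for k using f C_perms by blast
  have "\<forall>k. b \<le> length (f k) \<longrightarrow> (\<exists>B\<in>set Bs. path_of b (f k) \<in> paths B)"
    using f path_of_in_paths(1) dec unfolding path_complete_decomposition_def by blast
  then obtain B where B: "\<And>k. b \<le> length (f k) \<Longrightarrow> B k \<in> set Bs \<and> path_of b (f k) \<in> paths (B k)" by metis
  define colour where "colour k = (if b \<le> length (f k) then Inr (B k) else Inl (f k))" for k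
  have "range colour \<subseteq> Inl ` {xs. set xs \<subseteq> {1..b} \<and> length xs \<le> b} \<union> Inr ` set Bs"
  proof
    fix x assume "x \<in> range colour"
    then obtain k where k: "x = colour k" by blast
    show "x \<in> Inl ` {xs. set xs \<subseteq> {1..b} \<and> length xs \<le> b} \<union> Inr ` set Bs"
    proof (cases "b \<le> length (f k)")
      case True
      then show ?thesis using B k by (simp add: colour_def)
    next
      case False
      then have "set (f k) \<subseteq> {1..b}" using fp[of k] by (auto simp: perms_def)
      then show ?thesis using False k by (simp add: colour_def)
    qed
  qed
  moreover have "finite (Inl ` {xs. set xs \<subseteq> {1..b} \<and> length xs \<le> b} \<union> Inr ` set Bs)"
    using finite_lists_length_le[of "{1..b}" b] by simp
  ultimately have "finite (range colour)" using finite_subset by blast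
  then obtain k0 where inf: "infinite {k \<in> UNIV. colour k = colour k0}"
    using pigeonhole_infinite[OF infinite_UNIV_nat] by blast
  define S where "S = {k. colour k = colour k0}"
  have S: "infinite S" using inf by (simp add: S_def)
  show "\<exists>m n. m \<noteq> n \<and> f m \<le>\<^sub>f f n"
  proof (cases "b \<le> length (f k0)")
    case False
    have "infinite (S - {k0})" using S by simp
    then obtain k where "k \<in> S" "k \<noteq> k0" by (metis Diff_iff finite.emptyI ex_in_conv insertCI)
    then have "f k = f k0" using False by (auto simp: S_def colour_def split: if_splits)
    then show ?thesis using \<open>k \<noteq> k0\<close> consec_subperm_refl[OF fp] by metis
  next
    case True
    have SB: "b \<le> length (f k) \<and> B k = B k0" if "k \<in> S" for k
      using that True by (auto simp: S_def colour_def split: if_splits)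
    have B0: "B k0 \<in> set Bs" using B True by blast
    then obtain I P T where parts: "bicycle_parts (B k0) I P T" using bi unfolding bicycle_def by blast
    have sub: "subgraph (with_proj (B k0)) (with_proj G)"
      using B0 dec by (auto simp: path_complete_decomposition_def)
    interpret rigid_bicycle C b "B k0" I P T
      by unfold_locales (rule parts sub no_ambiguous_cycle_rigid_cycles[OF amb])+
    have unsplittable
      using split B0 parts unfolding unsplittable_def has_splittable_pair_def by blast
    moreover have "f k \<in> C \<and> b \<le> length (f k) \<and> path_of b (f k) \<in> paths (B k0)" if "k \<in> S" for k
      using SB[OF that] B[of k] f by auto
    ultimately show ?thesis using unsplittable_no_antichain[OF _ S] by blast
  qed
qed

end

text \<open>The window of length \<open>b\<close> is the one that starts at the occurrence of \<open>\<tau>\<close>, unless it would stick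
  out at the end.\<close>

lemma consec_subperm_of_window:
  assumes "\<tau> \<le>\<^sub>f \<sigma>" "\<sigma> \<in> perms" "length \<tau> \<le> b" "b \<le> length \<sigma>"
  shows "\<exists>k. k + b \<le> length \<sigma> \<and> \<tau> \<le>\<^sub>f standardize (take b (drop k \<sigma>))"
proof -
  let ?h = "model_of \<sigma> 0"
  note inj = inj_model_of[OF assms(2), of 0] and pat = pattern_model_of[OF assms(2), of 0]
  obtain i where i: "i + length \<tau> \<le> length \<sigma>" "\<tau> = standardize (take (length \<tau>) (drop i \<sigma>))"
    using assms(1) by (auto simp: consec_subperm_def)
  define k where "k = min i (length \<sigma> - b)"
  have k: "k + b \<le> length \<sigma>" "k \<le> i" "i - k + length \<tau> \<le> b" using assms(3,4) i(1) by (auto simp: k_def)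
  have w: "standardize (take b (drop k \<sigma>)) = pattern ?h (int k) b"
    using pattern_window[OF inj k(1)] pat by simp
  have injk: "inj_on ?h {int k..<int k + int b}" by (rule inj_on_subset[OF inj]) (use k in auto)
  have "standardize (take (length \<tau>) (drop (i - k) (pattern ?h (int k) b))) = pattern ?h (int k + int (i - k)) (length \<tau>)"
    by (rule pattern_window[OF injk k(3)])
  also have "int k + int (i - k) = int i" using k(2) by simp
  also have "pattern ?h (int i) (length \<tau>) = \<tau>"
    using pattern_window[OF inj i(1)] pat i(2) by simp
  finally have "\<tau> \<le>\<^sub>f pattern ?h (int k) b"
    unfolding consec_subperm_def length_pattern[OF injk] using k(3) by metis
  then show ?thesis using k(1) w by metis
qed

lemma basis_below:
  assumes "\<sigma> \<in> perms - C"
  shows "\<exists>\<tau>\<in>basis C. \<tau> \<le>\<^sub>f \<sigma>"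
proof -
  define M where "M \<tau> \<longleftrightarrow> \<tau> \<in> perms - C \<and> \<tau> \<le>\<^sub>f \<sigma>" for \<tau>
  have "M \<sigma>" using assms consec_subperm_refl by (auto simp: M_def)
  then obtain \<tau> where \<tau>: "M \<tau>" "\<And>\<rho>. M \<rho> \<Longrightarrow> length \<tau> \<le> length \<rho>"
    using ex_has_least_nat[of M \<sigma> length] by blast
  have "\<tau> \<in> basis C"
    unfolding basis_def
  proof (intro CollectI conjI ballI impI)
    show "\<tau> \<in> perms - C" using \<tau>(1) by (simp add: M_def)
    fix \<rho> assume \<rho>: "\<rho> \<in> perms - C" "\<rho> \<le>\<^sub>f \<tau>"
    then have "M \<rho>" using consec_subperm_trans[OF \<rho>(2)] \<tau>(1) assms by (auto simp: M_def)
    then have "length \<rho> = length \<tau>" using \<tau>(2) consec_subperm_length[OF \<rho>(2)] by force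
    then show "\<rho> = \<tau>" using consec_subperm_eq_length[OF \<rho>(2)] \<tau>(1) by (auto simp: M_def)
  qed
  then show ?thesis using \<tau>(1) by (auto simp: M_def)
qed

theorem theorem7p20:
  fixes C :: "nat list set" and b :: nat
  assumes "C \<subseteq> perms"
    and "downward_closed C"
    and "finite (basis C)" and "basis C \<noteq> {}"
    and "b = Max (length ` basis C)"
  shows "well_quasi_ordered_on (\<le>\<^sub>f) C \<longleftrightarrow>
    (\<exists>Bs. ((\<forall>B\<in>set Bs. bicycle B) \<and> path_complete_decomposition (factor_graph b C) Bs) \<and>
          (\<nexists>\<pi>. path_cycle (factor_graph b C) \<pi> \<and> ambiguous b \<pi>) \<and>
          (\<forall>B\<in>set Bs. \<not> has_splittable_pair b B))"
proof (cases "b \<ge> 2")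
  case True
  interpret finitely_based C b
  proof
    fix \<sigma> assume \<sigma>: "\<sigma> \<in> perms" "b \<le> length \<sigma>"
      and local: "\<And>k. k + b \<le> length \<sigma> \<Longrightarrow> standardize (take b (drop k \<sigma>)) \<in> C"
    show "\<sigma> \<in> C"
    proof (rule ccontr)
      assume "\<sigma> \<notin> C"
      then obtain \<tau> where \<tau>: "\<tau> \<in> basis C" "\<tau> \<le>\<^sub>f \<sigma>" using basis_below \<sigma>(1) by blast
      have "length \<tau> \<le> b" using \<tau>(1) assms(3,5) by simp
      then obtain k where "k + b \<le> length \<sigma>" "\<tau> \<le>\<^sub>f standardize (take b (drop k \<sigma>))"
        using consec_subperm_of_window[OF \<tau>(2) \<sigma>(1) _ \<sigma>(2)] by blast
      then have "\<tau> \<in> C" using local assms(2) \<tau>(1) unfolding downward_closed_def basis_def by blast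
      then show False using \<tau>(1) by (simp add: basis_def)
    qed
  qed (use assms True in auto)
  show ?thesis
  proof
    assume wqo: "well_quasi_ordered_on (\<le>\<^sub>f) C"
    obtain Bs where Bs: "\<forall>B\<in>set Bs. bicycle B" "path_complete_decomposition G Bs"
      using bicycle_decomposition[OF finite_verts G_wf well_quasi_order_free[OF wqo]] by blast
    moreover have "\<nexists>\<pi>. path_cycle G \<pi> \<and> ambiguous b \<pi>"
      using rigid_cycles_no_ambiguous_cycle[OF well_quasi_order_rigid_cycles[OF wqo] Bs(2,1)] .
    moreover have "\<not> has_splittable_pair b B" if "B \<in> set Bs" for B
      using well_quasi_order_no_splittable_pair[OF wqo] Bs(2) that
      by (auto simp: path_complete_decomposition_def)
    ultimately show "\<exists>Bs. ((\<forall>B\<in>set Bs. bicycle B) \<and> path_complete_decomposition G Bs) \<and>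
          (\<nexists>\<pi>. path_cycle G \<pi> \<and> ambiguous b \<pi>) \<and> (\<forall>B\<in>set Bs. \<not> has_splittable_pair b B)" by blast
  qed (use well_quasi_order_if_no_splittable_pair in blast)
next
  case False
  \<comment> \<open>The only permutation of length \<open>b \<le> 1\<close> is the basis element, so \<open>C \<subseteq> {[]}\<close>.\<close>
  have "b \<in> length ` basis C" unfolding assms(5) by (rule Max_in) (use assms(3,4) in auto)
  then obtain \<tau> where \<tau>: "\<tau> \<in> basis C" "length \<tau> = b" by blast
  have short: "length \<sigma> < b" if "\<sigma> \<in> C" for \<sigma>
  proof (rule ccontr)
    assume "\<not> length \<sigma> < b"
    then have len: "b \<le> length \<sigma>" by simp
    have \<tau>p: "\<tau> \<in> perms" "\<tau> \<notin> C" using \<tau>(1) by (auto simp: basis_def)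
    have \<sigma>p: "\<sigma> \<in> perms" using that assms(1) by blast
    have dist: "distinct (take b (drop 0 \<sigma>))" using \<sigma>p by (simp add: perms_def)
    have l1: "length (take b (drop 0 \<sigma>)) = b" using len by simp
    have "i = j" if "i < b" "j < b" for i j using that False by linarith
    then have "standardize (take b (drop 0 \<sigma>)) = \<tau>"
      using \<tau>(2) \<tau>p(1) l1 by (intro standardize_eqI[OF dist]) (auto simp: less_irrefl)
    then have "\<tau> \<le>\<^sub>f \<sigma>" using len \<tau>(2) unfolding consec_subperm_def by (intro exI[of _ 0]) simp
    then show False using \<tau>p that assms(2) by (auto simp: downward_closed_def)
  qed
  have "\<sigma> = []" if "\<sigma> \<in> C" for \<sigma>
  proof -
    have "length \<sigma> = 0" using short[OF that] False by linarith
    then show ?thesis by simp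
  qed
  then have C: "C \<subseteq> {[]}" by blast
  have "pverts (factor_graph b C) = {}" using short by (auto simp: factor_graph_def)
  then have paths: "paths (factor_graph b C) = {}" by (auto simp: in_paths_iff)
  have "f 0 \<le>\<^sub>f f 1" if "range f \<subseteq> C" for f :: "nat \<Rightarrow> nat list"
  proof -
    have "f 0 = []" "f 1 = []" using that C by auto
    then show ?thesis using consec_subperm_refl[of "[]"] by (simp add: perms_def)
  qed
  then have "well_quasi_ordered_on (\<le>\<^sub>f) C"
    unfolding well_quasi_ordered_on_perms_iff[OF assms(1)] by (metis zero_neq_one)
  moreover have "path_complete_decomposition (factor_graph b C) []"
    using paths by (simp add: path_complete_decomposition_def)
  moreover have "\<nexists>\<pi>. path_cycle (factor_graph b C) \<pi> \<and> ambiguous b \<pi>"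
    using paths by (simp add: path_cycle_def)
  ultimately show ?thesis by (intro iffI exI[of _ "[]"]) auto
qed

end
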